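(* Let $n\ge 1$ and let $\pi: X\to\mathbb{P}^n$ be a cyclic covering (over $\mathbb{C}$) of degree $d$, branched over a smooth hypersurface of degree $d\cdot k$ for some natural number $k$ (so that $X$ is smooth). Then there exists an Ulrich vector bundle on $X$ for $\pi$, i.e. a vector bundle $E$ on $X$ with $\pi_*E\cong\mathcal{O}_{\mathbb{P}^n}^{\oplus \operatorname{rk}(E)\cdot d}$.
   Context: Everything is over $\mathbb{C}$. Cyclic covering of $\mathbb{P}^n$: let $d,k$ be positive integers and $f\in H^0(\mathbb{P}^n,\mathcal{O}_{\mathbb{P}^n}(d\cdot k))$ with zero locus $B$. Let $p: V=\operatorname{Spec}(\operatorname{Sym}(\mathcal{O}_{\mathbb{P}^n}(-k)))\to\mathbb{P}^n$ be the total space of $\mathcal{O}_{\mathbb{P}^n}(k)$ and $T$ the tautological section of $p^*\mathcal{O}_{\mathbb{P}^n}(k)$. The cyclic covering of degree $d$ with branch divisor $B$ is $X=\operatorname{Zero}(T^d-p^*f)\subset V$ with $\pi=p|_X: X\to\mathbb{P}^n$. (Equivalently, $X$ is the hypersurface $t^d=f$ in the weighted projective space $\mathbb{P}(1,\dots,1,k)$.) $X$ is smooth if and only if $B$ is smooth. Ulrich bundle: for a finite surjective map $\pi: X\to\mathbb{P}^n$, an Ulrich bundle on $X$ is a vector bundle $E$ of positive rank on $X$ such that $\pi_*E\cong\mathcal{O}_{\mathbb{P}^n}^{\oplus \operatorname{rk}(E)\cdot\deg(\pi)}$. *)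

theory Defs
  imports "HOL-Analysis.Analysis" "HOL-Algebra.Module"
begin

text \<open>
  Varieties over the complex numbers are treated classically, as spaces with functions: a Zariski
  topology on the set of closed points, together with the complex-valued functions that are
  regular on each open set. Only reduced varieties occur below, and for a reduced scheme of finite
  type over an algebraically closed field the space of closed points with its regular functions
  has the same open sets, the same structure sheaf and the same sheaves of modules.
\<close>

section \<open>Spaces with functions and sheaves of modules\<close>

record 'p fun_space =
  pts_top :: "'p topology"
  reg_fun :: "'p set \<Rightarrow> ('p \<Rightarrow> complex) set"

abbreviation pts :: "'p fun_space \<Rightarrow> 'p set" where
  "pts X \<equiv> topspace (pts_top X)"

abbreviation open_in :: "'p fun_space \<Rightarrow> 'p set \<Rightarrow> bool" where
  "open_in X \<equiv> openin (pts_top X)"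

text \<open>The ring \<open>\<O>\<^sub>X(U)\<close>; its elements take the value \<open>undefined\<close> outside \<open>U\<close>.\<close>

definition struct_ring :: "'p fun_space \<Rightarrow> 'p set \<Rightarrow> ('p \<Rightarrow> complex) ring" where
  "struct_ring X U =
     \<lparr>carrier = reg_fun X U,
      mult = (\<lambda>g h. \<lambda>P\<in>U. g P * h P), one = (\<lambda>P\<in>U. 1),
      zero = (\<lambda>P\<in>U. 0), add = (\<lambda>g h. \<lambda>P\<in>U. g P + h P)\<rparr>"

definition open_subspace :: "'p fun_space \<Rightarrow> 'p set \<Rightarrow> 'p fun_space" where
  "open_subspace X W = X\<lparr>pts_top := subtopology (pts_top X) W\<rparr>"

definition is_morphism :: "'p fun_space \<Rightarrow> 'q fun_space \<Rightarrow> ('p \<Rightarrow> 'q) \<Rightarrow> bool" where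
  "is_morphism X Y \<phi> \<longleftrightarrow>
     continuous_map (pts_top X) (pts_top Y) \<phi> \<and>
     (\<forall>V g. open_in Y V \<longrightarrow> g \<in> reg_fun Y V \<longrightarrow>
        (\<lambda>P\<in>{P \<in> pts X. \<phi> P \<in> V}. g (\<phi> P)) \<in> reg_fun X {P \<in> pts X. \<phi> P \<in> V})"

record ('p, 's) mod_presheaf =
  sect :: "'p set \<Rightarrow> ('p \<Rightarrow> complex, 's) module"
  rstr :: "'p set \<Rightarrow> 'p set \<Rightarrow> 's \<Rightarrow> 's"

text \<open>Sheaves of \<open>\<O>\<^sub>X\<close>-modules; the map \<open>rstr F U V\<close> restricts sections from \<open>U\<close> to \<open>V\<close>.\<close>

locale mod_sheaf =
  fixes X :: "'p fun_space" and F :: "('p, 's) mod_presheaf"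
  assumes sect_module: "open_in X U \<Longrightarrow> Module.module (struct_ring X U) (sect F U)"
    and rstr_closed: "\<lbrakk>open_in X U; open_in X V; V \<subseteq> U; s \<in> carrier (sect F U)\<rbrakk>
          \<Longrightarrow> rstr F U V s \<in> carrier (sect F V)"
    and rstr_add: "\<lbrakk>open_in X U; open_in X V; V \<subseteq> U;
            s \<in> carrier (sect F U); t \<in> carrier (sect F U)\<rbrakk>
          \<Longrightarrow> rstr F U V (s \<oplus>\<^bsub>sect F U\<^esub> t) = rstr F U V s \<oplus>\<^bsub>sect F V\<^esub> rstr F U V t"
    and rstr_smult: "\<lbrakk>open_in X U; open_in X V; V \<subseteq> U;
            g \<in> reg_fun X U; s \<in> carrier (sect F U)\<rbrakk>
          \<Longrightarrow> rstr F U V (g \<odot>\<^bsub>sect F U\<^esub> s) = restrict g V \<odot>\<^bsub>sect F V\<^esub> rstr F U V s"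
    and rstr_id: "\<lbrakk>open_in X U; s \<in> carrier (sect F U)\<rbrakk> \<Longrightarrow> rstr F U U s = s"
    and rstr_comp: "\<lbrakk>open_in X U; open_in X V; open_in X W; W \<subseteq> V; V \<subseteq> U;
            s \<in> carrier (sect F U)\<rbrakk>
          \<Longrightarrow> rstr F V W (rstr F U V s) = rstr F U W s"
    and locality: "\<lbrakk>\<And>U. U \<in> \<U> \<Longrightarrow> open_in X U;
            s \<in> carrier (sect F (\<Union>\<U>)); t \<in> carrier (sect F (\<Union>\<U>));
            \<And>U. U \<in> \<U> \<Longrightarrow> rstr F (\<Union>\<U>) U s = rstr F (\<Union>\<U>) U t\<rbrakk>
          \<Longrightarrow> s = t"
    and gluing: "\<lbrakk>\<And>U. U \<in> \<U> \<Longrightarrow> open_in X U; \<And>U. U \<in> \<U> \<Longrightarrow> \<sigma> U \<in> carrier (sect F U);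
            \<And>U V. U \<in> \<U> \<Longrightarrow> V \<in> \<U>
              \<Longrightarrow> rstr F U (U \<inter> V) (\<sigma> U) = rstr F V (U \<inter> V) (\<sigma> V)\<rbrakk>
          \<Longrightarrow> \<exists>s \<in> carrier (sect F (\<Union>\<U>)). \<forall>U\<in>\<U>. rstr F (\<Union>\<U>) U s = \<sigma> U"

definition sheaf_iso_map ::
  "'p fun_space \<Rightarrow> ('p, 's) mod_presheaf \<Rightarrow> ('p, 't) mod_presheaf \<Rightarrow> ('p set \<Rightarrow> 's \<Rightarrow> 't) \<Rightarrow> bool"
where
  "sheaf_iso_map X F G \<Phi> \<longleftrightarrow>
     (\<forall>U. open_in X U \<longrightarrow>
        bij_betw (\<Phi> U) (carrier (sect F U)) (carrier (sect G U)) \<and>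
        (\<forall>s\<in>carrier (sect F U). \<forall>t\<in>carrier (sect F U).
           \<Phi> U (s \<oplus>\<^bsub>sect F U\<^esub> t) = \<Phi> U s \<oplus>\<^bsub>sect G U\<^esub> \<Phi> U t) \<and>
        (\<forall>g\<in>reg_fun X U. \<forall>s\<in>carrier (sect F U).
           \<Phi> U (g \<odot>\<^bsub>sect F U\<^esub> s) = g \<odot>\<^bsub>sect G U\<^esub> \<Phi> U s) \<and>
        (\<forall>V. open_in X V \<longrightarrow> V \<subseteq> U \<longrightarrow>
           (\<forall>s\<in>carrier (sect F U). \<Phi> V (rstr F U V s) = rstr G U V (\<Phi> U s))))"

definition sheaf_iso ::
  "'p fun_space \<Rightarrow> ('p, 's) mod_presheaf \<Rightarrow> ('p, 't) mod_presheaf \<Rightarrow> bool" where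
  "sheaf_iso X F G \<longleftrightarrow> (\<exists>\<Phi>. sheaf_iso_map X F G \<Phi>)"

text \<open>The free sheaf \<open>\<O>\<^sub>X\<^sup>r\<close>. The multiplication and unit of the module record carry no meaning.\<close>

definition free_sheaf :: "'p fun_space \<Rightarrow> nat \<Rightarrow> ('p, nat \<Rightarrow> 'p \<Rightarrow> complex) mod_presheaf" where
  "free_sheaf X r =
     \<lparr>sect = (\<lambda>U.
        \<lparr>carrier = {..<r} \<rightarrow>\<^sub>E reg_fun X U, mult = undefined, one = undefined,
         zero = (\<lambda>i\<in>{..<r}. \<lambda>P\<in>U. 0), add = (\<lambda>s t. \<lambda>i\<in>{..<r}. \<lambda>P\<in>U. s i P + t i P),
         smult = (\<lambda>g s. \<lambda>i\<in>{..<r}. \<lambda>P\<in>U. g P * s i P)\<rparr>),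
      rstr = (\<lambda>U V s. \<lambda>i\<in>{..<r}. restrict (s i) V)\<rparr>"

text \<open>Vector bundles of constant rank \<open>r\<close>, as locally free sheaves.\<close>

definition vector_bundle :: "'p fun_space \<Rightarrow> nat \<Rightarrow> ('p, 's) mod_presheaf \<Rightarrow> bool" where
  "vector_bundle X r E \<longleftrightarrow> mod_sheaf X E \<and>
     (\<forall>P\<in>pts X. \<exists>W. open_in X W \<and> P \<in> W \<and>
        sheaf_iso (open_subspace X W) E (free_sheaf (open_subspace X W) r))"

definition pushforward ::
  "'p fun_space \<Rightarrow> ('p \<Rightarrow> 'q) \<Rightarrow> ('p, 's) mod_presheaf \<Rightarrow> ('q, 's) mod_presheaf" where
  "pushforward X \<phi> E =
     (let pre = (\<lambda>V. {P \<in> pts X. \<phi> P \<in> V}) in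
      \<lparr>sect = (\<lambda>V.
         \<lparr>carrier = carrier (sect E (pre V)), mult = mult (sect E (pre V)),
          one = one (sect E (pre V)), zero = zero (sect E (pre V)), add = add (sect E (pre V)),
          smult = (\<lambda>g s. (\<lambda>P\<in>pre V. g (\<phi> P)) \<odot>\<^bsub>sect E (pre V)\<^esub> s)\<rparr>),
       rstr = (\<lambda>U V. rstr E (pre U) (pre V))\<rparr>)"

text \<open>Ulrich bundles for a map \<open>\<phi>\<close> from \<open>X\<close> to \<open>Y\<close> of degree \<open>d\<close>.\<close>

definition ulrich_bundle ::
  "'p fun_space \<Rightarrow> 'q fun_space \<Rightarrow> ('p \<Rightarrow> 'q) \<Rightarrow> nat \<Rightarrow> ('p, 's) mod_presheaf \<Rightarrow> bool" where
  "ulrich_bundle X Y \<phi> d E \<longleftrightarrow>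
     (\<exists>r>0. vector_bundle X r E \<and> sheaf_iso Y (pushforward X \<phi> E) (free_sheaf Y (r * d)))"


section \<open>Subvarieties of weighted projective spaces\<close>

type_synonym cvec = "nat \<Rightarrow> complex"

text \<open>Affine \<open>m\<close>-space, with coordinates \<open>x 0, \<dots>, x (m - 1)\<close>.\<close>

definition cvecs :: "nat \<Rightarrow> cvec set" where
  "cvecs m = {x. \<forall>i\<ge>m. x i = 0}"

text \<open>
  Polynomials in \<open>x 0, \<dots>, x (m - 1)\<close> that are homogeneous of degree \<open>e\<close> when \<open>x i\<close> has degree
  \<open>w i\<close>, as functions; over an infinite field a polynomial is determined by its function.
\<close>

definition wforms :: "nat \<Rightarrow> (nat \<Rightarrow> nat) \<Rightarrow> nat \<Rightarrow> (cvec \<Rightarrow> complex) set" where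
  "wforms m w e =
     {F. \<exists>(A :: (nat \<Rightarrow> nat) set) c. finite A \<and> (\<forall>a\<in>A. (\<Sum>i<m. w i * a i) = e) \<and>
           F = (\<lambda>x. \<Sum>a\<in>A. c a * (\<Prod>i<m. x i ^ a i))}"

definition orb :: "(nat \<Rightarrow> nat) \<Rightarrow> cvec \<Rightarrow> cvec set" where
  "orb w x = {(\<lambda>i. l ^ w i * x i) |l. l \<noteq> 0}"

lemma wforms_scale:
  assumes "F \<in> wforms m w e"
  shows "F (\<lambda>i. l ^ w i * x i) = l ^ e * F x"
proof -
  obtain A :: "(nat \<Rightarrow> nat) set" and c
    where A: "\<forall>a\<in>A. (\<Sum>i<m. w i * a i) = e" "F = (\<lambda>x. \<Sum>a\<in>A. c a * (\<Prod>i<m. x i ^ a i))"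
    using assms unfolding wforms_def by blast
  have "(\<Prod>i<m. (l ^ w i * x i) ^ a i) = l ^ e * (\<Prod>i<m. x i ^ a i)" if "a \<in> A" for a
  proof -
    have "(\<Prod>i<m. (l ^ w i * x i) ^ a i) = (\<Prod>i<m. l ^ (w i * a i)) * (\<Prod>i<m. x i ^ a i)"
      by (simp add: power_mult_distrib power_mult prod.distrib)
    also have "(\<Prod>i<m. l ^ (w i * a i)) = l ^ e"
      using A(1) that by (simp add: power_sum[symmetric])
    finally show ?thesis .
  qed
  then show ?thesis
    unfolding A(2) by (simp add: sum_distrib_left mult.left_commute)
qed

lemma wforms_mult:
  assumes "F \<in> wforms m w e" and "G \<in> wforms m w e'"
  shows "(\<lambda>x. F x * G x) \<in> wforms m w (e + e')"
proof -
  obtain A :: "(nat \<Rightarrow> nat) set" and c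
    where A: "finite A" "\<forall>a\<in>A. (\<Sum>i<m. w i * a i) = e"
      "F = (\<lambda>x. \<Sum>a\<in>A. c a * (\<Prod>i<m. x i ^ a i))"
    using assms(1) unfolding wforms_def by blast
  obtain B :: "(nat \<Rightarrow> nat) set" and c'
    where B: "finite B" "\<forall>b\<in>B. (\<Sum>i<m. w i * b i) = e'"
      "G = (\<lambda>x. \<Sum>b\<in>B. c' b * (\<Prod>i<m. x i ^ b i))"
    using assms(2) unfolding wforms_def by blast
  define h where "h = (\<lambda>(a, b). \<lambda>i :: nat. a i + b i :: nat)"
  define c2 where "c2 = (\<lambda>u. \<Sum>p\<in>{p \<in> A \<times> B. h p = u}. c (fst p) * c' (snd p))"
  have "F x * G x = (\<Sum>u\<in>h ` (A \<times> B). c2 u * (\<Prod>i<m. x i ^ u i))" for x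
  proof -
    have "F x * G x = (\<Sum>p\<in>A \<times> B. c (fst p) * (\<Prod>i<m. x i ^ fst p i) *
        (c' (snd p) * (\<Prod>i<m. x i ^ snd p i)))"
      by (simp add: A(3) B(3) sum_product sum.cartesian_product split_beta)
    also have "\<dots> = (\<Sum>p\<in>A \<times> B. c (fst p) * c' (snd p) * (\<Prod>i<m. x i ^ h p i))"
      by (intro sum.cong) (auto simp: h_def power_add prod.distrib mult_ac)
    also have "\<dots> = (\<Sum>u\<in>h ` (A \<times> B). \<Sum>p\<in>{p \<in> A \<times> B. h p = u}.
        c (fst p) * c' (snd p) * (\<Prod>i<m. x i ^ h p i))"
      using A(1) B(1) by (intro sum.image_gen) auto
    also have "\<dots> = (\<Sum>u\<in>h ` (A \<times> B). c2 u * (\<Prod>i<m. x i ^ u i))"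
      by (simp add: c2_def sum_distrib_right)
    finally show ?thesis .
  qed
  moreover have "\<forall>u\<in>h ` (A \<times> B). (\<Sum>i<m. w i * u i) = e + e'"
    using A(2) B(2) by (auto simp: h_def sum.distrib distrib_left)
  moreover have "finite (h ` (A \<times> B))"
    using A(1) B(1) by simp
  ultimately show ?thesis
    unfolding wforms_def by blast
qed

lemma orb_self: "x \<in> orb w x"
  unfolding orb_def by (intro CollectI exI[of _ 1]) simp

lemma wforms_nonzero_orb:
  assumes "F \<in> wforms m w e" and "orb w x = orb w y"
  shows "F x = 0 \<longleftrightarrow> F y = 0"
proof -
  obtain l where "l \<noteq> 0" "x = (\<lambda>i. l ^ w i * y i)"
    using orb_self[of x w] assms(2) unfolding orb_def by blast
  then show ?thesis
    using wforms_scale[OF assms(1), of l y] by simp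
qed

text \<open>
  Let \<open>K\<close> be a subset of affine \<open>m\<close>-space without the origin that is stable under the action of
  the nonzero scalars with weights \<open>w\<close>, and locally closed. Its orbits are the points of a locally
  closed subvariety of the weighted projective space with weights \<open>w\<close>: closed sets are the zero
  sets of weighted homogeneous polynomials, and regular functions are locally quotients of
  weighted homogeneous polynomials of equal degree.
\<close>

definition wzariski_open :: "nat \<Rightarrow> (nat \<Rightarrow> nat) \<Rightarrow> cvec set \<Rightarrow> cvec set set \<Rightarrow> bool" where
  "wzariski_open m w K U \<longleftrightarrow>
     (\<exists>S. S \<subseteq> (\<Union>e. wforms m w e) \<and> U = orb w ` {x \<in> K. \<exists>F\<in>S. F x \<noteq> 0})"

definition wregular ::
  "nat \<Rightarrow> (nat \<Rightarrow> nat) \<Rightarrow> cvec set \<Rightarrow> cvec set set \<Rightarrow> (cvec set \<Rightarrow> complex) set" where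
  "wregular m w K U =
     {g \<in> extensional U. \<forall>P\<in>U. \<exists>W e a b.
        wzariski_open m w K W \<and> P \<in> W \<and> W \<subseteq> U \<and> a \<in> wforms m w e \<and> b \<in> wforms m w e \<and>
        (\<forall>x\<in>K. orb w x \<in> W \<longrightarrow> b x \<noteq> 0 \<and> g (orb w x) = a x / b x)}"

definition wvariety :: "nat \<Rightarrow> (nat \<Rightarrow> nat) \<Rightarrow> cvec set \<Rightarrow> cvec set fun_space" where
  "wvariety m w K =
     \<lparr>pts_top = topology (wzariski_open m w K), reg_fun = wregular m w K\<rparr>"

lemma istopology_wzariski: "istopology (wzariski_open m w K)"
  unfolding istopology_def
proof (intro conjI allI impI)
  fix U V
  assume "wzariski_open m w K U" "wzariski_open m w K V"
  then obtain S T where S: "S \<subseteq> (\<Union>e. wforms m w e)" "U = orb w ` {x \<in> K. \<exists>F\<in>S. F x \<noteq> 0}"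
    and T: "T \<subseteq> (\<Union>e. wforms m w e)" "V = orb w ` {x \<in> K. \<exists>F\<in>T. F x \<noteq> 0}"
    unfolding wzariski_open_def by blast
  define R where "R = {\<lambda>x. F x * G x |F G. F \<in> S \<and> G \<in> T}"
  have "R \<subseteq> (\<Union>e. wforms m w e)"
    using S(1) T(1) unfolding R_def by (blast intro: wforms_mult)
  moreover have "U \<inter> V = orb w ` {x \<in> K. \<exists>H\<in>R. H x \<noteq> 0}"
  proof (intro equalityI subsetI)
    fix P
    assume "P \<in> U \<inter> V"
    then obtain x y F G where *: "P = orb w x" "x \<in> K" "F \<in> S" "F x \<noteq> 0"
      "P = orb w y" "G \<in> T" "G y \<noteq> 0"
      unfolding S(2) T(2) by blast
    then have "G x \<noteq> 0"
      using T(1) wforms_nonzero_orb[of G m w _ x y] by auto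
    with *(4) have "F x * G x \<noteq> 0"
      by simp
    moreover have "(\<lambda>x. F x * G x) \<in> R"
      using *(3,6) unfolding R_def by blast
    ultimately have "\<exists>H\<in>R. H x \<noteq> 0"
      by (rule bexI)
    then show "P \<in> orb w ` {x \<in> K. \<exists>H\<in>R. H x \<noteq> 0}"
      using *(1,2) by simp
  qed (auto simp: S(2) T(2) R_def intro!: imageI)
  ultimately show "wzariski_open m w K (U \<inter> V)"
    unfolding wzariski_open_def by blast
next
  fix \<U>
  assume "\<forall>U\<in>\<U>. wzariski_open m w K U"
  then have "\<exists>S. \<forall>U\<in>\<U>.
      S U \<subseteq> (\<Union>e. wforms m w e) \<and> U = orb w ` {x \<in> K. \<exists>F\<in>S U. F x \<noteq> 0}"
    unfolding wzariski_open_def by (rule bchoice)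
  then obtain S where *: "\<forall>U\<in>\<U>.
      S U \<subseteq> (\<Union>e. wforms m w e) \<and> U = orb w ` {x \<in> K. \<exists>F\<in>S U. F x \<noteq> 0}"
    by (rule exE)
  note S = bspec[OF *]
  have "(\<Union>U\<in>\<U>. U) = (\<Union>U\<in>\<U>. orb w ` {x \<in> K. \<exists>F\<in>S U. F x \<noteq> 0})"
    by (intro SUP_cong refl conjunct2[OF S])
  also have "\<dots> = orb w ` {x \<in> K. \<exists>F\<in>(\<Union>U\<in>\<U>. S U). F x \<noteq> 0}"
    by blast
  finally have "\<Union>\<U> = orb w ` {x \<in> K. \<exists>F\<in>(\<Union>U\<in>\<U>. S U). F x \<noteq> 0}"
    by simp
  moreover have "(\<Union>U\<in>\<U>. S U) \<subseteq> (\<Union>e. wforms m w e)"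
    by (intro UN_least conjunct1[OF S])
  ultimately show "wzariski_open m w K (\<Union>\<U>)"
    unfolding wzariski_open_def by blast
qed

lemma open_in_wvariety: "open_in (wvariety m w K) = wzariski_open m w K"
  by (simp add: wvariety_def istopology_wzariski)

lemma pts_wvariety: "pts (wvariety m w K) = orb w ` K"
proof -
  have "(\<lambda>x. \<Sum>a\<in>{\<lambda>_. 0}. 1 * (\<Prod>i<m. x i ^ a i)) \<in> wforms m w 0"
    unfolding wforms_def by (intro CollectI exI[of _ "{\<lambda>_. 0}"] exI[of _ "\<lambda>_. 1"]) auto
  then have "(\<lambda>x. 1) \<in> wforms m w 0"
    by simp
  then have "wzariski_open m w K (orb w ` K)"
    unfolding wzariski_open_def by (intro exI[of _ "{\<lambda>x. 1}"]) auto
  moreover have "U \<subseteq> orb w ` K" if "wzariski_open m w K U" for U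
    using that unfolding wzariski_open_def by blast
  ultimately show ?thesis
    unfolding topspace_def open_in_wvariety by blast
qed


section \<open>Cyclic coverings of projective space\<close>

definition proj_space :: "nat \<Rightarrow> cvec set fun_space" where
  "proj_space n = wvariety (Suc n) (\<lambda>_. 1) {x \<in> cvecs (Suc n). \<exists>i\<le>n. x i \<noteq> 0}"

text \<open>
  The total space \<open>V\<close> of \<open>\<O>(k)\<close> on projective \<open>n\<close>-space is the quotient of the pairs \<open>(x, t)\<close> with
  \<open>x \<noteq> 0\<close> by \<open>l \<cdot> (x, t) = (l x, l\<^sup>k t)\<close>, that is, the weighted projective space with weights
  \<open>(1, \<dots>, 1, k)\<close> without the point \<open>(0 : \<dots> : 0 : 1)\<close>. The coordinate \<open>t\<close>, stored at index \<open>n + 1\<close>,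
  is the tautological section, and the bundle projection forgets it.
\<close>

definition cov_wt :: "nat \<Rightarrow> nat \<Rightarrow> nat \<Rightarrow> nat" where
  "cov_wt n k i = (if i = Suc n then k else 1)"

definition total_cone :: "nat \<Rightarrow> cvec set" where
  "total_cone n = {x \<in> cvecs (Suc (Suc n)). \<exists>i\<le>n. x i \<noteq> 0}"

definition forget_t :: "nat \<Rightarrow> cvec \<Rightarrow> cvec" where
  "forget_t n x = x(Suc n := 0)"

definition cyclic_cover :: "nat \<Rightarrow> nat \<Rightarrow> nat \<Rightarrow> (cvec \<Rightarrow> complex) \<Rightarrow> cvec set fun_space" where
  "cyclic_cover n d k f =
     wvariety (Suc (Suc n)) (cov_wt n k) {x \<in> total_cone n. x (Suc n) ^ d = f (forget_t n x)}"

text \<open>Forgetting \<open>t\<close> sends an orbit onto an orbit, so no representative has to be chosen.\<close>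

definition cover_map :: "nat \<Rightarrow> cvec set \<Rightarrow> cvec set" where
  "cover_map n P = forget_t n ` P"

lemma cover_map_orb: "cover_map n (orb (cov_wt n k) x) = orb (\<lambda>_. 1) (forget_t n x)"
  (is "?L = ?R")
proof -
  have eq: "forget_t n (\<lambda>i. l ^ cov_wt n k i * x i) = (\<lambda>i. l ^ 1 * forget_t n x i)" for l
    by (auto simp: forget_t_def cov_wt_def)
  have "?L = {forget_t n (\<lambda>i. l ^ cov_wt n k i * x i) |l. l \<noteq> 0}"
    by (auto simp: cover_map_def orb_def)
  also have "\<dots> = ?R"
    by (simp only: eq orb_def)
  finally show ?thesis .
qed

lemma wforms_pullback:
  assumes "F \<in> wforms (Suc n) (\<lambda>_. 1) e"
  shows "(\<lambda>x. F (forget_t n x)) \<in> wforms (Suc (Suc n)) (cov_wt n k) e"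
proof -
  obtain A :: "(nat \<Rightarrow> nat) set" and c
    where A: "finite A" "\<forall>a\<in>A. (\<Sum>i<Suc n. 1 * a i) = e"
      "F = (\<lambda>x. \<Sum>a\<in>A. c a * (\<Prod>i<Suc n. x i ^ a i))"
    using assms unfolding wforms_def by blast
  define h where "h = (\<lambda>a :: nat \<Rightarrow> nat. a(Suc n := 0))"
  define c2 where "c2 = (\<lambda>u. \<Sum>a\<in>{a \<in> A. h a = u}. c a)"
  have "F (forget_t n x) = (\<Sum>u\<in>h ` A. c2 u * (\<Prod>i<Suc (Suc n). x i ^ u i))" for x
  proof -
    have "F (forget_t n x) = (\<Sum>a\<in>A. c a * (\<Prod>i<Suc (Suc n). x i ^ h a i))"
      by (simp add: A(3) h_def forget_t_def)
    also have "\<dots> = (\<Sum>u\<in>h ` A. \<Sum>a\<in>{a \<in> A. h a = u}. c a * (\<Prod>i<Suc (Suc n). x i ^ h a i))"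
      using A(1) by (rule sum.image_gen)
    also have "\<dots> = (\<Sum>u\<in>h ` A. c2 u * (\<Prod>i<Suc (Suc n). x i ^ u i))"
      by (simp add: c2_def sum_distrib_right)
    finally show ?thesis .
  qed
  moreover have "\<forall>u\<in>h ` A. (\<Sum>i<Suc (Suc n). cov_wt n k i * u i) = e"
    using A(2) by (auto simp: h_def cov_wt_def)
  moreover have "finite (h ` A)"
    using A(1) by simp
  ultimately show ?thesis
    unfolding wforms_def by blast
qed

lemma is_morphism_cover_map: "is_morphism (cyclic_cover n d k f) (proj_space n) (cover_map n)"
proof -
  define KX where "KX = {x \<in> total_cone n. x (Suc n) ^ d = f (forget_t n x)}"
  define KP where "KP = {x \<in> cvecs (Suc n). \<exists>i\<le>n. x i \<noteq> 0}"
  let ?wX = "cov_wt n k" and ?wP = "\<lambda>_ :: nat. 1 :: nat"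
  let ?X = "wvariety (Suc (Suc n)) ?wX KX" and ?P = "wvariety (Suc n) ?wP KP"
  have X: "cyclic_cover n d k f = ?X" and P: "proj_space n = ?P"
    by (simp_all add: cyclic_cover_def proj_space_def KX_def KP_def)
  have K: "forget_t n x \<in> KP" if "x \<in> KX" for x
  proof -
    have "\<forall>i\<ge>Suc n. forget_t n x i = 0"
      using that by (auto simp: KX_def total_cone_def forget_t_def cvecs_def)
    moreover have "\<exists>i\<le>n. x i \<noteq> 0"
      using that by (simp add: KX_def total_cone_def)
    then obtain i where "i \<le> n" "x i \<noteq> 0"
      by blast
    then have "i \<le> n \<and> forget_t n x i \<noteq> 0"
      by (simp add: forget_t_def)
    then have "\<exists>i\<le>n. forget_t n x i \<noteq> 0"
      by (rule exI)
    ultimately show ?thesis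
      unfolding KP_def cvecs_def mem_Collect_eq by (rule conjI)
  qed
  have map: "cover_map n Q \<in> pts ?P" if "Q \<in> pts ?X" for Q
    using that K by (auto simp: pts_wvariety cover_map_orb)
  have pre: "open_in ?X {Q \<in> pts ?X. cover_map n Q \<in> V}" if V: "open_in ?P V" for V
  proof -
    obtain S where S: "S \<subseteq> (\<Union>e. wforms (Suc n) ?wP e)" "V = orb ?wP ` {x \<in> KP. \<exists>F\<in>S. F x \<noteq> 0}"
      using V unfolding open_in_wvariety wzariski_open_def by blast
    define T where "T = (\<lambda>F x. F (forget_t n x)) ` S"
    have "T \<subseteq> (\<Union>e. wforms (Suc (Suc n)) ?wX e)"
      using S(1) unfolding T_def by (blast intro: wforms_pullback)
    moreover have "orb ?wP (forget_t n x) \<in> V \<longleftrightarrow> (\<exists>H\<in>T. H x \<noteq> 0)" if "x \<in> KX" for x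
    proof
      assume "orb ?wP (forget_t n x) \<in> V"
      then obtain y F where "orb ?wP (forget_t n x) = orb ?wP y" "F \<in> S" "F y \<noteq> 0"
        unfolding S(2) by blast
      moreover from this have "F (forget_t n x) \<noteq> 0"
        using S(1) wforms_nonzero_orb[of F "Suc n" ?wP _ "forget_t n x" y] by auto
      ultimately show "\<exists>H\<in>T. H x \<noteq> 0"
        unfolding T_def by auto
    next
      assume "\<exists>H\<in>T. H x \<noteq> 0"
      then show "orb ?wP (forget_t n x) \<in> V"
        unfolding S(2) T_def using K[OF that] by auto
    qed
    then have "{Q \<in> pts ?X. cover_map n Q \<in> V} = orb ?wX ` {x \<in> KX. \<exists>H\<in>T. H x \<noteq> 0}"
      by (auto simp: pts_wvariety cover_map_orb)
    ultimately show ?thesis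
      unfolding open_in_wvariety wzariski_open_def by blast
  qed
  have "(\<lambda>Q\<in>{Q \<in> pts ?X. cover_map n Q \<in> V}. g (cover_map n Q))
          \<in> wregular (Suc (Suc n)) ?wX KX {Q \<in> pts ?X. cover_map n Q \<in> V}"
    if g: "g \<in> wregular (Suc n) ?wP KP V" for V g
    unfolding wregular_def
  proof (intro CollectI conjI ballI)
    fix Q
    assume Q: "Q \<in> {Q \<in> pts ?X. cover_map n Q \<in> V}"
    then obtain W e a b where W: "wzariski_open (Suc n) ?wP KP W" "cover_map n Q \<in> W" "W \<subseteq> V"
      and ab: "a \<in> wforms (Suc n) ?wP e" "b \<in> wforms (Suc n) ?wP e"
      and gab: "\<forall>x\<in>KP. orb ?wP x \<in> W \<longrightarrow> b x \<noteq> 0 \<and> g (orb ?wP x) = a x / b x"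
      using g unfolding wregular_def by blast
    let ?W = "{Q \<in> pts ?X. cover_map n Q \<in> W}"
    have "wzariski_open (Suc (Suc n)) ?wX KX ?W"
      using pre[of W] W(1) by (simp add: open_in_wvariety)
    moreover have "Q \<in> ?W" "?W \<subseteq> {Q \<in> pts ?X. cover_map n Q \<in> V}"
      using Q W by auto
    moreover have "\<forall>x\<in>KX. orb ?wX x \<in> ?W \<longrightarrow> b (forget_t n x) \<noteq> 0 \<and>
        (\<lambda>Q\<in>{Q \<in> pts ?X. cover_map n Q \<in> V}. g (cover_map n Q)) (orb ?wX x)
          = a (forget_t n x) / b (forget_t n x)"
      using gab K W(3) by (auto simp: cover_map_orb)
    ultimately show "\<exists>W e a b. wzariski_open (Suc (Suc n)) ?wX KX W \<and> Q \<in> W \<and>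
        W \<subseteq> {Q \<in> pts ?X. cover_map n Q \<in> V} \<and>
        a \<in> wforms (Suc (Suc n)) ?wX e \<and> b \<in> wforms (Suc (Suc n)) ?wX e \<and>
        (\<forall>x\<in>KX. orb ?wX x \<in> W \<longrightarrow> b x \<noteq> 0 \<and>
          (\<lambda>Q\<in>{Q \<in> pts ?X. cover_map n Q \<in> V}. g (cover_map n Q)) (orb ?wX x) = a x / b x)"
      using wforms_pullback[OF ab(1), of k] wforms_pullback[OF ab(2), of k]
      by (intro exI[of _ ?W] exI[of _ e] exI[of _ "\<lambda>x. a (forget_t n x)"]
          exI[of _ "\<lambda>x. b (forget_t n x)"] conjI)
  qed simp
  moreover have "reg_fun ?X = wregular (Suc (Suc n)) ?wX KX" "reg_fun ?P = wregular (Suc n) ?wP KP"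
    by (simp_all add: wvariety_def)
  ultimately show ?thesis
    unfolding is_morphism_def X P continuous_map_def using map pre by auto
qed

text \<open>
  Smoothness of the hypersurface \<open>f = 0\<close> in projective \<open>n\<close>-space, as a scheme, by the Jacobian
  criterion: no point of it is a common zero of all partial derivatives of \<open>f\<close>.
\<close>

definition partial_deriv :: "nat \<Rightarrow> (cvec \<Rightarrow> complex) \<Rightarrow> cvec \<Rightarrow> complex" where
  "partial_deriv i f x = deriv (\<lambda>z. f (x(i := z))) (x i)"

definition smooth_hypersurface :: "nat \<Rightarrow> (cvec \<Rightarrow> complex) \<Rightarrow> bool" where
  "smooth_hypersurface n f \<longleftrightarrow>
     (\<forall>x\<in>cvecs (Suc n). (\<exists>i\<le>n. x i \<noteq> 0) \<longrightarrow> f x = 0 \<longrightarrow> (\<exists>i\<le>n. partial_deriv i f x \<noteq> 0))"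

end

theory Submission
  imports Defs "Jordan_Normal_Form.Determinant"
begin

text \<open>
  The form \<open>f\<close> is a sum of products of \<open>d\<close> forms of degree \<open>k\<close>, so there is a matrix \<open>A\<close> of forms
  of degree \<open>k\<close> with \<open>A ^ d = f\<close> (Backelin, Herzog and Sanders). The Ulrich bundle consists of the
  eigenvectors of \<open>A\<close> with eigenvalue \<open>t\<close>, twisted by \<open>(d - 1) * k\<close>. The matrix
  \<open>\<Phi> = (\<Sum>l<d. t ^ (d - 1 - l) * A ^ l)\<close> maps onto the eigenspaces, and \<open>u \<mapsto> \<Phi> u\<close> trivialises the
  direct image. Its inverse is obtained from the sum of \<open>t * s(x, t)\<close> over the sheets, which equals
  \<open>d * f * u\<close>, and extends over the branch locus. All eigenspaces have the same dimension: \<open>\<Phi>\<close> can be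
  completed to a projector onto the eigenspace whose trace is the size of \<open>A\<close> divided by \<open>d\<close>. Where
  \<open>t \<noteq> 0\<close> this is a multiple of \<open>\<Phi>\<close>, and where \<open>t = 0\<close> it is \<open>A ^ (d - 1) * \<partial>A\<close> divided by \<open>\<partial>f \<noteq> 0\<close>, by
  differentiating \<open>A ^ d = f\<close>.
\<close>

text \<open>A sheaf of modules on \<open>X\<close> whose direct image is free of rank
  \<open>N\<close> is the same thing as an action of \<open>t\<close> on that free sheaf, that is, a
  matrix of forms of degree \<open>k\<close> whose \<open>d\<close>-th power is \<open>f\<close>.
  This is why matrix roots are the heart of the matter. The module that \<open>A\<close> defines is
  the cokernel of \<open>t - A\<close>; since \<open>(t - A) * \<Phi> = t ^ d - A ^ d = 0\<close> on
  \<open>X\<close>, \<open>\<Phi>\<close> carries it to the kernel of \<open>t - A\<close>, and the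
  twist is the degree \<open>(d - 1) * k\<close> of the entries of \<open>\<Phi>\<close>. The kernel
  is preferred because its sections are vector-valued functions on the cone over \<open>X\<close>,
  so that the sheaf axioms become statements about functions. The price is that constancy of the
  rank has to be shown point by point. Where \<open>t \<noteq> 0\<close> it rests on a grading
  modulo \<open>d\<close> that \<open>A\<close> shifts by one: it forces \<open>A ^ l\<close> to
  have trace 0 for \<open>0 < l < d\<close>, so that all \<open>d\<close> eigenvalues have equal
  multiplicity. The obstacle in the direct image is the division by \<open>f\<close>: identities are
  proved where \<open>f \<noteq> 0\<close> and extended by density, and regularity at a branch point
  comes from a denominator that is invariant under the deck transformations.\<close>

hide_const (open) Finite_Cartesian_Product.vec Finite_Cartesian_Product.mat Determinants.det

section \<open>Weighted forms\<close>

lemma wforms_zero: "(\<lambda>x. 0) \<in> wforms m w e"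
  unfolding wforms_def by (intro CollectI exI[of _ "{}"]) simp

lemma wforms_monom:
  assumes "(\<Sum>i<m. w i * a i) = e"
  shows "(\<lambda>x. c * (\<Prod>i<m. x i ^ a i)) \<in> wforms m w e"
  unfolding wforms_def using assms by (intro CollectI exI[of _ "{a}"] exI[of _ "\<lambda>_. c"]) simp

lemma wforms_add:
  assumes "F \<in> wforms m w e" and "G \<in> wforms m w e"
  shows "(\<lambda>x. F x + G x) \<in> wforms m w e"
proof -
  obtain A :: "(nat \<Rightarrow> nat) set" and c
    where A: "finite A" "\<forall>a\<in>A. (\<Sum>i<m. w i * a i) = e"
      "F = (\<lambda>x. \<Sum>a\<in>A. c a * (\<Prod>i<m. x i ^ a i))"
    using assms(1) unfolding wforms_def by blast
  obtain B :: "(nat \<Rightarrow> nat) set" and c'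
    where B: "finite B" "\<forall>b\<in>B. (\<Sum>i<m. w i * b i) = e"
      "G = (\<lambda>x. \<Sum>b\<in>B. c' b * (\<Prod>i<m. x i ^ b i))"
    using assms(2) unfolding wforms_def by blast
  define c2 where "c2 = (\<lambda>a. (if a \<in> A then c a else 0) + (if a \<in> B then c' a else 0))"
  have "F x + G x = (\<Sum>a\<in>A \<union> B. c2 a * (\<Prod>i<m. x i ^ a i))" for x
  proof -
    have "F x = (\<Sum>a\<in>A \<union> B. (if a \<in> A then c a else 0) * (\<Prod>i<m. x i ^ a i))"
      unfolding A(3) using A(1) B(1) by (intro sum.mono_neutral_cong_left) auto
    moreover have "G x = (\<Sum>a\<in>A \<union> B. (if a \<in> B then c' a else 0) * (\<Prod>i<m. x i ^ a i))"
      unfolding B(3) using A(1) B(1) by (intro sum.mono_neutral_cong_left) auto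
    ultimately show ?thesis
      by (simp add: c2_def distrib_right sum.distrib)
  qed
  then show ?thesis
    unfolding wforms_def using A(1,2) B(1,2)
    by (intro CollectI exI[of _ "A \<union> B"] exI[of _ c2]) auto
qed

lemma wforms_induct [consumes 1, case_names zero monom add]:
  assumes "F \<in> wforms m w e"
    and "P (\<lambda>x. 0)"
    and "\<And>c a. (\<Sum>i<m. w i * a i) = e \<Longrightarrow> P (\<lambda>x. c * (\<Prod>i<m. x i ^ a i))"
    and "\<And>F G. \<lbrakk>F \<in> wforms m w e; G \<in> wforms m w e; P F; P G\<rbrakk> \<Longrightarrow> P (\<lambda>x. F x + G x)"
  shows "P F"
proof -
  obtain A :: "(nat \<Rightarrow> nat) set" and c
    where A: "finite A" "\<forall>a\<in>A. (\<Sum>i<m. w i * a i) = e"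
      "F = (\<lambda>x. \<Sum>a\<in>A. c a * (\<Prod>i<m. x i ^ a i))"
    using assms(1) unfolding wforms_def by blast
  \<comment> \<open>Membership is carried along because the case \<open>add\<close> demands that
    both summands be forms.\<close>
  have "(\<lambda>x. \<Sum>a\<in>A. c a * (\<Prod>i<m. x i ^ a i)) \<in> wforms m w e \<and>
      P (\<lambda>x. \<Sum>a\<in>A. c a * (\<Prod>i<m. x i ^ a i))"
    using A(1,2)
  proof (induction A rule: finite_induct)
    case empty
    then show ?case using assms(2) by (simp add: wforms_zero)
  next
    case (insert a A)
    then have "(\<lambda>x. c a * (\<Prod>i<m. x i ^ a i)) \<in> wforms m w e" "P (\<lambda>x. c a * (\<Prod>i<m. x i ^ a i))"
      using assms(3) by (auto intro: wforms_monom)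
    with insert assms(4) wforms_add show ?case
      by simp
  qed
  then show ?thesis
    unfolding A(3) by blast
qed

lemma wforms_const: "(\<lambda>x. c) \<in> wforms m w 0"
  using wforms_monom[where m = m and w = w and a = "\<lambda>_. 0" and e = 0 and c = c] by simp

lemma wforms_coord:
  assumes "i < m"
  shows "(\<lambda>x. x i) \<in> wforms m w (w i)"
proof -
  have "(\<Prod>j<m. x j ^ (if j = i then 1 else 0)) = x i" for x :: cvec
  proof -
    have "(\<Prod>j<m. x j ^ (if j = i then 1 else 0)) = (\<Prod>j<m. if j = i then x j else 1)"
      by (intro prod.cong) auto
    then show ?thesis using assms by simp
  qed
  moreover have "(\<Sum>j<m. w j * (if j = i then 1 else 0)) = (\<Sum>j<m. if j = i then w j else 0)"
    by (intro sum.cong) auto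
  then have "(\<Sum>j<m. w j * (if j = i then 1 else 0)) = w i"
    using assms by simp
  ultimately show ?thesis
    using wforms_monom[where m = m and w = w and a = "\<lambda>j. if j = i then 1 else 0" and e = "w i" and c = 1] by simp
qed

lemma wforms_cmult: "F \<in> wforms m w e \<Longrightarrow> (\<lambda>x. c * F x) \<in> wforms m w e"
  using wforms_mult[OF wforms_const[where c = c], where G = F and m = m and w = w and e' = e] by simp

lemma wforms_uminus: "F \<in> wforms m w e \<Longrightarrow> (\<lambda>x. - F x) \<in> wforms m w e"
  using wforms_cmult[where F = F and c = "-1" and e = e] by simp

lemma wforms_sum:
  "(\<And>i. i \<in> I \<Longrightarrow> F i \<in> wforms m w e) \<Longrightarrow> (\<lambda>x. \<Sum>i\<in>I. F i x) \<in> wforms m w e"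
  by (induction I rule: infinite_finite_induct) (auto intro: wforms_zero wforms_add)

lemma wforms_prod:
  "(\<And>i. i \<in> I \<Longrightarrow> F i \<in> wforms m w (e i)) \<Longrightarrow> (\<lambda>x. \<Prod>i\<in>I. F i x) \<in> wforms m w (\<Sum>i\<in>I. e i)"
  \<comment> \<open>For infinite \<open>I\<close> the product is 1 and the degree sum is 0, which is
    still consistent.\<close>
  by (induction I rule: infinite_finite_induct) (auto intro: wforms_const wforms_mult)

lemma wforms_power: "F \<in> wforms m w e \<Longrightarrow> (\<lambda>x. F x ^ r) \<in> wforms m w (r * e)"
  using wforms_prod[where I = "{..<r}" and F = "\<lambda>_. F" and e = "\<lambda>_. e"] by simp

section \<open>Locally rational functions on a cone\<close>

text \<open>Sections of a nonzero twist are not functions of points, only of representatives, so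
  everything is evaluated on this part of the affine cone.\<close>

definition cone_over :: "(nat \<Rightarrow> nat) \<Rightarrow> cvec set \<Rightarrow> cvec set set \<Rightarrow> cvec set" where
  "cone_over w K U = {x \<in> K. orb w x \<in> U}"

text \<open>
  Sections over \<open>U\<close> of the twist of the structure sheaf by \<open>\<delta>\<close>, as functions on the cone. The
  denominator near a point clears on all of the cone, not only near that point: multiply it by a
  form that vanishes where the local representation fails.
\<close>

definition rat_on ::
  "nat \<Rightarrow> (nat \<Rightarrow> nat) \<Rightarrow> cvec set \<Rightarrow> cvec set set \<Rightarrow> int \<Rightarrow> (cvec \<Rightarrow> complex) \<Rightarrow> bool" where
  "rat_on m w K U \<delta> h \<longleftrightarrow> (\<forall>x0\<in>cone_over w K U. \<exists>e e' a b.
     a \<in> wforms m w e \<and> b \<in> wforms m w e' \<and> int e = int e' + \<delta> \<and> b x0 \<noteq> 0 \<and>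
     (\<forall>x\<in>cone_over w K U. b x * h x = a x))"

lemma cone_over_mono: "V \<subseteq> U \<Longrightarrow> cone_over w K V \<subseteq> cone_over w K U"
  by (auto simp: cone_over_def)

lemma rat_onI:
  assumes "\<And>x0. x0 \<in> cone_over w K U \<Longrightarrow> \<exists>e e' a b.
     a \<in> wforms m w e \<and> b \<in> wforms m w e' \<and> int e = int e' + \<delta> \<and> b x0 \<noteq> 0 \<and>
     (\<forall>x\<in>cone_over w K U. b x * h x = a x)"
  shows "rat_on m w K U \<delta> h"
  using assms unfolding rat_on_def by blast

lemma rat_onE:
  assumes "rat_on m w K U \<delta> h" and "x0 \<in> cone_over w K U"
  obtains e e' a b where "a \<in> wforms m w e" "b \<in> wforms m w e'" "int e = int e' + \<delta>" "b x0 \<noteq> 0"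
    "\<And>x. x \<in> cone_over w K U \<Longrightarrow> b x * h x = a x"
  using assms unfolding rat_on_def by blast

lemma rat_on_subset:
  assumes "rat_on m w K U \<delta> h" and "V \<subseteq> U"
  shows "rat_on m w K V \<delta> h"
proof (rule rat_onI)
  fix x0 assume "x0 \<in> cone_over w K V"
  then have "x0 \<in> cone_over w K U" using cone_over_mono[OF assms(2)] by auto
  then obtain e e' a b where "a \<in> wforms m w e" "b \<in> wforms m w e'" "int e = int e' + \<delta>" "b x0 \<noteq> 0"
    "\<And>x. x \<in> cone_over w K U \<Longrightarrow> b x * h x = a x" by (rule rat_onE[OF assms(1)]) (rule that)
  then show "\<exists>e e' a b. a \<in> wforms m w e \<and> b \<in> wforms m w e' \<and> int e = int e' + \<delta> \<and> b x0 \<noteq> 0 \<and>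
     (\<forall>x\<in>cone_over w K V. b x * h x = a x)"
    using cone_over_mono[OF assms(2)] by blast
qed

lemma rat_on_cong:
  assumes "\<And>x. x \<in> cone_over w K U \<Longrightarrow> h x = h' x"
  shows "rat_on m w K U \<delta> h \<longleftrightarrow> rat_on m w K U \<delta> h'"
  unfolding rat_on_def using assms by (simp cong: ball_cong)

lemma rat_on_form:
  assumes "F \<in> wforms m w e"
  shows "rat_on m w K U (int e) F"
  by (rule rat_onI, intro exI[of _ e] exI[of _ 0] exI[of _ F] exI[of _ "\<lambda>_. 1"])
     (use assms in \<open>auto intro: wforms_const\<close>)

lemma rat_on_const: "rat_on m w K U 0 (\<lambda>_. c)"
  using rat_on_form[OF wforms_const, of m w K U c] by simp

lemma rat_on_zero: "rat_on m w K U (int \<delta>) (\<lambda>_. 0)"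
  using rat_on_form[OF wforms_zero] .

text \<open>The twist is an integer rather than a natural number for the sake of such quotients:
  coordinates in a local frame are divided by a determinant.\<close>

lemma rat_on_inverse_form:
  assumes "F \<in> wforms m w e" and "\<And>x. x \<in> cone_over w K U \<Longrightarrow> F x \<noteq> 0"
  shows "rat_on m w K U (- int e) (\<lambda>x. 1 / F x)"
  by (rule rat_onI, intro exI[of _ 0] exI[of _ e] exI[of _ F] exI[of _ "\<lambda>_. 1"])
     (use assms in \<open>auto intro: wforms_const\<close>)

lemma rat_on_add:
  assumes "rat_on m w K U \<delta> h" and "rat_on m w K U \<delta> h'"
  shows "rat_on m w K U \<delta> (\<lambda>x. h x + h' x)"
proof (rule rat_onI)
  fix x0 assume x0: "x0 \<in> cone_over w K U"
  obtain e e' a b where 1: "a \<in> wforms m w e" "b \<in> wforms m w e'" "int e = int e' + \<delta>" "b x0 \<noteq> 0"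
    "\<And>x. x \<in> cone_over w K U \<Longrightarrow> b x * h x = a x" by (rule rat_onE[OF assms(1) x0]) (rule that)
  obtain f f' c d where 2: "c \<in> wforms m w f" "d \<in> wforms m w f'" "int f = int f' + \<delta>" "d x0 \<noteq> 0"
    "\<And>x. x \<in> cone_over w K U \<Longrightarrow> d x * h' x = c x" by (rule rat_onE[OF assms(2) x0]) (rule that)
  \<comment> \<open>Both quotients have degree \<open>\<delta>\<close>, so the two cross products in
    the common numerator are homogeneous of one degree.\<close>
  have "e + f' = e' + f" using 1(3) 2(3) by linarith
  then have "(\<lambda>x. b x * c x) \<in> wforms m w (e + f')"
    using wforms_mult[OF 1(2) 2(1)] by simp
  then have "(\<lambda>x. a x * d x + b x * c x) \<in> wforms m w (e + f')"
    using wforms_mult[OF 1(1) 2(2)] by (intro wforms_add)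
  moreover have "(\<lambda>x. b x * d x) \<in> wforms m w (e' + f')"
    using 1(2) 2(2) by (rule wforms_mult)
  moreover have "int (e + f') = int (e' + f') + \<delta>" using 1(3) by simp
  moreover have "b x0 * d x0 \<noteq> 0" using 1(4) 2(4) by simp
  moreover have "b x * d x * (h x + h' x) = a x * d x + b x * c x" if "x \<in> cone_over w K U" for x
    unfolding 1(5)[OF that, symmetric] 2(5)[OF that, symmetric] by (simp add: algebra_simps)
  ultimately show "\<exists>e e' a b. a \<in> wforms m w e \<and> b \<in> wforms m w e' \<and> int e = int e' + \<delta> \<and>
      b x0 \<noteq> 0 \<and> (\<forall>x\<in>cone_over w K U. b x * (h x + h' x) = a x)"
    by blast
qed

lemma rat_on_mult:
  assumes "rat_on m w K U \<delta> h" and "rat_on m w K U \<delta>' h'"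
  shows "rat_on m w K U (\<delta> + \<delta>') (\<lambda>x. h x * h' x)"
proof (rule rat_onI)
  fix x0 assume x0: "x0 \<in> cone_over w K U"
  obtain e e' a b where 1: "a \<in> wforms m w e" "b \<in> wforms m w e'" "int e = int e' + \<delta>" "b x0 \<noteq> 0"
    "\<And>x. x \<in> cone_over w K U \<Longrightarrow> b x * h x = a x" by (rule rat_onE[OF assms(1) x0]) (rule that)
  obtain f f' c d where 2: "c \<in> wforms m w f" "d \<in> wforms m w f'" "int f = int f' + \<delta>'" "d x0 \<noteq> 0"
    "\<And>x. x \<in> cone_over w K U \<Longrightarrow> d x * h' x = c x" by (rule rat_onE[OF assms(2) x0]) (rule that)
  have "(\<lambda>x. a x * c x) \<in> wforms m w (e + f)"
    using 1(1) 2(1) by (rule wforms_mult)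
  moreover have "(\<lambda>x. b x * d x) \<in> wforms m w (e' + f')"
    using 1(2) 2(2) by (rule wforms_mult)
  moreover have "int (e + f) = int (e' + f') + (\<delta> + \<delta>')" using 1(3) 2(3) by simp
  moreover have "b x0 * d x0 \<noteq> 0" using 1(4) 2(4) by simp
  moreover have "b x * d x * (h x * h' x) = a x * c x" if "x \<in> cone_over w K U" for x
    unfolding 1(5)[OF that, symmetric] 2(5)[OF that, symmetric] by (simp add: algebra_simps)
  ultimately show "\<exists>e e' a b. a \<in> wforms m w e \<and> b \<in> wforms m w e' \<and> int e = int e' + (\<delta> + \<delta>') \<and>
      b x0 \<noteq> 0 \<and> (\<forall>x\<in>cone_over w K U. b x * (h x * h' x) = a x)"
    by blast
qed

lemma rat_on_cmult: "rat_on m w K U \<delta> h \<Longrightarrow> rat_on m w K U \<delta> (\<lambda>x. c * h x)"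
  using rat_on_mult[OF rat_on_const[where c = c], where \<delta>' = \<delta> and h' = h] by simp

lemma rat_on_sum:
  assumes "\<And>i. i \<in> I \<Longrightarrow> rat_on m w K U (int \<delta>) (h i)"
  shows "rat_on m w K U (int \<delta>) (\<lambda>x. \<Sum>i\<in>I. h i x)"
  using assms
  by (induction I rule: infinite_finite_induct) (auto intro: rat_on_zero rat_on_add)

text \<open>Principal open sets form a basis: a single member of the defining set that is nonzero at
  \<open>x0\<close> already cuts out a neighbourhood inside \<open>W\<close>.\<close>

lemma wzariski_openE:
  assumes "wzariski_open m w K W" and "x0 \<in> K" and "orb w x0 \<in> W"
  obtains F e where "F \<in> wforms m w e" "F x0 \<noteq> 0" "\<And>x. x \<in> K \<Longrightarrow> F x \<noteq> 0 \<Longrightarrow> orb w x \<in> W"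
proof -
  obtain S where S: "S \<subseteq> (\<Union>e. wforms m w e)" "W = orb w ` {x \<in> K. \<exists>F\<in>S. F x \<noteq> 0}"
    using assms(1) unfolding wzariski_open_def by blast
  obtain y F where y: "orb w x0 = orb w y" "F \<in> S" "F y \<noteq> 0"
    using assms(3) unfolding S(2) by blast
  obtain e where F: "F \<in> wforms m w e" using S(1) y(2) by blast
  have "F x0 \<noteq> 0" using wforms_nonzero_orb[OF F y(1)] y(3) by simp
  moreover have "orb w x \<in> W" if "x \<in> K" "F x \<noteq> 0" for x
    unfolding S(2) using that y(2) by blast
  ultimately show thesis using F that by blast
qed

lemma rat_on_locally:
  assumes "\<And>x0. x0 \<in> cone_over w K U \<Longrightarrow>
    \<exists>W. wzariski_open m w K W \<and> orb w x0 \<in> W \<and> rat_on m w K (U \<inter> W) \<delta> h"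
  shows "rat_on m w K U \<delta> h"
proof (rule rat_onI)
  fix x0 assume x0: "x0 \<in> cone_over w K U"
  then obtain W where W: "wzariski_open m w K W" "orb w x0 \<in> W" "rat_on m w K (U \<inter> W) \<delta> h"
    using assms by blast
  have "x0 \<in> K" "x0 \<in> cone_over w K (U \<inter> W)" using x0 W(2) by (auto simp: cone_over_def)
  obtain e e' a b where 1: "a \<in> wforms m w e" "b \<in> wforms m w e'" "int e = int e' + \<delta>" "b x0 \<noteq> 0"
    "\<And>x. x \<in> cone_over w K (U \<inter> W) \<Longrightarrow> b x * h x = a x"
    by (rule rat_onE[OF W(3) \<open>x0 \<in> cone_over w K (U \<inter> W)\<close>]) (rule that)
  obtain F f where F: "F \<in> wforms m w f" "F x0 \<noteq> 0" "\<And>x. x \<in> K \<Longrightarrow> F x \<noteq> 0 \<Longrightarrow> orb w x \<in> W"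
    by (rule wzariski_openE[OF W(1) \<open>x0 \<in> K\<close> W(2)]) (rule that)
  have "F x * b x * h x = F x * a x" if "x \<in> cone_over w K U" for x
  proof (cases "F x = 0")
    case False
    then have "x \<in> cone_over w K (U \<inter> W)" using that F(3) by (auto simp: cone_over_def)
    then show ?thesis using 1(5) by (simp add: mult.assoc)
  qed simp
  moreover have "(\<lambda>x. F x * a x) \<in> wforms m w (f + e)" "(\<lambda>x. F x * b x) \<in> wforms m w (f + e')"
    using F(1) 1(1,2) by (auto intro: wforms_mult)
  moreover have "int (f + e) = int (f + e') + \<delta>" "F x0 * b x0 \<noteq> 0" using 1(3,4) F(2) by auto
  ultimately show "\<exists>e e' a b. a \<in> wforms m w e \<and> b \<in> wforms m w e' \<and> int e = int e' + \<delta> \<and>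
      b x0 \<noteq> 0 \<and> (\<forall>x\<in>cone_over w K U. b x * h x = a x)"
    by blast
qed

lemma wzariski_open_Int: "wzariski_open m w K U \<Longrightarrow> wzariski_open m w K V \<Longrightarrow> wzariski_open m w K (U \<inter> V)"
  using istopology_wzariski[of m w K] unfolding istopology_def by blast

lemma wzariski_open_nonzero:
  "F \<in> wforms m w e \<Longrightarrow> wzariski_open m w K (orb w ` {x \<in> K. F x \<noteq> 0})"
  unfolding wzariski_open_def by (intro exI[of _ "{F}"]) auto

lemma wzariski_open_subset: "wzariski_open m w K U \<Longrightarrow> U \<subseteq> orb w ` K"
  unfolding wzariski_open_def by blast

lemma orb_in_nonzero_iff:
  assumes "F \<in> wforms m w e" and "x \<in> K"
  shows "orb w x \<in> orb w ` {x \<in> K. F x \<noteq> 0} \<longleftrightarrow> F x \<noteq> 0"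
  using wforms_nonzero_orb[OF assms(1)] assms(2) by blast

text \<open>Passing to \<open>rat_on\<close> spreads each local denominator over the whole cone by
  \<open>rat_on_locally\<close>; passing back shrinks the neighbourhood to the locus where the
  denominator is nonzero.\<close>

lemma wregular_iff_rat_on:
  assumes "wzariski_open m w K U"
  shows "g \<in> wregular m w K U \<longleftrightarrow> g \<in> extensional U \<and> rat_on m w K U 0 (\<lambda>x. g (orb w x))"
    (is "?L \<longleftrightarrow> ?E \<and> ?R")
proof
  assume g: ?L
  have ?R
  proof (rule rat_on_locally)
    fix x0 assume x0: "x0 \<in> cone_over w K U"
    then have "orb w x0 \<in> U" by (simp add: cone_over_def)
    then obtain W e a b where W: "wzariski_open m w K W" "orb w x0 \<in> W" "W \<subseteq> U"
      and ab: "a \<in> wforms m w e" "b \<in> wforms m w e"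
      and gab: "\<forall>x\<in>K. orb w x \<in> W \<longrightarrow> b x \<noteq> 0 \<and> g (orb w x) = a x / b x"
      using g unfolding wregular_def by blast
    have "rat_on m w K (U \<inter> W) 0 (\<lambda>x. g (orb w x))"
    proof (rule rat_onI)
      fix y assume "y \<in> cone_over w K (U \<inter> W)"
      then have "b y \<noteq> 0" using gab by (simp add: cone_over_def)
      moreover have "\<forall>x\<in>cone_over w K (U \<inter> W). b x * g (orb w x) = a x"
        using gab by (simp add: cone_over_def)
      ultimately show "\<exists>e e' a b. a \<in> wforms m w e \<and> b \<in> wforms m w e' \<and> int e = int e' + 0 \<and>
          b y \<noteq> 0 \<and> (\<forall>x\<in>cone_over w K (U \<inter> W). b x * g (orb w x) = a x)"
        using ab by fastforce
    qed
    then show "\<exists>W. wzariski_open m w K W \<and> orb w x0 \<in> W \<and> rat_on m w K (U \<inter> W) 0 (\<lambda>x. g (orb w x))"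
      using W by blast
  qed
  then show "?E \<and> ?R" using g by (simp add: wregular_def)
next
  assume g: "?E \<and> ?R"
  have "\<exists>W e a b. wzariski_open m w K W \<and> P \<in> W \<and> W \<subseteq> U \<and> a \<in> wforms m w e \<and> b \<in> wforms m w e \<and>
        (\<forall>x\<in>K. orb w x \<in> W \<longrightarrow> b x \<noteq> 0 \<and> g (orb w x) = a x / b x)" if "P \<in> U" for P
  proof -
    obtain x0 where x0: "x0 \<in> K" "P = orb w x0" using wzariski_open_subset[OF assms] \<open>P \<in> U\<close> by blast
    then have "x0 \<in> cone_over w K U" using \<open>P \<in> U\<close> by (simp add: cone_over_def)
    then obtain e e' a b where 1: "a \<in> wforms m w e" "b \<in> wforms m w e'" "int e = int e' + 0" "b x0 \<noteq> 0"
      "\<And>x. x \<in> cone_over w K U \<Longrightarrow> b x * g (orb w x) = a x" by (rule rat_onE[OF conjunct2[OF g]]) (rule that)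
    define W where "W = U \<inter> orb w ` {x \<in> K. b x \<noteq> 0}"
    have "wzariski_open m w K W"
      unfolding W_def using assms wzariski_open_nonzero[OF 1(2)] by (rule wzariski_open_Int)
    moreover have "P \<in> W" "W \<subseteq> U" using x0 1(4) \<open>P \<in> U\<close> by (auto simp: W_def)
    moreover have "b x \<noteq> 0 \<and> g (orb w x) = a x / b x" if "x \<in> K" "orb w x \<in> W" for x
    proof -
      have "b x \<noteq> 0" using that orb_in_nonzero_iff[OF 1(2) that(1)] by (auto simp: W_def)
      moreover have "b x * g (orb w x) = a x" using that by (intro 1(5)) (auto simp: W_def cone_over_def)
      ultimately show ?thesis by (simp add: field_simps)
    qed
    moreover have "e = e'" using 1(3) by simp
    ultimately show ?thesis using 1(1,2) by blast
  qed
  then show ?L using g by (simp add: wregular_def)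
qed

text \<open>Numerator and denominator have equal degree, so moving along an orbit multiplies both by
  the same \<open>l ^ e\<close>.\<close>

lemma rat_on_scale_invariant:
  assumes "rat_on m w K U 0 h" and "x \<in> cone_over w K U" and "y \<in> cone_over w K U" and "orb w x = orb w y"
  shows "h x = h y"
proof -
  obtain e e' a b where 1: "a \<in> wforms m w e" "b \<in> wforms m w e'" "int e = int e' + 0" "b x \<noteq> 0"
    "\<And>x. x \<in> cone_over w K U \<Longrightarrow> b x * h x = a x" by (rule rat_onE[OF assms(1,2)]) (rule that)
  obtain l where l: "l \<noteq> 0" "x = (\<lambda>i. l ^ w i * y i)"
    using orb_self[of x w] assms(4) unfolding orb_def by blast
  have "b x * h x = a x" "b y * h y = a y" using 1(5) assms by auto
  moreover have "a x = l ^ e * a y" "b x = l ^ e * b y"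
    using wforms_scale[OF 1(1)] wforms_scale[OF 1(2)] 1(3) l(2) by auto
  ultimately have "b x * h x = b x * h y" by (simp only: mult.assoc)
  then show ?thesis using 1(4) by simp
qed

text \<open>The representative picked by \<open>SOME\<close> does not matter, because a function of
  degree 0 is constant on orbits.\<close>

lemma rat_on_descend:
  assumes "wzariski_open m w K U" and "rat_on m w K U 0 h"
  defines "g \<equiv> (\<lambda>P\<in>U. h (SOME x. x \<in> K \<and> orb w x = P))"
  shows "g \<in> wregular m w K U" and "\<And>x. x \<in> cone_over w K U \<Longrightarrow> g (orb w x) = h x"
proof -
  show *: "g (orb w x) = h x" if "x \<in> cone_over w K U" for x
  proof -
    define y where "y = (SOME y. y \<in> K \<and> orb w y = orb w x)"
    have "y \<in> K \<and> orb w y = orb w x" unfolding y_def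
      by (rule someI[of _ x]) (use that in \<open>simp add: cone_over_def\<close>)
    then have "h y = h x"
      using that by (intro rat_on_scale_invariant[OF assms(2)]) (auto simp: cone_over_def)
    then show ?thesis using that by (simp add: g_def y_def cone_over_def)
  qed
  then have "rat_on m w K U 0 (\<lambda>x. g (orb w x))"
    using assms(2) rat_on_cong[of w K U "\<lambda>x. g (orb w x)" h m 0] by simp
  then show "g \<in> wregular m w K U"
    using wregular_iff_rat_on[OF assms(1)] by (simp add: g_def)
qed

section \<open>Sheaves of sections on a weighted variety\<close>

lemma reg_fun_wvariety: "reg_fun (wvariety m w K) = wregular m w K"
  by (simp add: wvariety_def)

lemma extensional_restrict_cong: "(\<And>x. x \<in> A \<Longrightarrow> f x = g x) \<Longrightarrow> restrict f A = restrict g A"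
  by (auto simp: restrict_def)

lemma wregularI:
  assumes "wzariski_open m w K U" and "rat_on m w K U 0 h" and "g \<in> extensional U"
    and "\<And>x. x \<in> cone_over w K U \<Longrightarrow> g (orb w x) = h x"
  shows "g \<in> wregular m w K U"
  using assms rat_on_cong[of w K U "\<lambda>x. g (orb w x)" h m 0] by (simp add: wregular_iff_rat_on)

lemma wregularD:
  assumes "wzariski_open m w K U" and "g \<in> wregular m w K U"
  shows "rat_on m w K U 0 (\<lambda>x. g (orb w x))"
  using assms wregular_iff_rat_on by blast

lemma wregular_const: "wzariski_open m w K U \<Longrightarrow> (\<lambda>P\<in>U. c) \<in> wregular m w K U"
  by (rule wregularI[OF _ rat_on_const[of m w K U c]]) (auto simp: cone_over_def)

lemma wregular_add:
  assumes "wzariski_open m w K U" and "g \<in> wregular m w K U" and "h \<in> wregular m w K U"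
  shows "(\<lambda>P\<in>U. g P + h P) \<in> wregular m w K U"
  by (rule wregularI[OF assms(1) rat_on_add[OF assms(2,3)[THEN wregularD[OF assms(1)]]]])
    (auto simp: cone_over_def)

lemma wregular_mult:
  assumes "wzariski_open m w K U" and "g \<in> wregular m w K U" and "h \<in> wregular m w K U"
  shows "(\<lambda>P\<in>U. g P * h P) \<in> wregular m w K U"
  using rat_on_mult[OF assms(2,3)[THEN wregularD[OF assms(1)]]]
  by (intro wregularI[OF assms(1), of "\<lambda>x. g (orb w x) * h (orb w x)"]) (auto simp: cone_over_def)

lemma wregular_restrict:
  assumes "wzariski_open m w K U" and "wzariski_open m w K V" and "V \<subseteq> U" and "g \<in> wregular m w K U"
  shows "restrict g V \<in> wregular m w K V"
  by (rule wregularI[OF assms(2) rat_on_subset[OF wregularD[OF assms(1,4)] assms(3)]])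
    (auto simp: cone_over_def)

lemma cring_struct_ring:
  assumes U: "wzariski_open m w K U"
  shows "cring (struct_ring (wvariety m w K) U)" (is "cring ?R")
proof (rule cringI)
  have car: "carrier ?R = wregular m w K U"
    by (simp add: struct_ring_def reg_fun_wvariety)
  have ext: "g \<in> extensional U" if "g \<in> carrier ?R" for g
    using that unfolding car by (simp add: wregular_def)
  note [simp] = wregular_const[OF U] wregular_add[OF U] wregular_mult[OF U]
  show "abelian_group ?R"
  proof (rule abelian_groupI)
    fix g assume g: "g \<in> carrier ?R"
    \<comment> \<open>Writing the negative as a product with the constant -1 reduces its regularity
      to closure under products.\<close>
    have "(\<lambda>P\<in>U. (\<lambda>P\<in>U. - 1) P * g P) \<in> carrier ?R"
      using g unfolding car by (intro wregular_mult[OF U] wregular_const[OF U])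
    moreover have "(\<lambda>P\<in>U. (\<lambda>P\<in>U. - 1) P * g P) \<oplus>\<^bsub>?R\<^esub> g = \<zero>\<^bsub>?R\<^esub>"
      by (auto simp: struct_ring_def restrict_def)
    ultimately show "\<exists>h\<in>carrier ?R. h \<oplus>\<^bsub>?R\<^esub> g = \<zero>\<^bsub>?R\<^esub>"
      by blast
  next
    fix g assume "g \<in> carrier ?R"
    then show "\<zero>\<^bsub>?R\<^esub> \<oplus>\<^bsub>?R\<^esub> g = g"
      using ext[of g] by (auto simp: struct_ring_def extensional_def fun_eq_iff)
  qed (auto simp: struct_ring_def reg_fun_wvariety algebra_simps intro!: extensional_restrict_cong)
  show "comm_monoid ?R"
  proof (rule comm_monoidI)
    fix g assume "g \<in> carrier ?R"
    then show "\<one>\<^bsub>?R\<^esub> \<otimes>\<^bsub>?R\<^esub> g = g"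
      using ext[of g] by (auto simp: struct_ring_def extensional_def fun_eq_iff)
  qed (auto simp: struct_ring_def reg_fun_wvariety algebra_simps intro!: extensional_restrict_cong)
qed (auto simp: struct_ring_def algebra_simps intro!: extensional_restrict_cong)

section \<open>Sheaves of functions subject to a linear condition at each point\<close>

definition lin_sub :: "cvec set \<Rightarrow> bool" where
  "lin_sub S \<longleftrightarrow> (\<lambda>_. 0) \<in> S \<and> (\<forall>u\<in>S. \<forall>v\<in>S. (\<lambda>i. u i + v i) \<in> S) \<and> (\<forall>c. \<forall>u\<in>S. (\<lambda>i. c * u i) \<in> S)"

text \<open>A subsheaf of a power of the twist by \<open>\<delta>\<close>. Values are infinite
  sequences; their length is bounded through \<open>L\<close>, which in the application consists of
  vectors of length \<open>N\<close>.\<close>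

definition sections ::
  "nat \<Rightarrow> (nat \<Rightarrow> nat) \<Rightarrow> cvec set \<Rightarrow> nat \<Rightarrow> (cvec \<Rightarrow> cvec set) \<Rightarrow> cvec set set \<Rightarrow> (cvec \<Rightarrow> cvec) set" where
  "sections m w K \<delta> L U = {s \<in> extensional (cone_over w K U).
     (\<forall>x\<in>cone_over w K U. s x \<in> L x) \<and> (\<forall>i. rat_on m w K U (int \<delta>) (\<lambda>x. s x i))}"

definition section_sheaf ::
  "nat \<Rightarrow> (nat \<Rightarrow> nat) \<Rightarrow> cvec set \<Rightarrow> nat \<Rightarrow> (cvec \<Rightarrow> cvec set) \<Rightarrow> (cvec set, cvec \<Rightarrow> cvec) mod_presheaf" where
  "section_sheaf m w K \<delta> L =
     \<lparr>sect = (\<lambda>U.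
        \<lparr>carrier = sections m w K \<delta> L U, mult = undefined, one = undefined,
         zero = (\<lambda>x\<in>cone_over w K U. \<lambda>i. 0),
         add = (\<lambda>s t. \<lambda>x\<in>cone_over w K U. \<lambda>i. s x i + t x i),
         smult = (\<lambda>g s. \<lambda>x\<in>cone_over w K U. \<lambda>i. g (orb w x) * s x i)\<rparr>),
      rstr = (\<lambda>U V s. restrict s (cone_over w K V))\<rparr>"

lemma sectionsI:
  assumes "s \<in> extensional (cone_over w K U)" and "\<And>x. x \<in> cone_over w K U \<Longrightarrow> s x = s' x"
    and "\<And>x. x \<in> cone_over w K U \<Longrightarrow> s' x \<in> L x" and "\<And>i. rat_on m w K U (int \<delta>) (\<lambda>x. s' x i)"
  shows "s \<in> sections m w K \<delta> L U"
proof -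
  have "rat_on m w K U (int \<delta>) (\<lambda>x. s x i)" for i
    using assms(4)[of i] assms(2) by (subst rat_on_cong[of w K U _ "\<lambda>x. s' x i"]) auto
  then show ?thesis
    using assms by (simp add: sections_def)
qed

text \<open>Both sheaf axioms are those of functions: the condition \<open>L x\<close> is pointwise
  and rationality is local by \<open>rat_on_locally\<close>.\<close>

lemma mod_sheaf_section_sheaf:
  assumes L: "\<And>x. x \<in> K \<Longrightarrow> lin_sub (L x)"
  shows "mod_sheaf (wvariety m w K) (section_sheaf m w K \<delta> L)" (is "mod_sheaf ?X ?F")
proof -
  let ?C = "cone_over w K" and ?S = "sections m w K \<delta> L"
  have CK: "x \<in> K" if "x \<in> ?C U" for x U using that by (simp add: cone_over_def)
  have S: "s \<in> extensional (?C U)" "\<And>x. x \<in> ?C U \<Longrightarrow> s x \<in> L x"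
      "\<And>i. rat_on m w K U (int \<delta>) (\<lambda>x. s x i)" if "s \<in> ?S U" for s U
    using that by (simp_all add: sections_def)
  have car: "carrier (sect ?F U) = ?S U" for U by (simp add: section_sheaf_def)
  have zero: "(\<lambda>x\<in>?C U. \<lambda>i. 0) \<in> ?S U" for U
    using L CK by (intro sectionsI[where s' = "\<lambda>x i. 0"]) (auto simp: lin_sub_def intro: rat_on_zero)
  have add: "(\<lambda>x\<in>?C U. \<lambda>i. s x i + t x i) \<in> ?S U" if "s \<in> ?S U" "t \<in> ?S U" for s t U
    using L CK S that
    by (intro sectionsI[where s' = "\<lambda>x i. s x i + t x i"]) (auto simp: lin_sub_def intro: rat_on_add)
  have smult: "(\<lambda>x\<in>?C U. \<lambda>i. g (orb w x) * s x i) \<in> ?S U"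
    if "s \<in> ?S U" "g \<in> wregular m w K U" "wzariski_open m w K U" for s g U
  proof (intro sectionsI[where s' = "\<lambda>x i. g (orb w x) * s x i"])
    fix i
    have "rat_on m w K U 0 (\<lambda>x. g (orb w x))" using that wregular_iff_rat_on by blast
    then show "rat_on m w K U (int \<delta>) (\<lambda>x. g (orb w x) * s x i)"
      using rat_on_mult[OF _ S(3)[OF that(1), of i]] by fastforce
  qed (use L CK S that in \<open>auto simp: lin_sub_def\<close>)
  have res: "restrict s (?C V) \<in> ?S V" if "s \<in> ?S U" "V \<subseteq> U" for s U V
  proof (intro sectionsI[where s' = s])
    show "rat_on m w K V (int \<delta>) (\<lambda>x. s x i)" for i using S(3)[OF that(1)] that(2) by (rule rat_on_subset)
  qed (use S(2)[OF that(1)] cone_over_mono[OF that(2)] in auto)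
  have module: "Module.module (struct_ring ?X U) (sect ?F U)" if U: "wzariski_open m w K U" for U
  proof -
    let ?M = "sect ?F U"
    have "abelian_group ?M"
    proof (rule abelian_groupI)
      fix s assume s: "s \<in> carrier ?M"
      have "(\<lambda>x\<in>?C U. \<lambda>i. (\<lambda>P\<in>U. - 1) (orb w x) * s x i) \<in> carrier ?M"
        using s U smult[of s U "\<lambda>P\<in>U. - 1"] wregular_const[OF U] by (simp add: car)
      moreover have "(\<lambda>x\<in>?C U. \<lambda>i. (\<lambda>P\<in>U. - 1) (orb w x) * s x i) \<oplus>\<^bsub>?M\<^esub> s = \<zero>\<^bsub>?M\<^esub>"
        by (auto simp: section_sheaf_def restrict_def fun_eq_iff cone_over_def)
      ultimately show "\<exists>t\<in>carrier ?M. t \<oplus>\<^bsub>?M\<^esub> s = \<zero>\<^bsub>?M\<^esub>"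
        by blast
    next
      fix s assume "s \<in> carrier ?M"
      then show "\<zero>\<^bsub>?M\<^esub> \<oplus>\<^bsub>?M\<^esub> s = s"
        using S(1)[of s U] by (auto simp: section_sheaf_def extensional_def fun_eq_iff)
    qed (auto simp: section_sheaf_def zero add algebra_simps intro!: extensional_restrict_cong)
    then show ?thesis
    proof (rule Module.moduleI[OF cring_struct_ring[OF U]])
      fix s assume "s \<in> carrier ?M"
      then show "\<one>\<^bsub>struct_ring ?X U\<^esub> \<odot>\<^bsub>?M\<^esub> s = s"
        using S(1)[of s U] by (auto simp: section_sheaf_def struct_ring_def extensional_def fun_eq_iff cone_over_def)
    next
      fix g s assume "g \<in> carrier (struct_ring ?X U)" "s \<in> carrier ?M"
      then show "g \<odot>\<^bsub>?M\<^esub> s \<in> carrier ?M"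
        using smult[OF _ _ U] by (simp add: section_sheaf_def struct_ring_def reg_fun_wvariety)
    qed (auto simp: section_sheaf_def struct_ring_def algebra_simps cone_over_def
        intro!: extensional_restrict_cong)
  qed
  show ?thesis
  proof (rule mod_sheaf.intro, unfold open_in_wvariety reg_fun_wvariety car)
    fix U V s t
    assume "wzariski_open m w K U" "wzariski_open m w K V" "V \<subseteq> U" "s \<in> ?S U" "t \<in> ?S U"
    then show "rstr ?F U V (s \<oplus>\<^bsub>sect ?F U\<^esub> t) = rstr ?F U V s \<oplus>\<^bsub>sect ?F V\<^esub> rstr ?F U V t"
      by (auto simp: section_sheaf_def fun_eq_iff restrict_def cone_over_def)
  next
    fix U V g s
    assume "wzariski_open m w K U" "wzariski_open m w K V" "V \<subseteq> U" "g \<in> wregular m w K U" "s \<in> ?S U"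
    then show "rstr ?F U V (g \<odot>\<^bsub>sect ?F U\<^esub> s) = restrict g V \<odot>\<^bsub>sect ?F V\<^esub> rstr ?F U V s"
      by (auto simp: section_sheaf_def fun_eq_iff restrict_def cone_over_def)
  next
    fix U s
    assume "wzariski_open m w K U" "s \<in> ?S U"
    then show "rstr ?F U U s = s"
      using S(1)[of s U] by (auto simp: section_sheaf_def fun_eq_iff restrict_def extensional_def)
  next
    fix U V W s
    assume "wzariski_open m w K U" "wzariski_open m w K V" "wzariski_open m w K W" "W \<subseteq> V" "V \<subseteq> U" "s \<in> ?S U"
    then show "rstr ?F V W (rstr ?F U V s) = rstr ?F U W s"
      by (auto simp: section_sheaf_def fun_eq_iff restrict_def cone_over_def)
  next
    fix \<U> s t
    assume "s \<in> ?S (\<Union>\<U>)" "t \<in> ?S (\<Union>\<U>)" and eq: "\<And>U. U \<in> \<U> \<Longrightarrow> rstr ?F (\<Union>\<U>) U s = rstr ?F (\<Union>\<U>) U t"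
    show "s = t"
    proof (rule extensionalityI[OF S(1) S(1)])
      fix x assume "x \<in> ?C (\<Union>\<U>)"
      then obtain U where "U \<in> \<U>" "x \<in> ?C U" by (auto simp: cone_over_def)
      then show "s x = t x" using fun_cong[OF eq[of U], of x] by (simp add: section_sheaf_def)
    qed fact+
  next
    fix \<U> \<sigma>
    assume op: "\<And>U. U \<in> \<U> \<Longrightarrow> wzariski_open m w K U" and \<sigma>: "\<And>U. U \<in> \<U> \<Longrightarrow> \<sigma> U \<in> ?S U"
      and eq: "\<And>U V. U \<in> \<U> \<Longrightarrow> V \<in> \<U> \<Longrightarrow> rstr ?F U (U \<inter> V) (\<sigma> U) = rstr ?F V (U \<inter> V) (\<sigma> V)"
    \<comment> \<open>Any member of the cover that contains the orbit of \<open>x\<close> gives the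
      same value, by compatibility on intersections.\<close>
    define s where "s = (\<lambda>x\<in>?C (\<Union>\<U>). \<sigma> (SOME U. U \<in> \<U> \<and> orb w x \<in> U) x)"
    have s: "s x = \<sigma> U x" if "U \<in> \<U>" "x \<in> ?C U" for U x
    proof -
      define V where "V = (SOME U. U \<in> \<U> \<and> orb w x \<in> U)"
      have V: "V \<in> \<U> \<and> orb w x \<in> V"
        unfolding V_def by (rule someI[of _ U]) (use that in \<open>simp add: cone_over_def\<close>)
      have "x \<in> ?C (\<Union>\<U>)" "x \<in> ?C (V \<inter> U)"
        using that V by (auto simp: cone_over_def)
      then show ?thesis
        using fun_cong[OF eq[of V U], of x] V that(1) by (simp add: section_sheaf_def s_def flip: V_def)
    qed
    have "s \<in> ?S (\<Union>\<U>)"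
    proof (rule sectionsI[where s' = s])
      show "s x \<in> L x" if x: "x \<in> ?C (\<Union>\<U>)" for x
      proof -
        obtain U where "U \<in> \<U>" "x \<in> ?C U" using x by (auto simp: cone_over_def)
        then show ?thesis using s[of U x] S(2)[OF \<sigma>[of U], of x] by simp
      qed
      show "rat_on m w K (\<Union>\<U>) (int \<delta>) (\<lambda>x. s x i)" for i
      proof (rule rat_on_locally)
        fix x0 assume "x0 \<in> ?C (\<Union>\<U>)"
        then obtain U where U: "U \<in> \<U>" "orb w x0 \<in> U" by (auto simp: cone_over_def)
        then have "\<Union>\<U> \<inter> U = U" by blast
        moreover have "rat_on m w K U (int \<delta>) (\<lambda>x. s x i)"
          using S(3)[OF \<sigma>[OF U(1)], of i] s[OF U(1)]
          by (subst rat_on_cong[of w K U _ "\<lambda>x. \<sigma> U x i"]) auto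
        ultimately show "\<exists>W. wzariski_open m w K W \<and> orb w x0 \<in> W \<and> rat_on m w K (\<Union>\<U> \<inter> W) (int \<delta>) (\<lambda>x. s x i)"
          using U op[OF U(1)] by (intro exI[of _ U]) simp
      qed
    qed (auto simp: s_def)
    moreover have "rstr ?F (\<Union>\<U>) U s = \<sigma> U" if "U \<in> \<U>" for U
      using S(1)[OF \<sigma>[OF that]] s[OF that] by (auto simp: section_sheaf_def fun_eq_iff restrict_def extensional_def)
    ultimately show "\<exists>s\<in>?S (\<Union>\<U>). \<forall>U\<in>\<U>. rstr ?F (\<Union>\<U>) U s = \<sigma> U"
      by blast
  qed (use module res in \<open>auto simp: section_sheaf_def\<close>)
qed

section \<open>Isomorphisms with free sheaves\<close>

definition reg_closed :: "'p fun_space \<Rightarrow> bool" where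
  "reg_closed X \<longleftrightarrow> (\<forall>U. open_in X U \<longrightarrow>
     (\<forall>g\<in>reg_fun X U. \<forall>h\<in>reg_fun X U.
        (\<lambda>P\<in>U. g P + h P) \<in> reg_fun X U \<and> (\<lambda>P\<in>U. g P * h P) \<in> reg_fun X U) \<and>
     (\<forall>V. open_in X V \<longrightarrow> V \<subseteq> U \<longrightarrow> (\<forall>g\<in>reg_fun X U. restrict g V \<in> reg_fun X V)))"

lemma reg_closed_wvariety: "reg_closed (wvariety m w K)"
  unfolding reg_closed_def open_in_wvariety reg_fun_wvariety
  using wregular_add wregular_mult wregular_restrict by blast

lemma open_in_open_subspace:
  assumes "open_in X W"
  shows "open_in (open_subspace X W) U \<longleftrightarrow> open_in X U \<and> U \<subseteq> W"
  using openin_open_subtopology[OF assms] by (simp add: open_subspace_def)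

lemma reg_fun_open_subspace: "reg_fun (open_subspace X W) = reg_fun X"
  by (simp add: open_subspace_def)

lemma reg_closed_open_subspace:
  "reg_closed X \<Longrightarrow> open_in X W \<Longrightarrow> reg_closed (open_subspace X W)"
  unfolding reg_closed_def reg_fun_open_subspace by (simp add: open_in_open_subspace) blast

text \<open>Maps out of a free sheaf have explicit formulas, whereas bundles and Ulrich bundles are
  defined by maps into one. Transporting the module laws to the inverse requires that the free sheaf
  be closed under its operations, which is what \<open>reg_closed\<close> provides.\<close>

lemma sheaf_iso_freeI:
  assumes "reg_closed X" and \<Psi>: "sheaf_iso_map X (free_sheaf X r) F \<Psi>"
  shows "sheaf_iso X F (free_sheaf X r)"
proof -
  let ?G = "free_sheaf X r"
  let ?\<Phi> = "\<lambda>U. inv_into (carrier (sect ?G U)) (\<Psi> U)"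
  have add: "s \<oplus>\<^bsub>sect ?G U\<^esub> t \<in> carrier (sect ?G U)"
    if "open_in X U" "s \<in> carrier (sect ?G U)" "t \<in> carrier (sect ?G U)" for U s t
    using assms(1) that by (auto simp: free_sheaf_def reg_closed_def PiE_iff)
  have smult: "g \<odot>\<^bsub>sect ?G U\<^esub> s \<in> carrier (sect ?G U)"
    if "open_in X U" "g \<in> reg_fun X U" "s \<in> carrier (sect ?G U)" for U g s
    using assms(1) that by (auto simp: free_sheaf_def reg_closed_def PiE_iff)
  have rstr: "rstr ?G U V s \<in> carrier (sect ?G V)"
    if "open_in X U" "open_in X V" "V \<subseteq> U" "s \<in> carrier (sect ?G U)" for U V s
    using assms(1) that by (auto simp: free_sheaf_def reg_closed_def PiE_iff)
  have bij: "bij_betw (\<Psi> U) (carrier (sect ?G U)) (carrier (sect F U))"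
    and hom_add: "\<And>s t. s \<in> carrier (sect ?G U) \<Longrightarrow> t \<in> carrier (sect ?G U) \<Longrightarrow>
      \<Psi> U (s \<oplus>\<^bsub>sect ?G U\<^esub> t) = \<Psi> U s \<oplus>\<^bsub>sect F U\<^esub> \<Psi> U t"
    and hom_smult: "\<And>g s. g \<in> reg_fun X U \<Longrightarrow> s \<in> carrier (sect ?G U) \<Longrightarrow>
      \<Psi> U (g \<odot>\<^bsub>sect ?G U\<^esub> s) = g \<odot>\<^bsub>sect F U\<^esub> \<Psi> U s"
    and nat: "\<And>V s. open_in X V \<Longrightarrow> V \<subseteq> U \<Longrightarrow> s \<in> carrier (sect ?G U) \<Longrightarrow>
      \<Psi> V (rstr ?G U V s) = rstr F U V (\<Psi> U s)"
    if "open_in X U" for U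
    using \<Psi>[unfolded sheaf_iso_map_def, THEN spec, THEN mp, OF that] by simp_all
  have inv: "?\<Phi> U (\<Psi> U s) = s" if "open_in X U" "s \<in> carrier (sect ?G U)" for U s
    using bij[OF that(1)] that(2) by (simp add: bij_betw_def)
  have surj: "\<exists>t\<in>carrier (sect ?G U). s = \<Psi> U t" if "open_in X U" "s \<in> carrier (sect F U)" for U s
    using bij[OF that(1)] that(2) unfolding bij_betw_def by blast
  have "sheaf_iso_map X F ?G ?\<Phi>"
    unfolding sheaf_iso_map_def
  proof (intro allI impI conjI ballI)
    fix U assume U: "open_in X U"
    show "bij_betw (?\<Phi> U) (carrier (sect F U)) (carrier (sect ?G U))"
      using bij[OF U] by (rule bij_betw_inv_into)
    fix s assume "s \<in> carrier (sect F U)"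
    then obtain s' where s: "s' \<in> carrier (sect ?G U)" "s = \<Psi> U s'" using surj[OF U] by blast
    show "?\<Phi> U (g \<odot>\<^bsub>sect F U\<^esub> s) = g \<odot>\<^bsub>sect ?G U\<^esub> ?\<Phi> U s" if "g \<in> reg_fun X U" for g
      using hom_smult[OF U that s(1), symmetric] inv[OF U] smult[OF U that s(1)] s by simp
    show "?\<Phi> V (rstr F U V s) = rstr ?G U V (?\<Phi> U s)" if "open_in X V" "V \<subseteq> U" for V
      using nat[OF U that s(1), symmetric] inv[OF U] inv[OF that(1)] rstr[OF U that s(1)] s by simp
    fix t assume "t \<in> carrier (sect F U)"
    then obtain t' where t: "t' \<in> carrier (sect ?G U)" "t = \<Psi> U t'" using surj[OF U] by blast
    show "?\<Phi> U (s \<oplus>\<^bsub>sect F U\<^esub> t) = ?\<Phi> U s \<oplus>\<^bsub>sect ?G U\<^esub> ?\<Phi> U t"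
      using hom_add[OF U s(1) t(1), symmetric] inv[OF U] add[OF U s(1) t(1)] s t by simp
  qed
  then show ?thesis
    unfolding sheaf_iso_def by blast
qed

section \<open>Matrices acting on coordinate vectors\<close>

text \<open>Vectors are sequences padded with zeros, the type in which sections take their values;
  identities between matrices are checked through this action by \<open>mat_eq_app\<close>.\<close>

definition app :: "complex mat \<Rightarrow> cvec \<Rightarrow> cvec" where
  "app A v = (\<lambda>i. if i < dim_row A then \<Sum>j<dim_col A. A $$ (i, j) * v j else 0)"

lemma index_mat_mult:
  assumes "A \<in> carrier_mat n r" and "B \<in> carrier_mat r c" and "i < n" and "j < c"
  shows "(A * B) $$ (i, j) = (\<Sum>l<r. A $$ (i, l) * B $$ (l, j))"
  using assms by (auto simp: scalar_prod_def lessThan_atLeast0 intro!: sum.cong)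

lemma app_in_cvecs: "dim_row A = n \<Longrightarrow> app A v \<in> cvecs n"
  by (auto simp: app_def cvecs_def)

lemma app_mult:
  assumes "A \<in> carrier_mat n r" and "B \<in> carrier_mat r c"
  shows "app (A * B) v = app A (app B v)"
proof
  fix i
  show "app (A * B) v i = app A (app B v) i"
  proof (cases "i < n")
    case True
    have "app (A * B) v i = (\<Sum>j<c. (\<Sum>l<r. A $$ (i, l) * B $$ (l, j)) * v j)"
      using assms True index_mat_mult[OF assms True] by (simp add: app_def)
    also have "\<dots> = (\<Sum>l<r. \<Sum>j<c. A $$ (i, l) * (B $$ (l, j) * v j))"
      by (simp add: sum_distrib_right mult.assoc) (rule sum.swap)
    also have "\<dots> = app A (app B v) i"
      using assms True by (simp add: app_def sum_distrib_left)
    finally show ?thesis .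
  qed (use assms in \<open>simp add: app_def\<close>)
qed

lemma app_one: "v \<in> cvecs n \<Longrightarrow> app (1\<^sub>m n) v = v"
  by (auto simp: app_def cvecs_def fun_eq_iff if_distrib[of "\<lambda>a. a * _"] sum.delta cong: if_cong)

lemma app_smult_mat: "app (c \<cdot>\<^sub>m A) v = (\<lambda>i. c * app A v i)"
  by (auto simp: app_def fun_eq_iff sum_distrib_left mult.assoc)

lemma app_add_mat:
  "A \<in> carrier_mat n r \<Longrightarrow> B \<in> carrier_mat n r \<Longrightarrow> app (A + B) v = (\<lambda>i. app A v i + app B v i)"
  by (auto simp: app_def fun_eq_iff sum.distrib distrib_right)

lemma app_cmult: "app A (\<lambda>i. c * v i) = (\<lambda>i. c * app A v i)"
  by (auto simp: app_def fun_eq_iff sum_distrib_left mult.left_commute)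

lemma app_add: "app A (\<lambda>i. u i + v i) = (\<lambda>i. app A u i + app A v i)"
  by (auto simp: app_def fun_eq_iff sum.distrib distrib_left)

lemma app_0: "app A (\<lambda>_. 0) = (\<lambda>_. 0)"
  by (auto simp: app_def)

lemma app_sum: "app A (\<lambda>i. \<Sum>k\<in>I. v k i) = (\<lambda>i. \<Sum>k\<in>I. app A (v k) i)"
proof
  fix i
  have "(\<Sum>j<dim_col A. A $$ (i, j) * (\<Sum>k\<in>I. v k j)) = (\<Sum>k\<in>I. \<Sum>j<dim_col A. A $$ (i, j) * v k j)"
    by (simp add: sum_distrib_left) (rule sum.swap)
  then show "app A (\<lambda>i. \<Sum>k\<in>I. v k i) i = (\<Sum>k\<in>I. app A (v k) i)"
    by (simp add: app_def)
qed

lemma app_unit: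
  assumes "A \<in> carrier_mat n r" and "j < r" and "i < n"
  shows "app A (\<lambda>l. if l = j then 1 else 0) i = A $$ (i, j)"
  using assms by (simp add: app_def if_distrib[of "\<lambda>a. _ * a"] sum.delta cong: if_cong)

lemma mat_eq_app:
  assumes "A \<in> carrier_mat n r" and "B \<in> carrier_mat n r" and "\<And>v. v \<in> cvecs r \<Longrightarrow> app A v = app B v"
  shows "A = B"
proof (rule eq_matI)
  fix i j assume "i < dim_row B" "j < dim_col B"
  moreover from this have "(\<lambda>l. if l = j then 1 else 0) \<in> cvecs r"
    using assms by (auto simp: cvecs_def)
  ultimately show "A $$ (i, j) = B $$ (i, j)"
    using assms app_unit[OF assms(1), of j i] app_unit[OF assms(2), of j i] by simp
qed (use assms in auto)

lemma pow_mat_Suc_left: "A \<in> carrier_mat n n \<Longrightarrow> A ^\<^sub>m Suc l = A * A ^\<^sub>m l"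
proof (induction l)
  case (Suc l)
  have "A ^\<^sub>m Suc (Suc l) = (A * A ^\<^sub>m l) * A" using Suc by simp
  also have "\<dots> = A * (A ^\<^sub>m l * A)"
    using Suc.prems by (intro assoc_mult_mat) (auto simp: pow_carrier_mat)
  finally show ?case by simp
qed simp

section \<open>Traces and rank factorization of idempotents\<close>

definition trace_mat :: "complex mat \<Rightarrow> complex" where
  "trace_mat A = (\<Sum>i<dim_row A. A $$ (i, i))"

lemma trace_mat_comm:
  assumes "A \<in> carrier_mat n r" and "B \<in> carrier_mat r n"
  shows "trace_mat (A * B) = trace_mat (B * A)"
proof -
  have "trace_mat (A * B) = (\<Sum>i<n. \<Sum>l<r. A $$ (i, l) * B $$ (l, i))"
    using assms index_mat_mult[OF assms] by (simp add: trace_mat_def)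
  also have "\<dots> = (\<Sum>l<r. \<Sum>i<n. A $$ (i, l) * B $$ (l, i))"
    by (rule sum.swap)
  also have "\<dots> = trace_mat (B * A)"
    using assms index_mat_mult[OF assms(2,1)] by (simp add: trace_mat_def mult.commute)
  finally show ?thesis .
qed

lemma trace_mat_add:
  "A \<in> carrier_mat n n \<Longrightarrow> B \<in> carrier_mat n n \<Longrightarrow> trace_mat (A + B) = trace_mat A + trace_mat B"
  by (simp add: trace_mat_def sum.distrib)

lemma trace_mat_smult: "A \<in> carrier_mat n n \<Longrightarrow> trace_mat (c \<cdot>\<^sub>m A) = c * trace_mat A"
  by (simp add: trace_mat_def sum_distrib_left)

lemma trace_mat_one: "trace_mat (1\<^sub>m n) = of_nat n"
  by (simp add: trace_mat_def)

text \<open>A rank one idempotent is split off at a pivot \<open>p a b\<close>: column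
  \<open>b\<close> is fixed by \<open>p\<close>, row \<open>a\<close> divided by the pivot is fixed
  from the other side, and their pairing is 1. The difference \<open>q\<close> is again idempotent,
  its row \<open>a\<close> is zero and zero rows stay zero, so the number of nonzero rows
  drops.\<close>

lemma idempotent_rank_factorization:
  fixes p :: "nat \<Rightarrow> nat \<Rightarrow> complex"
  assumes "\<forall>i<n. \<forall>j<n. (\<Sum>l<n. p i l * p l j) = p i j"
  shows "\<exists>(r::nat) V W. (\<forall>i<n. \<forall>j<n. p i j = (\<Sum>k<r. V i k * W k j)) \<and>
    (\<forall>k<r. \<forall>k'<r. (\<Sum>i<n. W k i * V i k') = (if k = k' then 1 else 0))"
  using assms
proof (induction "card {i. i < n \<and> (\<exists>j<n. p i j \<noteq> 0)}" arbitrary: p rule: less_induct)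
  case less
  note idem = less.prems[rule_format]
  show ?case
  proof (cases "\<exists>i<n. \<exists>j<n. p i j \<noteq> 0")
    case False
    then show ?thesis by (intro exI[of _ 0]) auto
  next
    case True
    then obtain a b where ab: "a < n" "b < n" "p a b \<noteq> 0" by blast
    define v where "v = (\<lambda>i. p i b)"
    define l where "l = (\<lambda>j. p a j / p a b)"
    define q where "q = (\<lambda>i j. p i j - v i * l j)"
    have pv: "(\<Sum>k<n. p i k * v k) = v i" if "i < n" for i
      using idem[OF that ab(2)] by (simp add: v_def)
    have lp: "(\<Sum>k<n. l k * p k j) = l j" if "j < n" for j
      using idem[OF ab(1) that] by (simp add: l_def sum_divide_distrib[symmetric])
    have lv: "(\<Sum>k<n. l k * v k) = 1"
      using idem[OF ab(1,2)] ab(3) by (simp add: l_def v_def sum_divide_distrib[symmetric])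
    have qv: "(\<Sum>k<n. q i k * v k) = 0" if "i < n" for i
    proof -
      have "(\<Sum>k<n. q i k * v k) = (\<Sum>k<n. p i k * v k) - v i * (\<Sum>k<n. l k * v k)"
        by (simp add: q_def left_diff_distrib sum_subtractf sum_distrib_left mult.assoc)
      then show ?thesis using pv[OF that] lv by simp
    qed
    have lq: "(\<Sum>k<n. l k * q k j) = 0" if "j < n" for j
    proof -
      have "(\<Sum>k<n. l k * q k j) = (\<Sum>k<n. l k * p k j) - (\<Sum>k<n. l k * v k) * l j"
        by (simp add: q_def right_diff_distrib sum_subtractf sum_distrib_right mult.assoc)
      then show ?thesis using lp[OF that] lv by simp
    qed
    have qidem: "\<forall>i<n. \<forall>j<n. (\<Sum>k<n. q i k * q k j) = q i j"
    proof (intro allI impI)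
      fix i j assume that: "i < n" "j < n"
      have "(\<Sum>k<n. q i k * q k j) = (\<Sum>k<n. q i k * p k j) - (\<Sum>k<n. q i k * v k) * l j"
        unfolding sum_distrib_right sum_subtractf[symmetric]
        by (intro sum.cong refl) (simp add: q_def algebra_simps)
      also have "\<dots> = (\<Sum>k<n. q i k * p k j)"
        using qv[OF that(1)] by simp
      also have "\<dots> = (\<Sum>k<n. p i k * p k j) - v i * (\<Sum>k<n. l k * p k j)"
        by (simp add: q_def left_diff_distrib sum_subtractf sum_distrib_left mult.assoc)
      also have "\<dots> = q i j" using idem[OF that] lp[OF that(2)] by (simp add: q_def)
      finally show "(\<Sum>k<n. q i k * q k j) = q i j" .
    qed
    have "{i. i < n \<and> (\<exists>j<n. q i j \<noteq> 0)} \<subset> {i. i < n \<and> (\<exists>j<n. p i j \<noteq> 0)}"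
    proof (rule psubsetI)
      show "{i. i < n \<and> (\<exists>j<n. q i j \<noteq> 0)} \<subseteq> {i. i < n \<and> (\<exists>j<n. p i j \<noteq> 0)}"
      proof (intro subsetI CollectI conjI)
        fix i assume i: "i \<in> {i. i < n \<and> (\<exists>j<n. q i j \<noteq> 0)}"
        then show "i < n" by simp
        show "\<exists>j<n. p i j \<noteq> 0"
        proof (rule ccontr)
          assume "\<not> (\<exists>j<n. p i j \<noteq> 0)"
          then have "q i j = 0" if "j < n" for j using that ab(2) by (simp add: q_def v_def)
          then show False using i by blast
        qed
      qed
      have "q a j = 0" for j using ab(3) by (simp add: q_def v_def l_def)
      then have "a \<notin> {i. i < n \<and> (\<exists>j<n. q i j \<noteq> 0)}" by simp
      moreover have "a \<in> {i. i < n \<and> (\<exists>j<n. p i j \<noteq> 0)}" using ab by blast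
      ultimately show "{i. i < n \<and> (\<exists>j<n. q i j \<noteq> 0)} \<noteq> {i. i < n \<and> (\<exists>j<n. p i j \<noteq> 0)}"
        by metis
    qed
    then have "card {i. i < n \<and> (\<exists>j<n. q i j \<noteq> 0)} < card {i. i < n \<and> (\<exists>j<n. p i j \<noteq> 0)}"
      by (intro psubset_card_mono) auto
    from less.hyps[OF this qidem] obtain r V W where 1: "\<forall>i<n. \<forall>j<n. q i j = (\<Sum>k<(r::nat). V i k * W k j)"
      "\<forall>k<r. \<forall>k'<r. (\<Sum>i<n. W k i * V i k') = (if k = k' then 1 else 0)"
      by (elim exE conjE) (rule that)
    note q = 1(1)[rule_format] and WV = 1(2)[rule_format]
    have Wv: "(\<Sum>i<n. W k i * v i) = 0" if "k < r" for k
    proof -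
      \<comment> \<open>Expanding \<open>q\<close> as \<open>V * W\<close> in
        \<open>W (q v) = 0\<close> and using \<open>W V = 1\<close> leaves \<open>W v = 0\<close>;
        the next fact is the mirror image for \<open>l\<close>.\<close>
      have "0 = (\<Sum>i<n. W k i * (\<Sum>j<n. q i j * v j))" using qv by simp
      also have "\<dots> = (\<Sum>i<n. \<Sum>j<n. \<Sum>k'<r. W k i * V i k' * W k' j * v j)"
        using q by (simp add: sum_distrib_left sum_distrib_right mult.assoc)
      also have "\<dots> = (\<Sum>j<n. \<Sum>k'<r. \<Sum>i<n. W k i * V i k' * W k' j * v j)"
        by (subst sum.swap) (intro sum.cong refl sum.swap)
      also have "\<dots> = (\<Sum>j<n. \<Sum>k'<r. (\<Sum>i<n. W k i * V i k') * (W k' j * v j))"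
        by (simp add: sum_distrib_right mult.assoc)
      also have "\<dots> = (\<Sum>j<n. W k j * v j)"
        using WV[OF that] that by (simp add: if_distrib[of "\<lambda>a. a * _"] sum.delta cong: if_cong)
      finally show ?thesis by simp
    qed
    have lV: "(\<Sum>i<n. l i * V i k) = 0" if "k < r" for k
    proof -
      have "0 = (\<Sum>j<n. (\<Sum>i<n. l i * q i j) * V j k)" using lq by simp
      also have "\<dots> = (\<Sum>j<n. \<Sum>i<n. \<Sum>k'<r. l i * V i k' * (W k' j * V j k))"
        using q by (simp add: sum_distrib_left sum_distrib_right mult.assoc)
      also have "\<dots> = (\<Sum>i<n. \<Sum>k'<r. \<Sum>j<n. l i * V i k' * (W k' j * V j k))"
        by (subst sum.swap) (intro sum.cong refl sum.swap)
      also have "\<dots> = (\<Sum>i<n. \<Sum>k'<r. l i * V i k' * (\<Sum>j<n. W k' j * V j k))"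
        by (simp add: sum_distrib_left)
      also have "\<dots> = (\<Sum>i<n. l i * V i k)"
        using WV[OF _ that] that by (simp add: if_distrib[of "\<lambda>a. _ * a"] sum.delta' cong: if_cong)
      finally show ?thesis by simp
    qed
    define V' where "V' = (\<lambda>i k. if k < r then V i k else v i)"
    define W' where "W' = (\<lambda>k i. if k < r then W k i else l i)"
    have "\<forall>i<n. \<forall>j<n. p i j = (\<Sum>k<Suc r. V' i k * W' k j)"
      using q by (simp add: V'_def W'_def q_def diff_eq_eq)
    moreover have "\<forall>k<Suc r. \<forall>k'<Suc r. (\<Sum>i<n. W' k i * V' i k') = (if k = k' then 1 else 0)"
    proof (intro allI impI)
      fix k k' assume "k < Suc r" "k' < Suc r"
      then show "(\<Sum>i<n. W' k i * V' i k') = (if k = k' then 1 else 0)"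
        by (cases "k < r"; cases "k' < r") (simp_all add: V'_def W'_def WV Wv lV lv less_Suc_eq)
    qed
    ultimately have "(\<forall>i<n. \<forall>j<n. p i j = (\<Sum>k<Suc r. V' i k * W' k j)) \<and>
      (\<forall>k<Suc r. \<forall>k'<Suc r. (\<Sum>i<n. W' k i * V' i k') = (if k = k' then 1 else 0))"
      by (rule conjI)
    then show ?thesis by (rule exI[of _ W', THEN exI[of _ V'], THEN exI[of _ "Suc r"]])
  qed
qed

text \<open>Cyclicity turns the trace of \<open>V * W\<close> into that of \<open>W * V = 1\<close>,
  which is how a trace computation later fixes the dimension of an eigenspace.\<close>

lemma idempotent_mat_factorization:
  assumes P: "P \<in> carrier_mat n n" and "P * P = P"
  obtains r V W where "V \<in> carrier_mat n r" "W \<in> carrier_mat r n" "P = V * W" "W * V = 1\<^sub>m r"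
    "trace_mat P = of_nat r"
proof -
  have "\<forall>i<n. \<forall>j<n. (\<Sum>l<n. P $$ (i, l) * P $$ (l, j)) = P $$ (i, j)"
  proof (intro allI impI)
    fix i j assume "i < n" "j < n"
    from index_mat_mult[OF P P this] show "(\<Sum>l<n. P $$ (i, l) * P $$ (l, j)) = P $$ (i, j)"
      unfolding assms(2) by (rule sym)
  qed
  from idempotent_rank_factorization[of n "\<lambda>i j. P $$ (i, j)", OF this]
  obtain r V W where *: "(\<forall>i<n. \<forall>j<n. P $$ (i, j) = (\<Sum>k<(r::nat). V i k * W k j)) \<and>
    (\<forall>k<r. \<forall>k'<r. (\<Sum>i<n. W k i * V i k') = (if k = k' then 1 else 0))"
    by (elim exE) (rule that)
  note 1 = *[THEN conjunct1] *[THEN conjunct2]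
  define V' W' where "V' = mat n r (\<lambda>(i, k). V i k)" and "W' = mat r n (\<lambda>(k, i). W k i)"
  have car: "V' \<in> carrier_mat n r" "W' \<in> carrier_mat r n" by (simp_all add: V'_def W'_def)
  have 2: "P = V' * W'"
  proof (rule eq_matI)
    fix i j assume "i < dim_row (V' * W')" "j < dim_col (V' * W')"
    then have ij: "i < n" "j < n" using car by auto
    have "(V' * W') $$ (i, j) = (\<Sum>k<r. V' $$ (i, k) * W' $$ (k, j))"
      using car ij by (rule index_mat_mult)
    also have "\<dots> = P $$ (i, j)"
      using ij 1(1) by (simp add: V'_def W'_def)
    finally show "P $$ (i, j) = (V' * W') $$ (i, j)" by (rule sym)
  qed (simp_all add: carrier_matD[OF P] carrier_matD[OF car(1)] carrier_matD[OF car(2)])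
  have 3: "W' * V' = 1\<^sub>m r"
  proof (rule eq_matI)
    fix i j assume "i < dim_row (1\<^sub>m r :: complex mat)" "j < dim_col (1\<^sub>m r :: complex mat)"
    then have ij: "i < r" "j < r" by auto
    have "(W' * V') $$ (i, j) = (\<Sum>k<n. W' $$ (i, k) * V' $$ (k, j))"
      using car(2,1) ij by (rule index_mat_mult)
    also have "\<dots> = 1\<^sub>m r $$ (i, j)"
      using ij 1(2) by (simp add: V'_def W'_def)
    finally show "(W' * V') $$ (i, j) = 1\<^sub>m r $$ (i, j)" .
  qed (simp_all add: carrier_matD[OF car(1)] carrier_matD[OF car(2)])
  have "trace_mat P = trace_mat (W' * V')"
    unfolding 2 by (rule trace_mat_comm[OF car])
  then have "trace_mat P = of_nat r"
    unfolding 3 by (simp add: trace_mat_one)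
  then show thesis by (rule that[OF car 2 3])
qed

section \<open>Matrix roots of forms\<close>

fun gauss_binomial :: "complex \<Rightarrow> nat \<Rightarrow> nat \<Rightarrow> complex" where
  "gauss_binomial q 0 b = 1"
| "gauss_binomial q (Suc a) 0 = 1"
| "gauss_binomial q (Suc a) (Suc b) = gauss_binomial q a (Suc b) + q ^ Suc a * gauss_binomial q (Suc a) b"

lemma gauss_binomial_0_right: "gauss_binomial q a 0 = 1"
  by (cases a) simp_all

text \<open>\<open>F q n\<close> is the q-factorial up to a power of \<open>1 - q\<close>, so this
  is the factorial formula for the Gaussian binomial of \<open>a + b\<close> over \<open>a\<close>,
  free of denominators and hence valid at roots of unity.\<close>

lemma gauss_binomial_factorial:
  defines "F \<equiv> (\<lambda>q n. \<Prod>i<n. 1 - q ^ Suc i :: complex)"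
  shows "gauss_binomial q a b * F q a * F q b = F q (a + b)"
proof (induction q a b rule: gauss_binomial.induct)
  case (3 q a b)
  have "gauss_binomial q (Suc a) (Suc b) * F q (Suc a) * F q (Suc b) =
      (gauss_binomial q a (Suc b) * F q a * F q (Suc b)) * (1 - q ^ Suc a) +
      q ^ Suc a * (gauss_binomial q (Suc a) b * F q (Suc a) * F q b) * (1 - q ^ Suc b)"
    by (simp add: F_def algebra_simps)
  also have "\<dots> = F q (Suc (a + b)) * (1 - q ^ Suc a) + q ^ Suc a * F q (Suc (a + b)) * (1 - q ^ Suc b)"
    using 3 by simp
  also have "\<dots> = F q (Suc (a + b)) * (1 - q ^ (Suc (Suc (a + b))))"
    by (simp add: algebra_simps power_add)
  finally show ?case by (simp add: F_def)
qed (simp_all add: F_def)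

text \<open>The q-factorial of \<open>a + b\<close> has the factor
  \<open>1 - q ^ (a + b) = 0\<close>, while the shorter ones of \<open>a\<close> and of
  \<open>b\<close> have only nonzero factors.\<close>

lemma gauss_binomial_root_of_unity:
  assumes "q ^ (a + b) = 1" and "\<And>i. 0 < i \<Longrightarrow> i < a + b \<Longrightarrow> q ^ i \<noteq> 1" and "a > 0" and "b > 0"
  shows "gauss_binomial q a b = 0"
proof -
  have ne: "(\<Prod>i<n. 1 - q ^ Suc i) \<noteq> 0" if "n < a + b" for n
  proof -
    have "1 - q ^ Suc i \<noteq> 0" if "i < n" for i
      using assms(2)[of "Suc i"] that \<open>n < a + b\<close> by simp
    then show ?thesis by simp
  qed
  obtain n where n: "a + b = Suc n" using assms(3) by (cases "a + b") auto
  have "(\<Prod>i<a + b. 1 - q ^ Suc i) = 0"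
    using assms(1) unfolding n by simp
  with gauss_binomial_factorial[of q a b]
  have "gauss_binomial q a b * (\<Prod>i<a. 1 - q ^ Suc i) * (\<Prod>i<b. 1 - q ^ Suc i) = 0"
    by (simp only:)
  moreover have "a < a + b" "b < a + b" using assms(3,4) by auto
  ultimately show ?thesis
    using ne[of a] ne[of b] by (simp only: mult_eq_0_iff) blast
qed

text \<open>The q-Pascal rule in summed form. In the q-binomial theorem \<open>t a\<close> stands
  for \<open>X ^ a * Y ^ (Suc n - a)\<close> applied to a vector; the two sums on the left come from
  one more factor \<open>X\<close> and one more factor \<open>Y\<close>.\<close>

lemma gauss_binomial_step:
  "(\<Sum>a\<le>n. gauss_binomial q a (n - a) * t (Suc a)) + (\<Sum>a\<le>n. gauss_binomial q a (n - a) * (q ^ a * t a)) =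
   (\<Sum>a\<le>Suc n. gauss_binomial q a (Suc n - a) * t a)"
proof -
  let ?g = "gauss_binomial q"
  have s: "(\<Sum>a\<le>n. h a) = h n + (\<Sum>a<n. h a)" for h :: "nat \<Rightarrow> complex"
    by (simp add: lessThan_Suc_atMost[symmetric])
  have s': "(\<Sum>a\<le>n. h a) = h 0 + (\<Sum>a<n. h (Suc a))" for h :: "nat \<Rightarrow> complex"
    unfolding lessThan_Suc_atMost[symmetric] sum.lessThan_Suc_shift ..
  have "(\<Sum>a\<le>Suc n. ?g a (Suc n - a) * t a) = t 0 + (\<Sum>a\<le>n. ?g (Suc a) (n - a) * t (Suc a))"
    unfolding sum.atMost_Suc_shift by simp
  also have "(\<Sum>a\<le>n. ?g (Suc a) (n - a) * t (Suc a)) =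
      t (Suc n) + (\<Sum>a<n. ?g (Suc a) (n - a) * t (Suc a))"
    by (simp add: s)
  also have "(\<Sum>a<n. ?g (Suc a) (n - a) * t (Suc a)) =
      (\<Sum>a<n. ?g a (n - a) * t (Suc a) + ?g (Suc a) (n - Suc a) * (q ^ Suc a * t (Suc a)))"
  proof (rule sum.cong)
    fix a assume "a \<in> {..<n}"
    then obtain b where "n - a = Suc b" "n - Suc a = b"
      by (metis Suc_diff_Suc lessThan_iff)
    then show "?g (Suc a) (n - a) * t (Suc a) =
        ?g a (n - a) * t (Suc a) + ?g (Suc a) (n - Suc a) * (q ^ Suc a * t (Suc a))"
      by (simp add: algebra_simps)
  qed simp
  finally have *: "(\<Sum>a\<le>Suc n. ?g a (Suc n - a) * t a) = t 0 + (t (Suc n) +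
      (\<Sum>a<n. ?g a (n - a) * t (Suc a) + ?g (Suc a) (n - Suc a) * (q ^ Suc a * t (Suc a))))" .
  show ?thesis
    unfolding * s[of "\<lambda>a. ?g a (n - a) * t (Suc a)"] s'[of "\<lambda>a. ?g a (n - a) * (q ^ a * t a)"]
    by (simp add: sum.distrib gauss_binomial_0_right)
qed

lemma app_pow_Suc: "A \<in> carrier_mat n n \<Longrightarrow> app (A ^\<^sub>m Suc l) v = app A (app (A ^\<^sub>m l) v)"
  unfolding pow_mat_Suc_left by (rule app_mult) (auto simp: pow_carrier_mat)

lemma app_pow_0: "A \<in> carrier_mat n n \<Longrightarrow> v \<in> cvecs n \<Longrightarrow> app (A ^\<^sub>m 0) v = v"
  by (simp add: app_one)

text \<open>Moving \<open>Y\<close> past \<open>X ^ a\<close> costs a factor \<open>q ^ a\<close>.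
  Working on the coordinates of a vector replaces sums of matrices by sums of complex
  numbers.\<close>

lemma q_binomial_app:
  assumes X: "X \<in> carrier_mat n n" and Y: "Y \<in> carrier_mat n n" and YX: "Y * X = q \<cdot>\<^sub>m (X * Y)"
    and v: "v \<in> cvecs n"
  shows "app ((X + Y) ^\<^sub>m l) v i =
    (\<Sum>a\<le>l. gauss_binomial q a (l - a) * app (X ^\<^sub>m a) (app (Y ^\<^sub>m (l - a)) v) i)"
proof -
  have XY: "X + Y \<in> carrier_mat n n" using X Y by simp
  have swap1: "app Y (app X u) = (\<lambda>i. q * app X (app Y u) i)" for u
    unfolding app_mult[OF Y X, symmetric] app_mult[OF X Y, symmetric] YX by (rule app_smult_mat)
  have swap: "app Y (app (X ^\<^sub>m a) u) = (\<lambda>i. q ^ a * app (X ^\<^sub>m a) (app Y u) i)" if "u \<in> cvecs n" for a u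
  proof (induction a)
    case 0
    have "app Y u \<in> cvecs n" using Y by (intro app_in_cvecs) auto
    then show ?case using that app_pow_0[OF X] by simp
  next
    case (Suc a)
    show ?case
      unfolding app_pow_Suc[OF X] swap1 Suc app_cmult by (simp add: mult.assoc)
  qed
  have "app ((X + Y) ^\<^sub>m l) v =
    (\<lambda>i. \<Sum>a\<le>l. gauss_binomial q a (l - a) * app (X ^\<^sub>m a) (app (Y ^\<^sub>m (l - a)) v) i)"
  proof (induction l)
    case 0
    show ?case using app_pow_0[OF X v] app_pow_0[OF Y v] app_pow_0[OF XY v] by simp
  next
    case (Suc l)
    let ?T = "\<lambda>a. app (X ^\<^sub>m a) (app (Y ^\<^sub>m (Suc l - a)) v)"
    have Yl: "app (Y ^\<^sub>m m) v \<in> cvecs n" for m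
      using pow_carrier_mat[OF Y, of m] by (intro app_in_cvecs) auto
    have 1: "app X (app (X ^\<^sub>m a) (app (Y ^\<^sub>m (l - a)) v)) = ?T (Suc a)" for a
      by (simp only: app_pow_Suc[OF X] diff_Suc_Suc)
    have 2: "app Y (app (X ^\<^sub>m a) (app (Y ^\<^sub>m (l - a)) v)) = (\<lambda>i. q ^ a * ?T a i)" if "a \<le> l" for a
      unfolding swap[OF Yl] using that by (simp only: Suc_diff_le app_pow_Suc[OF Y])
    have "app ((X + Y) ^\<^sub>m Suc l) v i = (\<Sum>a\<le>Suc l. gauss_binomial q a (Suc l - a) * ?T a i)" for i
    proof -
      have "app ((X + Y) ^\<^sub>m Suc l) v i =
          (\<Sum>a\<le>l. gauss_binomial q a (l - a) * app X (app (X ^\<^sub>m a) (app (Y ^\<^sub>m (l - a)) v)) i) +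
          (\<Sum>a\<le>l. gauss_binomial q a (l - a) * app Y (app (X ^\<^sub>m a) (app (Y ^\<^sub>m (l - a)) v)) i)"
        unfolding app_pow_Suc[OF XY] Suc app_add_mat[OF X Y] app_sum app_cmult
        by (simp only: distrib_left sum.distrib)
      also have "\<dots> = (\<Sum>a\<le>l. gauss_binomial q a (l - a) * ?T (Suc a) i) +
          (\<Sum>a\<le>l. gauss_binomial q a (l - a) * (q ^ a * ?T a i))"
        by (intro arg_cong2[where f = "(+)"] sum.cong refl) (simp_all add: 1 2 del: pow_mat.simps)
      also have "\<dots> = (\<Sum>a\<le>Suc l. gauss_binomial q a (Suc l - a) * ?T a i)"
        by (rule gauss_binomial_step)
      finally show ?thesis .
    qed
    then show ?case by (rule ext)
  qed
  then show ?thesis by (rule fun_cong)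
qed

lemma app_smult_one: "app (c \<cdot>\<^sub>m 1\<^sub>m n) v = (\<lambda>i. c * v i)" if "v \<in> cvecs n"
  unfolding app_smult_mat app_one[OF that] ..

text \<open>At a primitive \<open>d\<close>-th root of unity every mixed coefficient of the
  q-binomial expansion vanishes, and only \<open>X ^ d + Y ^ d\<close> is left. This is what makes
  matrix roots of a sum out of matrix roots of the summands.\<close>

lemma q_commuting_power_sum:
  fixes X Y :: "complex mat"
  assumes X: "X \<in> carrier_mat n n" and Y: "Y \<in> carrier_mat n n" and YX: "Y * X = q \<cdot>\<^sub>m (X * Y)"
    and q: "q ^ d = 1" "\<And>i. 0 < i \<Longrightarrow> i < d \<Longrightarrow> q ^ i \<noteq> 1" and d: "d > 0"
    and Xd: "X ^\<^sub>m d = a \<cdot>\<^sub>m 1\<^sub>m n" and Yd: "Y ^\<^sub>m d = b \<cdot>\<^sub>m 1\<^sub>m n"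
  shows "(X + Y) ^\<^sub>m d = (a + b) \<cdot>\<^sub>m 1\<^sub>m n"
proof (rule mat_eq_app)
  fix v :: cvec assume v: "v \<in> cvecs n"
  let ?t = "\<lambda>i l. gauss_binomial q l (d - l) * app (X ^\<^sub>m l) (app (Y ^\<^sub>m (d - l)) v) i"
  have "app ((X + Y) ^\<^sub>m d) v i = (a + b) * v i" for i
  proof -
    have "?t i l = 0" if "l \<in> {..d} - {0, d}" for l
    proof -
      have "gauss_binomial q l (d - l) = 0"
        using that q by (intro gauss_binomial_root_of_unity) auto
      then show ?thesis by simp
    qed
    then have "(\<Sum>l\<le>d. ?t i l) = (\<Sum>l\<in>{0, d}. ?t i l)"
      by (intro sum.mono_neutral_right) auto
    also have "\<dots> = app (X ^\<^sub>m 0) (app (Y ^\<^sub>m d) v) i + app (X ^\<^sub>m d) (app (Y ^\<^sub>m 0) v) i"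
      using d by (simp add: gauss_binomial_0_right del: pow_mat.simps)
    also have "\<dots> = b * v i + a * v i"
    proof -
      have "app (Y ^\<^sub>m 0) v = v" "app (Y ^\<^sub>m d) v = (\<lambda>i. b * v i)" "app (X ^\<^sub>m d) v = (\<lambda>i. a * v i)"
        unfolding app_pow_0[OF Y v] Xd Yd app_smult_one[OF v] by (rule refl)+
      moreover have "app (X ^\<^sub>m 0) (\<lambda>i. b * v i) = (\<lambda>i. b * v i)"
        unfolding app_cmult app_pow_0[OF X v] ..
      ultimately show ?thesis by simp
    qed
    finally show ?thesis
      unfolding q_binomial_app[OF X Y YX v] by (simp add: algebra_simps)
  qed
  then show "app ((X + Y) ^\<^sub>m d) v = app ((a + b) \<cdot>\<^sub>m 1\<^sub>m n) v"
    unfolding app_smult_one[OF v] by (rule ext)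
qed (use X Y in \<open>auto intro: pow_carrier_mat\<close>)

section \<open>Kronecker products\<close>

definition kron :: "complex mat \<Rightarrow> complex mat \<Rightarrow> complex mat" where
  "kron P Q = mat (dim_row P * dim_row Q) (dim_col P * dim_col Q)
     (\<lambda>(i, j). P $$ (i div dim_row Q, j div dim_col Q) * Q $$ (i mod dim_row Q, j mod dim_col Q))"

lemma kron_carrier: "P \<in> carrier_mat n n \<Longrightarrow> Q \<in> carrier_mat d d \<Longrightarrow> kron P Q \<in> carrier_mat (n * d) (n * d)"
  by (auto simp: kron_def)

lemma kron_index:
  "P \<in> carrier_mat n n \<Longrightarrow> Q \<in> carrier_mat d d \<Longrightarrow> i < n * d \<Longrightarrow> j < n * d \<Longrightarrow>
    kron P Q $$ (i, j) = P $$ (i div d, j div d) * Q $$ (i mod d, j mod d)"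
  by (auto simp: kron_def)

lemma div_less_mult: "i < n * d \<Longrightarrow> i div d < (n::nat)"
  by (simp add: less_mult_imp_div_less)

lemma mod_less_mult: "i < n * d \<Longrightarrow> i mod d < (d::nat)"
  by (cases "d = 0") auto

lemma sum_div_mod:
  "(\<Sum>l<n * d. F (l div d) (l mod d)) = (\<Sum>a<n. \<Sum>b<(d::nat). F a b)"
  unfolding sum.cartesian_product
proof (rule sum.reindex_bij_witness[where i = "\<lambda>(a, b). a * d + b" and j = "\<lambda>l. (l div d, l mod d)"])
  fix p assume p: "p \<in> {..<n} \<times> {..<d}"
  then obtain a b where ab: "p = (a, b)" "a < n" "b < d" by blast
  have "a * d + b < Suc a * d" using ab(3) by simp
  also have "\<dots> \<le> n * d" using ab(2) by (intro mult_le_mono1) simp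
  finally show "(case p of (a, b) \<Rightarrow> a * d + b) \<in> {..<n * d}" by (simp add: ab)
  show "((case p of (a, b) \<Rightarrow> a * d + b) div d, (case p of (a, b) \<Rightarrow> a * d + b) mod d) = p"
    using ab by simp
qed (auto simp: div_less_mult mod_less_mult)

lemma kron_mult:
  assumes "P \<in> carrier_mat n n" "P' \<in> carrier_mat n n" "Q \<in> carrier_mat d d" "Q' \<in> carrier_mat d d"
  shows "kron P Q * kron P' Q' = kron (P * P') (Q * Q')"
proof (rule eq_matI)
  have car: "kron P Q \<in> carrier_mat (n * d) (n * d)" "kron P' Q' \<in> carrier_mat (n * d) (n * d)"
    "kron (P * P') (Q * Q') \<in> carrier_mat (n * d) (n * d)" "P * P' \<in> carrier_mat n n" "Q * Q' \<in> carrier_mat d d"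
    using assms by (auto intro: kron_carrier)
  show "dim_row (kron P Q * kron P' Q') = dim_row (kron (P * P') (Q * Q'))"
    "dim_col (kron P Q * kron P' Q') = dim_col (kron (P * P') (Q * Q'))" using car by auto
  fix i j assume "i < dim_row (kron (P * P') (Q * Q'))" "j < dim_col (kron (P * P') (Q * Q'))"
  then have ij: "i < n * d" "j < n * d" using car(3) by auto
  note lt = div_less_mult[OF ij(1)] div_less_mult[OF ij(2)] mod_less_mult[OF ij(1)] mod_less_mult[OF ij(2)]
  have "(kron P Q * kron P' Q') $$ (i, j) = (\<Sum>l<n * d. kron P Q $$ (i, l) * kron P' Q' $$ (l, j))"
    using car(1,2) ij by (rule index_mat_mult)
  also have "\<dots> = (\<Sum>l<n * d. (P $$ (i div d, l div d) * P' $$ (l div d, j div d)) *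
      (Q $$ (i mod d, l mod d) * Q' $$ (l mod d, j mod d)))"
    by (intro sum.cong refl)
      (simp add: kron_index[OF assms(1,3) ij(1)] kron_index[OF assms(2,4) _ ij(2)])
  also have "\<dots> = (\<Sum>a<n. \<Sum>b<d. (P $$ (i div d, a) * P' $$ (a, j div d)) *
      (Q $$ (i mod d, b) * Q' $$ (b, j mod d)))"
    by (rule sum_div_mod[where F = "\<lambda>a b. (P $$ (i div d, a) * P' $$ (a, j div d)) *
      (Q $$ (i mod d, b) * Q' $$ (b, j mod d))"])
  also have "\<dots> = (P * P') $$ (i div d, j div d) * (Q * Q') $$ (i mod d, j mod d)"
    unfolding index_mat_mult[OF assms(1,2) lt(1,2)] index_mat_mult[OF assms(3,4) lt(3,4)] sum_product ..
  also have "\<dots> = kron (P * P') (Q * Q') $$ (i, j)"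
    by (rule kron_index[OF car(4,5) ij, symmetric])
  finally show "(kron P Q * kron P' Q') $$ (i, j) = kron (P * P') (Q * Q') $$ (i, j)" .
qed

lemma kron_smult_one: "kron (a \<cdot>\<^sub>m 1\<^sub>m n) (b \<cdot>\<^sub>m 1\<^sub>m d) = (a * b) \<cdot>\<^sub>m 1\<^sub>m (n * d)"
proof (rule eq_matI)
  fix i j assume "i < dim_row ((a * b) \<cdot>\<^sub>m 1\<^sub>m (n * d))" "j < dim_col ((a * b) \<cdot>\<^sub>m 1\<^sub>m (n * d))"
  then have ij: "i < n * d" "j < n * d" by auto
  have "i div d = j div d \<and> i mod d = j mod d \<longleftrightarrow> i = j"
    by (metis div_mult_mod_eq)
  then show "kron (a \<cdot>\<^sub>m 1\<^sub>m n) (b \<cdot>\<^sub>m 1\<^sub>m d) $$ (i, j) = ((a * b) \<cdot>\<^sub>m 1\<^sub>m (n * d)) $$ (i, j)"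
    using ij div_less_mult[OF ij(1)] div_less_mult[OF ij(2)] mod_less_mult[OF ij(1)] mod_less_mult[OF ij(2)]
    by (auto simp: kron_def)
qed (auto simp: kron_def)

lemma smult_1_mat: "1 \<cdot>\<^sub>m A = (A :: complex mat)"
  by (rule eq_matI) auto

lemma kron_one: "kron (1\<^sub>m n) (1\<^sub>m d) = 1\<^sub>m (n * d)"
  using kron_smult_one[of 1 n 1 d] by (simp add: smult_1_mat)

lemma kron_pow:
  assumes "P \<in> carrier_mat n n" and "Q \<in> carrier_mat d d"
  shows "kron P Q ^\<^sub>m l = kron (P ^\<^sub>m l) (Q ^\<^sub>m l)"
proof (induction l)
  case 0
  show ?case using assms kron_carrier[OF assms] by (simp add: kron_one)
next
  case (Suc l)
  then show ?case
    using kron_mult[OF pow_carrier_mat[OF assms(1), of l] assms(1) pow_carrier_mat[OF assms(2), of l] assms(2)] by simp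
qed

section \<open>Weighted cycles and clock matrices\<close>

definition weighted_cycle :: "nat \<Rightarrow> (nat \<Rightarrow> complex) \<Rightarrow> complex mat" where
  "weighted_cycle d g = mat d d (\<lambda>(i, j). if j = Suc i mod d then g i else 0)"

definition clock :: "nat \<Rightarrow> complex \<Rightarrow> complex mat" where
  "clock d q = mat d d (\<lambda>(i, j). if i = j then q ^ i else 0)"

lemma weighted_cycle_carrier: "weighted_cycle d g \<in> carrier_mat d d"
  by (simp add: weighted_cycle_def)

lemma clock_carrier: "clock d q \<in> carrier_mat d d"
  by (simp add: clock_def)

lemma app_weighted_cycle:
  "app (weighted_cycle d g) v = (\<lambda>i. if i < d then g i * v (Suc i mod d) else 0)"
proof
  fix i
  show "app (weighted_cycle d g) v i = (if i < d then g i * v (Suc i mod d) else 0)"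
  proof (cases "i < d")
    case True
    then show ?thesis
      by (simp add: app_def weighted_cycle_def if_distrib[of "\<lambda>a. a * _"] sum.delta cong: if_cong)
  qed (simp add: app_def weighted_cycle_def)
qed

lemma app_clock: "app (clock d q) v = (\<lambda>i. if i < d then q ^ i * v i else 0)"
proof
  fix i
  show "app (clock d q) v i = (if i < d then q ^ i * v i else 0)"
  proof (cases "i < d")
    case True
    then show ?thesis
      by (simp add: app_def clock_def if_distrib[of "\<lambda>a. a * _"] sum.delta' cong: if_cong)
  qed (simp add: app_def clock_def)
qed

lemma prod_rotate:
  fixes i d :: nat
  assumes "i < d"
  shows "(\<Prod>m<d. g ((i + m) mod d)) = (\<Prod>m<d. g m :: complex)"
proof (rule prod.reindex_bij_witness[where i = "\<lambda>m. (m + (d - i)) mod d" and j = "\<lambda>m. (i + m) mod d"])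
  fix m assume "m \<in> {..<d}"
  then have m: "m < d" by simp
  have "((i + m) mod d + (d - i)) mod d = (i + m + (d - i)) mod d"
    by (simp add: mod_add_left_eq)
  also have "\<dots> = m" using assms m by simp
  finally show "((i + m) mod d + (d - i)) mod d = m" .
  have "(i + (m + (d - i)) mod d) mod d = (i + (m + (d - i))) mod d"
    by (simp add: mod_add_right_eq)
  also have "\<dots> = m" using assms m by simp
  finally show "(i + (m + (d - i)) mod d) mod d = m" .
qed (use assms in auto)

text \<open>Walking \<open>d\<close> steps around the cycle returns to the start and collects every
  weight exactly once, whatever the start.\<close>

lemma weighted_cycle_pow: "weighted_cycle d g ^\<^sub>m d = (\<Prod>m<d. g m) \<cdot>\<^sub>m 1\<^sub>m d"
proof (rule mat_eq_app)
  fix v :: cvec assume v: "v \<in> cvecs d"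
  have *: "app (weighted_cycle d g ^\<^sub>m l) v i = (\<Prod>m<l. g ((i + m) mod d)) * v ((i + l) mod d)" if "i < d" for i l
    using that
  proof (induction l arbitrary: i)
    case 0
    then show ?case using app_pow_0[OF weighted_cycle_carrier v] by simp
  next
    case (Suc l)
    have "(Suc i mod d + m) mod d = Suc (i + m) mod d" for m
      using mod_add_left_eq[of "Suc i" d m] by simp
    then show ?case
      using Suc.IH[of "Suc i mod d"] Suc.prems
      unfolding app_pow_Suc[OF weighted_cycle_carrier] app_weighted_cycle prod.lessThan_Suc_shift
      by (simp add: mult.assoc)
  qed
  have "app (weighted_cycle d g ^\<^sub>m d) v i = (\<Prod>m<d. g m) * v i" for i
  proof (cases "i < d")
    case True
    then show ?thesis using *[OF True, of d] by (simp add: prod_rotate)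
  next
    case False
    have "app (weighted_cycle d g ^\<^sub>m d) v \<in> cvecs d"
      using pow_carrier_mat[OF weighted_cycle_carrier, of d g d] by (intro app_in_cvecs) auto
    then show ?thesis using False v by (simp add: cvecs_def)
  qed
  then show "app (weighted_cycle d g ^\<^sub>m d) v = app ((\<Prod>m<d. g m) \<cdot>\<^sub>m 1\<^sub>m d) v"
    unfolding app_smult_one[OF v] by (rule ext)
qed (auto intro: pow_carrier_mat weighted_cycle_carrier)

lemma clock_pow:
  assumes "q ^ d = 1"
  shows "clock d q ^\<^sub>m d = 1\<^sub>m d"
proof (rule mat_eq_app)
  fix v :: cvec assume v: "v \<in> cvecs d"
  have *: "app (clock d q ^\<^sub>m l) v i = (q ^ i) ^ l * v i" if "i < d" for i l
  proof (induction l)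
    case 0
    then show ?case using app_pow_0[OF clock_carrier v] by simp
  next
    case (Suc l)
    then show ?case
      unfolding app_pow_Suc[OF clock_carrier] app_clock using that by (simp add: mult.assoc)
  qed
  have "app (clock d q ^\<^sub>m d) v i = v i" for i
  proof (cases "i < d")
    case True
    have "(q ^ i) ^ d = 1" using assms by (metis power_mult mult.commute power_one)
    then show ?thesis using *[OF True, of d] by simp
  next
    case False
    have "app (clock d q ^\<^sub>m d) v \<in> cvecs d"
      using pow_carrier_mat[OF clock_carrier, of d q d] by (intro app_in_cvecs) auto
    then show ?thesis using False v by (simp add: cvecs_def)
  qed
  then show "app (clock d q ^\<^sub>m d) v = app (1\<^sub>m d) v"
    unfolding app_one[OF v] by (rule ext)
qed (auto intro: pow_carrier_mat clock_carrier)

lemma cycle_clock_commute: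
  assumes "q ^ d = 1"
  shows "weighted_cycle d g * clock d q = q \<cdot>\<^sub>m (clock d q * weighted_cycle d g)"
proof (rule mat_eq_app)
  fix v :: cvec
  \<comment> \<open>At the wrap-around \<open>i = d - 1\<close> the left side is
    \<open>q ^ 0\<close>, and the equation is \<open>q ^ d = 1\<close>.\<close>
  have "q ^ (Suc i mod d) = q * q ^ i" if "i < d" for i
  proof (cases "Suc i = d")
    case True
    then show ?thesis using assms by auto
  next
    case False
    then show ?thesis using that by simp
  qed
  then show "app (weighted_cycle d g * clock d q) v = app (q \<cdot>\<^sub>m (clock d q * weighted_cycle d g)) v"
    unfolding app_smult_mat app_mult[OF weighted_cycle_carrier clock_carrier]
      app_mult[OF clock_carrier weighted_cycle_carrier] app_clock app_weighted_cycle
    by (auto simp: fun_eq_iff)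
qed (use weighted_cycle_carrier[of d g] clock_carrier[of d q] in auto)

text \<open>The clock matrix in the first summand makes the two summands q-commute. With an identity
  matrix in its place they would commute, and the mixed terms of the \<open>d\<close>-th power would
  survive.\<close>

definition root_step :: "nat \<Rightarrow> complex \<Rightarrow> complex mat \<Rightarrow> (nat \<Rightarrow> complex) \<Rightarrow> complex mat" where
  "root_step d q A g = kron A (clock d q) + kron (1\<^sub>m (dim_row A)) (weighted_cycle d g)"

lemma root_step_carrier: "A \<in> carrier_mat n n \<Longrightarrow> root_step d q A g \<in> carrier_mat (n * d) (n * d)"
  unfolding root_step_def by (auto intro!: add_carrier_mat kron_carrier weighted_cycle_carrier)

lemma root_step_pow:
  assumes A: "A \<in> carrier_mat n n" "A ^\<^sub>m d = a \<cdot>\<^sub>m 1\<^sub>m n"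
    and q: "q ^ d = 1" "\<And>i. 0 < i \<Longrightarrow> i < d \<Longrightarrow> q ^ i \<noteq> 1" and d: "d > 0"
  shows "root_step d q A g ^\<^sub>m d = (a + (\<Prod>m<d. g m)) \<cdot>\<^sub>m 1\<^sub>m (n * d)"
proof -
  let ?Z = "clock d q" and ?B = "weighted_cycle d g" and ?I = "1\<^sub>m n :: complex mat"
  have I: "?I \<in> carrier_mat n n" by simp
  note Z = clock_carrier[of d q] and B = weighted_cycle_carrier[of d g]
  have "kron ?I ?B * kron A ?Z = kron A (?B * ?Z)"
    unfolding kron_mult[OF I A(1) B Z] using A(1) by simp
  also have "\<dots> = q \<cdot>\<^sub>m kron A (?Z * ?B)"
    unfolding cycle_clock_commute[OF q(1)] using A(1) Z B
    by (intro eq_matI) (auto simp: kron_def mod_less_mult)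
  also have "kron A (?Z * ?B) = kron A ?Z * kron ?I ?B"
    unfolding kron_mult[OF A(1) I Z B] using A(1) by simp
  finally have "kron ?I ?B * kron A ?Z = q \<cdot>\<^sub>m (kron A ?Z * kron ?I ?B)" .
  moreover have "kron A ?Z ^\<^sub>m d = a \<cdot>\<^sub>m 1\<^sub>m (n * d)"
    unfolding kron_pow[OF A(1) Z] A(2) clock_pow[OF q(1)]
    using kron_smult_one[of a n 1 d] by (simp add: smult_1_mat)
  moreover have "kron ?I ?B ^\<^sub>m d = (\<Prod>m<d. g m) \<cdot>\<^sub>m 1\<^sub>m (n * d)"
  proof -
    have "?I ^\<^sub>m d = ?I" by (induction d) auto
    then show ?thesis
      unfolding kron_pow[OF I B] weighted_cycle_pow
      using kron_smult_one[of 1 n "\<Prod>m<d. g m" d] by (simp add: smult_1_mat)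
  qed
  ultimately show ?thesis
    unfolding root_step_def carrier_matD(1)[OF A(1)] using q d
    by (intro q_commuting_power_sum[OF kron_carrier[OF A(1) Z] kron_carrier[OF I B]])
qed

section \<open>A grading modulo \<open>d\<close> that forces traces to vanish\<close>

definition graded :: "nat \<Rightarrow> (nat \<Rightarrow> nat) \<Rightarrow> complex mat \<Rightarrow> bool" where
  "graded d \<gamma> A \<longleftrightarrow>
     (\<forall>i<dim_row A. \<forall>j<dim_col A. A $$ (i, j) \<noteq> 0 \<longrightarrow> \<gamma> j mod d = Suc (\<gamma> i) mod d)"

lemma graded_pow:
  assumes A: "A \<in> carrier_mat n n" and "graded d \<gamma> A"
    and "i < n" and "j < n" and "(A ^\<^sub>m l) $$ (i, j) \<noteq> 0"
  shows "\<gamma> j mod d = (\<gamma> i + l) mod d"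
  using assms(4,5)
proof (induction l arbitrary: j)
  case 0
  then have "i = j" using A assms(3) by (auto split: if_splits)
  then show ?case by simp
next
  case (Suc l)
  have "(A ^\<^sub>m Suc l) $$ (i, j) = (\<Sum>a<n. (A ^\<^sub>m l) $$ (i, a) * A $$ (a, j))"
    unfolding pow_mat.simps using pow_carrier_mat[OF A] A assms(3) Suc.prems(1) by (rule index_mat_mult)
  then obtain a where a: "a < n" "(A ^\<^sub>m l) $$ (i, a) \<noteq> 0" "A $$ (a, j) \<noteq> 0"
    using Suc.prems(2) by (metis (no_types, lifting) lessThan_iff mult_eq_0_iff sum.neutral)
  have "\<gamma> j mod d = Suc (\<gamma> a) mod d"
    using assms(2) A a Suc.prems(1) by (simp add: graded_def)
  also have "\<dots> = Suc (\<gamma> a mod d) mod d" by (simp add: mod_Suc_eq)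
  also have "\<dots> = Suc (\<gamma> i + l) mod d"
    unfolding Suc.IH[OF a(1,2)] by (simp add: mod_Suc_eq)
  finally show ?case by simp
qed

text \<open>\<open>A ^ l\<close> shifts degrees by \<open>l\<close> modulo \<open>d\<close>, so a
  nonzero diagonal entry would make \<open>d\<close> divide \<open>l\<close>.\<close>

lemma graded_trace_pow:
  assumes A: "A \<in> carrier_mat n n" and "graded d \<gamma> A" and "0 < l" and "l < d"
  shows "trace_mat (A ^\<^sub>m l) = 0"
proof -
  have "(A ^\<^sub>m l) $$ (i, i) = 0" if "i < n" for i
  proof (rule ccontr)
    assume "(A ^\<^sub>m l) $$ (i, i) \<noteq> 0"
    then have "(\<gamma> i + 0) mod d = (\<gamma> i + l) mod d"
      using graded_pow[OF A assms(2) that that] by simp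
    then have "d dvd l"
      using mod_eq_dvd_iff_nat[of "\<gamma> i" "\<gamma> i + l" d] by simp
    then show False using assms(3,4) by (simp add: nat_dvd_not_less)
  qed
  then show ?thesis using A by (simp add: trace_mat_def)
qed

lemma root_step_index:
  assumes A: "A \<in> carrier_mat n n" and ij: "i < n * d" "j < n * d"
  shows "root_step d q A g $$ (i, j) = A $$ (i div d, j div d) * clock d q $$ (i mod d, j mod d) +
    1\<^sub>m n $$ (i div d, j div d) * weighted_cycle d g $$ (i mod d, j mod d)"
proof -
  have I: "1\<^sub>m n \<in> carrier_mat n n" by simp
  show ?thesis
    using ij A kron_carrier[OF A clock_carrier, of d q] kron_carrier[OF I weighted_cycle_carrier, of d g]
    by (simp add: root_step_def kron_index[OF A clock_carrier] kron_index[OF I weighted_cycle_carrier])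
qed

text \<open>The degree of a pair of indices is the sum of the degrees. The first summand shifts the
  degree of the block and keeps the position in the cycle; the second keeps the block and advances
  one place in the cycle.\<close>

lemma graded_root_step:
  assumes A: "A \<in> carrier_mat n n" and "graded d \<gamma> A" and "d > 0"
  shows "graded d (\<lambda>i. \<gamma> (i div d) + i mod d) (root_step d q A g)"
  unfolding graded_def
proof (intro allI impI)
  fix i j assume "i < dim_row (root_step d q A g)" "j < dim_col (root_step d q A g)"
    and ne: "root_step d q A g $$ (i, j) \<noteq> 0"
  then have ij: "i < n * d" "j < n * d" using root_step_carrier[OF A, of d q g] by auto
  note lt = div_less_mult[OF ij(1)] div_less_mult[OF ij(2)] mod_less_mult[OF ij(1)] mod_less_mult[OF ij(2)]
  consider "A $$ (i div d, j div d) \<noteq> 0" "clock d q $$ (i mod d, j mod d) \<noteq> 0" |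
    "1\<^sub>m n $$ (i div d, j div d) \<noteq> (0::complex)" "weighted_cycle d g $$ (i mod d, j mod d) \<noteq> 0"
    using ne unfolding root_step_index[OF A ij] by fastforce
  then show "(\<gamma> (j div d) + j mod d) mod d = Suc (\<gamma> (i div d) + i mod d) mod d"
  proof cases
    case 1
    have "i mod d = j mod d" using 1(2) lt by (auto simp: clock_def split: if_splits)
    moreover have "\<gamma> (j div d) mod d = Suc (\<gamma> (i div d)) mod d"
      using assms(2) A lt 1(1) by (simp add: graded_def)
    ultimately show ?thesis
      by (metis add_Suc mod_add_left_eq)
  next
    case 2
    have "i div d = j div d" using 2(1) lt by (auto split: if_splits)
    moreover have "j mod d = Suc (i mod d) mod d" using 2(2) lt by (auto simp: weighted_cycle_def split: if_splits)
    ultimately show ?thesis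
      by (metis add_Suc_right mod_add_right_eq)
  qed
qed

section \<open>Splitting monomials into factors of degree \<open>k\<close>\<close>

lemma exists_sub_multiindex:
  fixes m :: nat
  shows "k \<le> (\<Sum>i<m. a i) \<Longrightarrow> \<exists>b. (\<forall>i<m. b i \<le> (a i :: nat)) \<and> (\<Sum>i<m. b i) = k"
proof (induction m)
  case (Suc m)
  show ?case
  proof (cases "k \<le> (\<Sum>i<m. a i)")
    case True
    then obtain b where "\<forall>i<m. b i \<le> a i" "(\<Sum>i<m. b i) = k" using Suc.IH by blast
    then show ?thesis by (intro exI[of _ "b(m := 0)"]) (auto simp: less_Suc_eq)
  next
    case False
    then show ?thesis using Suc.prems
      by (intro exI[of _ "a(m := k - (\<Sum>i<m. a i))"]) (auto simp: less_Suc_eq)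
  qed
qed simp

text \<open>Parts of total degree \<open>k\<close> are split off one at a time; what remains of the
  exponent vector has total degree divisible by \<open>k\<close> again.\<close>

lemma exists_multiindex_decomposition:
  fixes m :: nat
  shows "(\<Sum>i<m. a i) = d * k \<Longrightarrow>
    \<exists>b :: nat \<Rightarrow> nat \<Rightarrow> nat. (\<forall>j<d. (\<Sum>i<m. b j i) = k) \<and> (\<forall>i<m. a i = (\<Sum>j<d. b j i))"
proof (induction d arbitrary: a)
  case (Suc d)
  obtain c where c: "\<forall>i<m. c i \<le> a i" "(\<Sum>i<m. c i) = k"
    using exists_sub_multiindex[of k a m] Suc.prems by auto
  have "(\<Sum>i<m. a i - c i) = (\<Sum>i<m. a i) - (\<Sum>i<m. c i)"
    using c(1) by (intro sum_subtractf_nat) auto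
  then have "(\<Sum>i<m. a i - c i) = d * k" using c(2) Suc.prems by simp
  then obtain b :: "nat \<Rightarrow> nat \<Rightarrow> nat" where b: "\<forall>j<d. (\<Sum>i<m. b j i) = k" "\<forall>i<m. a i - c i = (\<Sum>j<d. b j i)"
    using Suc.IH by blast
  have "\<forall>i<m. a i = (\<Sum>j<Suc d. (b(d := c)) j i)" using b(2) c(1) by (simp add: le_diff_conv2 diff_add_inverse2) (metis le_add_diff_inverse2)
  moreover have "\<forall>j<Suc d. (\<Sum>i<m. (b(d := c)) j i) = k" using b(1) c(2) by (simp add: less_Suc_eq)
  ultimately show ?case by blast
qed simp

lemma exists_primitive_root_of_unity:
  assumes "d > 0"
  shows "\<exists>q :: complex. q ^ d = 1 \<and> (\<forall>i. 0 < i \<longrightarrow> i < d \<longrightarrow> q ^ i \<noteq> 1)"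
proof -
  define e where "e = (\<lambda>j. exp (2 * of_real pi * \<i> * of_nat j / of_nat d))"
  have p: "e 1 ^ i = e i" for i
    by (simp add: e_def exp_of_nat_mult[symmetric] algebra_simps)
  have "e 1 ^ d = 1" unfolding e_def using complex_root_unity[of d 1] assms by simp
  moreover have "e 1 ^ i \<noteq> 1" if "0 < i" "i < d" for i
  proof -
    have "e i = e 0 \<longleftrightarrow> i mod d = 0 mod d"
      unfolding e_def using complex_root_unity_eq[of d i 0] assms by simp
    then show ?thesis using that unfolding p by (simp add: e_def)
  qed
  ultimately show ?thesis by blast
qed

lemma wforms_monom_factorization:
  assumes "(\<Sum>i<m. 1 * a i) = d * k" and "d > 0"
  shows "\<exists>g. (\<forall>j. g j \<in> wforms m (\<lambda>_. 1) k) \<and> (\<forall>x. c * (\<Prod>i<m. x i ^ a i) = (\<Prod>j<d. g j x))"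
proof -
  obtain b :: "nat \<Rightarrow> nat \<Rightarrow> nat" where b: "\<forall>j<d. (\<Sum>i<m. b j i) = k" "\<forall>i<m. a i = (\<Sum>j<d. b j i)"
    using exists_multiindex_decomposition[of a m d k] assms(1) by auto
  \<comment> \<open>The coefficient is put into factor 0, which exists because \<open>d > 0\<close>.
    Beyond \<open>d\<close> the zero form keeps the membership claim unconditional.\<close>
  define g where "g = (\<lambda>j x. if j < d then (if j = 0 then c else 1) * (\<Prod>i<m. x i ^ b j i) else (0::complex))"
  have "g j \<in> wforms m (\<lambda>_. 1) k" for j
  proof (cases "j < d")
    case True
    then show ?thesis using wforms_monom[of "\<lambda>_. 1" "b j" m k "if j = 0 then c else 1"] b(1) by (simp add: g_def)
  next
    case False
    then show ?thesis using wforms_zero[of m] by (simp add: g_def)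
  qed
  moreover have "c * (\<Prod>i<m. x i ^ a i) = (\<Prod>j<d. g j x)" for x
  proof -
    have "(\<Prod>i<m. x i ^ a i) = (\<Prod>i<m. \<Prod>j<d. x i ^ b j i)"
      using b(2) by (simp add: power_sum)
    also have "\<dots> = (\<Prod>j<d. \<Prod>i<m. x i ^ b j i)" by (rule prod.swap)
    finally show ?thesis
      using assms(2) by (simp add: g_def prod.distrib)
  qed
  ultimately show ?thesis by blast
qed

text \<open>
  A product of \<open>d\<close> forms of degree \<open>k\<close> has a weighted cycle as a \<open>d\<close>-th root, and tensoring with it
  adds the product to the form of which a root is already known.
\<close>

lemma exists_matrix_root:
  assumes "f \<in> wforms m (\<lambda>_. 1) (d * k)" and "d > 0"
  shows "\<exists>n A \<gamma>. n > 0 \<and> (\<forall>x. A x \<in> carrier_mat n n \<and> A x ^\<^sub>m d = f x \<cdot>\<^sub>m 1\<^sub>m n \<and> graded d \<gamma> (A x)) \<and>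
    (\<forall>i<n. \<forall>j<n. (\<lambda>x. A x $$ (i, j)) \<in> wforms m (\<lambda>_. 1) k)"
proof -
  obtain q :: complex where q: "q ^ d = 1" "\<And>i. 0 < i \<Longrightarrow> i < d \<Longrightarrow> q ^ i \<noteq> 1"
    using exists_primitive_root_of_unity[OF assms(2)] by blast
  obtain S :: "(nat \<Rightarrow> nat) set" and c
    where S: "finite S" "\<forall>a\<in>S. (\<Sum>i<m. 1 * a i) = d * k"
      "f = (\<lambda>x. \<Sum>a\<in>S. c a * (\<Prod>i<m. x i ^ a i))"
    using assms(1) unfolding wforms_def by blast
  show ?thesis
    unfolding S(3) using S(1,2)
  proof (induction S rule: finite_induct)
    case empty
    \<comment> \<open>For the zero form the 1 by 1 zero matrix is a root; an empty matrix would
      violate \<open>n > 0\<close>.\<close>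
    have "0\<^sub>m 1 1 ^\<^sub>m d = (0\<^sub>m 1 1 :: complex mat)"
      using assms(2) by (cases d) auto
    moreover have "0 \<cdot>\<^sub>m 1\<^sub>m 1 = (0\<^sub>m 1 1 :: complex mat)"
      by (rule eq_matI) auto
    ultimately show ?case
      by (intro exI[of _ 1] exI[of _ "\<lambda>_. 0\<^sub>m 1 1"] exI[of _ "\<lambda>_. 0"]) (simp add: graded_def wforms_zero)
  next
    case (insert a S)
    then have "\<forall>a\<in>S. (\<Sum>i<m. 1 * a i) = d * k" by simp
    from insert.IH[OF this] obtain n A \<gamma> where IH: "n > 0 \<and>
        (\<forall>x. A x \<in> carrier_mat n n \<and> A x ^\<^sub>m d = (\<Sum>a\<in>S. c a * (\<Prod>i<m. x i ^ a i)) \<cdot>\<^sub>m 1\<^sub>m n \<and> graded d \<gamma> (A x)) \<and>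
        (\<forall>i<n. \<forall>j<n. (\<lambda>x. A x $$ (i, j)) \<in> wforms m (\<lambda>_. 1) k)"
      by (elim exE) (rule that)
    then have n: "n > 0" and A: "\<And>x. A x \<in> carrier_mat n n"
      "\<And>x. A x ^\<^sub>m d = (\<Sum>a\<in>S. c a * (\<Prod>i<m. x i ^ a i)) \<cdot>\<^sub>m 1\<^sub>m n" "\<And>x. graded d \<gamma> (A x)"
      and Af: "\<And>i j. i < n \<Longrightarrow> j < n \<Longrightarrow> (\<lambda>x. A x $$ (i, j)) \<in> wforms m (\<lambda>_. 1) k"
      by simp_all
    have "(\<Sum>i<m. 1 * a i) = d * k" using insert.prems by simp
    from wforms_monom_factorization[OF this assms(2), of "c a"]
    obtain g where g: "(\<forall>j. g j \<in> wforms m (\<lambda>_. 1) k) \<and> (\<forall>x. c a * (\<Prod>i<m. x i ^ a i) = (\<Prod>j<d. g j x))"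
      by (elim exE) (rule that)
    let ?A = "\<lambda>x. root_step d q (A x) (\<lambda>j. g j x)"
    have "?A x ^\<^sub>m d = (\<Sum>a\<in>insert a S. c a * (\<Prod>i<m. x i ^ a i)) \<cdot>\<^sub>m 1\<^sub>m (n * d)" for x
    proof -
      have "?A x ^\<^sub>m d = ((\<Sum>a\<in>S. c a * (\<Prod>i<m. x i ^ a i)) + (\<Prod>j<d. g j x)) \<cdot>\<^sub>m 1\<^sub>m (n * d)"
        by (rule root_step_pow[OF A(1,2) q(1) _ assms(2)]) (rule q(2))
      also have "(\<Sum>a\<in>S. c a * (\<Prod>i<m. x i ^ a i)) + (\<Prod>j<d. g j x) =
          (\<Sum>a\<in>insert a S. c a * (\<Prod>i<m. x i ^ a i))"
        using insert.hyps g by simp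
      finally show ?thesis .
    qed
    moreover have "(\<lambda>x. ?A x $$ (i, j)) \<in> wforms m (\<lambda>_. 1) k" if ij: "i < n * d" "j < n * d" for i j
    proof -
      note lt = div_less_mult[OF ij(1)] div_less_mult[OF ij(2)] mod_less_mult[OF ij(1)] mod_less_mult[OF ij(2)]
      have "?A x $$ (i, j) = clock d q $$ (i mod d, j mod d) * A x $$ (i div d, j div d) +
          1\<^sub>m n $$ (i div d, j div d) * (if j mod d = Suc (i mod d) mod d then g (i mod d) x else 0)" for x
        unfolding root_step_index[OF A(1) ij] using lt by (simp add: weighted_cycle_def)
      moreover have "(\<lambda>x. if j mod d = Suc (i mod d) mod d then g (i mod d) x else 0) \<in> wforms m (\<lambda>_. 1) k"
        using g by (cases "j mod d = Suc (i mod d) mod d") (simp_all add: wforms_zero)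
      ultimately show ?thesis
        using Af[OF lt(1,2)] by (simp only: wforms_add wforms_cmult)
    qed
    ultimately show ?case
      using n assms(2) root_step_carrier[OF A(1)] graded_root_step[OF A(1,3) assms(2)]
      by (intro exI[of _ "n * d"] exI[of _ ?A] exI[of _ "\<lambda>i. \<gamma> (i div d) + i mod d"]) simp
  qed
qed

section \<open>Eigenspaces of matrix roots\<close>

text \<open>The complementary factor of \<open>t - A\<close> in
  \<open>t ^ d - A ^ d\<close>.\<close>

definition phi :: "nat \<Rightarrow> complex mat \<Rightarrow> complex \<Rightarrow> complex mat" where
  "phi d A t = mat (dim_row A) (dim_col A) (\<lambda>(i, j). \<Sum>l<d. t ^ (d - Suc l) * (A ^\<^sub>m l) $$ (i, j))"

lemma phi_carrier: "A \<in> carrier_mat n n \<Longrightarrow> phi d A t \<in> carrier_mat n n"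
  by (auto simp: phi_def)

lemma app_phi:
  assumes A: "A \<in> carrier_mat n n"
  shows "app (phi d A t) v i = (\<Sum>l<d. t ^ (d - Suc l) * app (A ^\<^sub>m l) v i)"
proof (cases "i < n")
  case True
  have "app (phi d A t) v i = (\<Sum>j<n. \<Sum>l<d. t ^ (d - Suc l) * ((A ^\<^sub>m l) $$ (i, j) * v j))"
    using True A by (simp add: app_def phi_def sum_distrib_right mult.assoc)
  also have "\<dots> = (\<Sum>l<d. \<Sum>j<n. t ^ (d - Suc l) * ((A ^\<^sub>m l) $$ (i, j) * v j))"
    by (rule sum.swap)
  also have "\<dots> = (\<Sum>l<d. t ^ (d - Suc l) * app (A ^\<^sub>m l) v i)"
    using True by (simp add: app_def sum_distrib_left carrier_matD[OF pow_carrier_mat[OF A]] del: pow_mat_dim)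
  finally show ?thesis .
next
  case False
  then show ?thesis using A by (simp add: app_def phi_def)
qed

text \<open>\<open>(A - t) \<Phi>\<close> telescopes to \<open>A ^ d - t ^ d\<close>, which vanishes
  by hypothesis.\<close>

lemma app_app_phi:
  assumes A: "A \<in> carrier_mat n n" and Ad: "A ^\<^sub>m d = t ^ d \<cdot>\<^sub>m 1\<^sub>m n" and v: "v \<in> cvecs n"
  shows "app A (app (phi d A t) v) = (\<lambda>i. t * app (phi d A t) v i)"
proof
  fix i
  let ?h = "\<lambda>l. t ^ (d - l) * app (A ^\<^sub>m l) v i"
  have "app A (app (phi d A t) v) i = (\<Sum>l<d. t ^ (d - Suc l) * app (A ^\<^sub>m Suc l) v i)"
  proof -
    have "app (phi d A t) v = (\<lambda>i. \<Sum>l<d. t ^ (d - Suc l) * app (A ^\<^sub>m l) v i)"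
      using app_phi[OF A] by (rule ext)
    then show ?thesis
      unfolding app_pow_Suc[OF A] by (simp only: app_sum app_cmult)
  qed
  moreover have "t * app (phi d A t) v i = (\<Sum>l<d. ?h l)"
    unfolding app_phi[OF A] sum_distrib_left
  proof (rule sum.cong)
    fix l assume "l \<in> {..<d}"
    then have "d - l = Suc (d - Suc l)" by auto
    then show "t * (t ^ (d - Suc l) * app (A ^\<^sub>m l) v i) = t ^ (d - l) * app (A ^\<^sub>m l) v i"
      by (simp only: power_Suc mult.assoc)
  qed simp
  moreover have "(\<Sum>l<d. ?h (Suc l) - ?h l) = ?h d - ?h 0"
    by (rule sum_lessThan_telescope)
  moreover have "?h d = ?h 0"
    unfolding Ad app_smult_one[OF v] app_pow_0[OF A v] by simp
  ultimately show "app A (app (phi d A t) v) i = t * app (phi d A t) v i"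
    by (simp add: sum_subtractf del: pow_mat.simps)
qed

text \<open>The eigenvalue \<open>s\<close> may differ from the parameter \<open>t\<close>: this
  compares different sheets over one point, where \<open>power_diff_quotient_roots\<close> makes
  \<open>\<Phi>\<close> at \<open>t\<close> kill the eigenvectors of all other sheets.\<close>

lemma app_phi_eigenvector:
  assumes A: "A \<in> carrier_mat n n" and v: "v \<in> cvecs n" and eig: "app A v = (\<lambda>i. s * v i)"
  shows "app (phi d A t) v i = (\<Sum>l<d. t ^ (d - Suc l) * s ^ l) * v i"
proof -
  have "app (A ^\<^sub>m l) v = (\<lambda>i. s ^ l * v i)" for l
  proof (induction l)
    case 0
    then show ?case using app_pow_0[OF A v] by simp
  next
    case (Suc l)
    show ?case unfolding app_pow_Suc[OF A] Suc app_cmult eig by (simp add: mult.left_commute mult.assoc)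
  qed
  then show ?thesis
    unfolding app_phi[OF A] by (simp add: sum_distrib_right mult.assoc)
qed

section \<open>Differentiating powers of a matrix\<close>

fun pow_deriv :: "complex mat \<Rightarrow> complex mat \<Rightarrow> nat \<Rightarrow> complex mat" where
  "pow_deriv A B 0 = 0\<^sub>m (dim_row A) (dim_row A)"
| "pow_deriv A B (Suc l) = pow_deriv A B l * A + A ^\<^sub>m l * B"

lemma pow_deriv_carrier:
  "A \<in> carrier_mat n n \<Longrightarrow> B \<in> carrier_mat n n \<Longrightarrow> pow_deriv A B l \<in> carrier_mat n n"
  by (induction l) (auto intro!: add_carrier_mat mult_carrier_mat[of _ n n] pow_carrier_mat)

lemma pow_mat_plus:
  assumes A: "A \<in> carrier_mat n n"
  shows "A ^\<^sub>m (a + b) = A ^\<^sub>m a * A ^\<^sub>m b"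
proof (induction b)
  case (Suc b)
  then show ?case
    using assoc_mult_mat[OF pow_carrier_mat[OF A, of a] pow_carrier_mat[OF A, of b] A] by simp
qed (use pow_carrier_mat[OF A, of a] A in simp)

text \<open>\<open>pow_deriv A B l\<close> is the sum of all
  \<open>A ^ i * B * A ^ (l - 1 - i)\<close>. Under the trace, and multiplied by a power of
  \<open>A\<close>, all these terms coincide.\<close>

lemma trace_pow_deriv:
  assumes A: "A \<in> carrier_mat n n" and B: "B \<in> carrier_mat n n"
  shows "trace_mat (pow_deriv A B (Suc l) * A ^\<^sub>m m) = of_nat (Suc l) * trace_mat (A ^\<^sub>m (l + m) * B)"
proof (induction l arbitrary: m)
  case 0
  have "pow_deriv A B (Suc 0) = B" using A B by simp
  then show ?case using trace_mat_comm[OF B pow_carrier_mat[OF A, of m]] by simp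
next
  case (Suc l)
  let ?D = "pow_deriv A B (Suc l)"
  note D = pow_deriv_carrier[OF A B, of "Suc l"] and P = pow_carrier_mat[OF A]
  have c: "?D * A \<in> carrier_mat n n" "A ^\<^sub>m Suc l * B \<in> carrier_mat n n"
    by (rule mult_carrier_mat[OF D A]) (rule mult_carrier_mat[OF P B])
  have "pow_deriv A B (Suc (Suc l)) * A ^\<^sub>m m = (?D * A) * A ^\<^sub>m m + (A ^\<^sub>m Suc l * B) * A ^\<^sub>m m"
    unfolding pow_deriv.simps(2)[of A B "Suc l"] by (rule add_mult_distrib_mat[OF c P])
  also have "(?D * A) * A ^\<^sub>m m = ?D * A ^\<^sub>m Suc m"
    unfolding pow_mat_Suc_left[OF A] by (rule assoc_mult_mat[OF D A P])
  finally have e: "pow_deriv A B (Suc (Suc l)) * A ^\<^sub>m m = ?D * A ^\<^sub>m Suc m + (A ^\<^sub>m Suc l * B) * A ^\<^sub>m m" .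
  have "trace_mat ((A ^\<^sub>m Suc l * B) * A ^\<^sub>m m) = trace_mat (A ^\<^sub>m m * (A ^\<^sub>m Suc l * B))"
    by (rule trace_mat_comm[OF c(2) P])
  also have "A ^\<^sub>m m * (A ^\<^sub>m Suc l * B) = (A ^\<^sub>m m * A ^\<^sub>m Suc l) * B"
    by (rule assoc_mult_mat[OF P P B, symmetric])
  also have "A ^\<^sub>m m * A ^\<^sub>m Suc l = A ^\<^sub>m (Suc l + m)"
    unfolding pow_mat_plus[OF A, symmetric] by (simp only: add.commute)
  finally show ?case
    unfolding e trace_mat_add[OF mult_carrier_mat[OF D P] mult_carrier_mat[OF c(2) P]] Suc.IH
    by (simp add: algebra_simps del: pow_mat.simps)
qed

lemma has_field_derivative_pow_mat:
  assumes A: "\<And>z. A z \<in> carrier_mat n n" and B: "B \<in> carrier_mat n n"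
    and deriv: "\<And>i j. i < n \<Longrightarrow> j < n \<Longrightarrow> ((\<lambda>z. A z $$ (i, j)) has_field_derivative B $$ (i, j)) (at z0)"
    and "i < n" and "j < n"
  shows "((\<lambda>z. (A z ^\<^sub>m l) $$ (i, j)) has_field_derivative pow_deriv (A z0) B l $$ (i, j)) (at z0)"
  using assms(5)
proof (induction l arbitrary: j)
  case 0
  have "(A z ^\<^sub>m 0) $$ (i, j) = (if i = j then 1 else 0)" for z
    using A[of z] assms(4) 0 by simp
  moreover have "pow_deriv (A z0) B 0 $$ (i, j) = 0" using A[of z0] assms(4) 0 by simp
  ultimately show ?case by (simp only: DERIV_const)
next
  case (Suc l)
  note P = pow_carrier_mat[OF A] and D = pow_deriv_carrier[OF A B]
  have 1: "(A z ^\<^sub>m Suc l) $$ (i, j) = (\<Sum>a<n. (A z ^\<^sub>m l) $$ (i, a) * A z $$ (a, j))" for z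
    unfolding pow_mat.simps by (rule index_mat_mult[OF P A assms(4) Suc.prems])
  have "pow_deriv (A z0) B (Suc l) $$ (i, j) =
      (pow_deriv (A z0) B l * A z0) $$ (i, j) + (A z0 ^\<^sub>m l * B) $$ (i, j)"
    using mult_carrier_mat[OF P B, of z0 l] assms(4) Suc.prems by (simp del: index_mult_mat)
  also have "\<dots> = (\<Sum>a<n. pow_deriv (A z0) B l $$ (i, a) * A z0 $$ (a, j) + B $$ (a, j) * (A z0 ^\<^sub>m l) $$ (i, a))"
    unfolding index_mat_mult[OF D A assms(4) Suc.prems] index_mat_mult[OF P B assms(4) Suc.prems]
    by (simp add: sum.distrib mult.commute)
  finally have 2: "pow_deriv (A z0) B (Suc l) $$ (i, j) =
      (\<Sum>a<n. pow_deriv (A z0) B l $$ (i, a) * A z0 $$ (a, j) + B $$ (a, j) * (A z0 ^\<^sub>m l) $$ (i, a))" .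
  show ?case
    unfolding 1 2 using Suc.IH deriv[OF _ Suc.prems] by (intro DERIV_sum DERIV_mult) auto
qed

text \<open>For \<open>s \<noteq> t\<close> the sum is the difference quotient of the
  \<open>d\<close>-th power, whose numerator is zero; for \<open>s = t\<close> it consists of
  \<open>d\<close> equal terms.\<close>

lemma power_diff_quotient_roots:
  fixes s t :: complex
  assumes "s ^ d = t ^ d"
  shows "(\<Sum>l<d. t ^ (d - Suc l) * s ^ l) = (if s = t then of_nat d * t ^ (d - 1) else 0)"
proof (cases "s = t")
  case True
  have "(\<Sum>l<d. t ^ (d - Suc l) * t ^ l) = (\<Sum>l<d. t ^ (d - 1))"
    by (intro sum.cong refl) (auto simp: power_add[symmetric])
  then show ?thesis using True by simp
next
  case False
  have "(s - t) * (\<Sum>l<d. t ^ (d - Suc l) * s ^ l) = 0"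
    using power_diff_sumr2[of s d t] assms by simp
  then show ?thesis using False by simp
qed

text \<open>The trace condition makes the rank \<open>n / d\<close>. That the range lies in the
  eigenspace is not part of the definition; it holds for the projectors constructed below because
  they have \<open>phi d A t\<close> as left factor.\<close>

definition eigen_projector :: "nat \<Rightarrow> nat \<Rightarrow> complex mat \<Rightarrow> complex \<Rightarrow> complex mat \<Rightarrow> bool" where
  "eigen_projector n d A t P \<longleftrightarrow> P \<in> carrier_mat n n \<and> P * P = P \<and> trace_mat P * of_nat d = of_nat n \<and>
     (\<forall>v\<in>cvecs n. app A v = (\<lambda>i. t * v i) \<longrightarrow> app P v = v)"

text \<open>Because \<open>\<Phi>\<close> maps into the eigenspace, a product
  \<open>\<Phi> Q\<close> that fixes all eigenvectors is automatically idempotent. Each of the two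
  cases therefore only has to supply \<open>Q\<close>, the trace and the action on
  eigenvectors.\<close>

lemma exists_eigen_projector:
  assumes A: "A \<in> carrier_mat n n" and Ad: "A ^\<^sub>m d = t ^ d \<cdot>\<^sub>m 1\<^sub>m n" and d: "d > 0" and gr: "graded d \<gamma> A"
    and sm: "t \<noteq> 0 \<or> (\<exists>B e. B \<in> carrier_mat n n \<and> e \<noteq> 0 \<and> pow_deriv A B d = e \<cdot>\<^sub>m 1\<^sub>m n)"
  shows "\<exists>Q. Q \<in> carrier_mat n n \<and> eigen_projector n d A t (phi d A t * Q)"
proof -
  note ph = phi_carrier[OF A, of d t]
  have "\<exists>Q. Q \<in> carrier_mat n n \<and> trace_mat (phi d A t * Q) * of_nat d = of_nat n \<and>
     (\<forall>v\<in>cvecs n. app A v = (\<lambda>i. t * v i) \<longrightarrow> app (phi d A t * Q) v = v)"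
  proof (cases "t = 0")
    case False
    define c where "c = 1 / (of_nat d * t ^ (d - 1))"
    have c: "c * (of_nat d * t ^ (d - 1)) = 1" using False d by (simp add: c_def)
    define Q where "Q = c \<cdot>\<^sub>m (1\<^sub>m n :: complex mat)"
    have Q: "Q \<in> carrier_mat n n" by (simp add: Q_def)
    have PQ: "phi d A t * Q = c \<cdot>\<^sub>m phi d A t"
      unfolding Q_def mult_smult_distrib[OF ph one_carrier_mat] right_mult_one_mat[OF ph] ..
    have "trace_mat (phi d A t) = (\<Sum>l<d. t ^ (d - Suc l) * trace_mat (A ^\<^sub>m l))"
      using A unfolding trace_mat_def phi_def
      by (simp add: sum_distrib_left) (rule sum.swap)
    \<comment> \<open>The grading removes every summand with \<open>0 < l < d\<close>.\<close>
    also have "\<dots> = (\<Sum>l<d. if l = 0 then t ^ (d - 1) * of_nat n else 0)"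
      using graded_trace_pow[OF A gr] A by (intro sum.cong refl) (auto simp: trace_mat_one simp del: pow_mat.simps(2))
    also have "\<dots> = t ^ (d - 1) * of_nat n" using d by simp
    finally have "trace_mat (phi d A t * Q) * of_nat d = (c * (of_nat d * t ^ (d - 1))) * of_nat n"
      unfolding PQ trace_mat_smult[OF ph] by simp
    then have "trace_mat (phi d A t * Q) * of_nat d = of_nat n" unfolding c by simp
    moreover have "app (phi d A t * Q) v = v" if "v \<in> cvecs n" "app A v = (\<lambda>i. t * v i)" for v
    proof
      fix i
      show "app (phi d A t * Q) v i = v i"
        unfolding PQ app_smult_mat app_phi_eigenvector[OF A that] power_diff_quotient_roots[OF refl]
        using c by (simp add: mult.assoc[symmetric])
    qed
    ultimately show ?thesis using Q by blast
  next
    case True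
    then obtain B e where B: "B \<in> carrier_mat n n" "e \<noteq> 0" "pow_deriv A B d = e \<cdot>\<^sub>m 1\<^sub>m n" using sm by blast
    obtain c where c: "d = Suc c" using d by (cases d) auto
    define Q where "Q = (1 / e) \<cdot>\<^sub>m B"
    have Q: "Q \<in> carrier_mat n n" using B by (simp add: Q_def)
    \<comment> \<open>With \<open>t = 0\<close> only the summand \<open>l = d - 1\<close> survives,
      since there \<open>0 ^ 0 = 1\<close>.\<close>
    have "phi d A t = A ^\<^sub>m c"
    proof (rule eq_matI)
      fix i j assume "i < dim_row (A ^\<^sub>m c)" "j < dim_col (A ^\<^sub>m c)"
      then have ij: "i < n" "j < n" using pow_carrier_mat[OF A, of c] by auto
      have "(\<Sum>l<d. t ^ (d - Suc l) * (A ^\<^sub>m l) $$ (i, j)) = (\<Sum>l<d. if l = c then (A ^\<^sub>m l) $$ (i, j) else 0)"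
        using c True by (intro sum.cong refl) (auto simp del: pow_mat.simps)
      then show "phi d A t $$ (i, j) = (A ^\<^sub>m c) $$ (i, j)" using ij A c by (simp add: phi_def)
    qed (use A in \<open>auto simp: phi_def\<close>)
    then have PQ: "phi d A t * Q = (1 / e) \<cdot>\<^sub>m (A ^\<^sub>m c * B)"
      unfolding Q_def by (simp add: mult_smult_distrib[OF pow_carrier_mat[OF A] B(1)])
    have AB: "A ^\<^sub>m c * B \<in> carrier_mat n n" using mult_carrier_mat[OF pow_carrier_mat[OF A] B(1)] .
    \<comment> \<open>Taking traces in the differentiated equation yields
      \<open>e * n = d * trace (A ^ (d - 1) * B)\<close>, so dividing \<open>B\<close> by
      \<open>e\<close> gives the trace \<open>n / d\<close>.\<close>
    have "trace_mat (e \<cdot>\<^sub>m (1\<^sub>m n :: complex mat)) = of_nat d * trace_mat (A ^\<^sub>m c * B)"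
      using trace_pow_deriv[OF A B(1), of c 0] A B pow_deriv_carrier[OF A B(1), of d] c by simp
    then have "e * of_nat n = of_nat d * trace_mat (A ^\<^sub>m c * B)"
      by (simp add: trace_mat_smult[of _ n] trace_mat_one)
    then have "trace_mat (phi d A t * Q) * of_nat d = of_nat n"
      unfolding PQ trace_mat_smult[OF AB] using B(2) by (simp add: field_simps)
    moreover have "app (phi d A t * Q) v = v" if v: "v \<in> cvecs n" "app A v = (\<lambda>i. t * v i)" for v
    proof -
      have Av: "app A v = (\<lambda>_. 0)" using v(2) True by simp
      \<comment> \<open>On the kernel of \<open>A\<close> every term of the derivative that ends in
        \<open>A\<close> vanishes; only \<open>A ^ (d - 1) * B\<close> remains.\<close>
      have "app (pow_deriv A B d) v = app (A ^\<^sub>m c * B) v"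
        unfolding c pow_deriv.simps
          app_add_mat[OF mult_carrier_mat[OF pow_deriv_carrier[OF A B(1)] A] AB]
          app_mult[OF pow_deriv_carrier[OF A B(1)] A] Av app_0 by simp
      then have "app (A ^\<^sub>m c * B) v = (\<lambda>i. e * v i)"
        unfolding B(3) app_smult_one[OF v(1)] ..
      then show ?thesis
        unfolding PQ app_smult_mat using B(2) by simp
    qed
    ultimately show ?thesis using Q by blast
  qed
  then obtain Q where Q: "Q \<in> carrier_mat n n" "trace_mat (phi d A t * Q) * of_nat d = of_nat n"
     "\<And>v. v \<in> cvecs n \<Longrightarrow> app A v = (\<lambda>i. t * v i) \<Longrightarrow> app (phi d A t * Q) v = v"
    by blast
  have P: "phi d A t * Q \<in> carrier_mat n n" using mult_carrier_mat[OF ph Q(1)] .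
  have "(phi d A t * Q) * (phi d A t * Q) = phi d A t * Q"
  proof (rule mat_eq_app[OF mult_carrier_mat[OF P P] P])
    fix v :: cvec assume v: "v \<in> cvecs n"
    have "app Q v \<in> cvecs n" "app (phi d A t * Q) v \<in> cvecs n"
      using Q(1) P by (auto intro!: app_in_cvecs)
    moreover have "app A (app (phi d A t * Q) v) = (\<lambda>i. t * app (phi d A t * Q) v i)"
      unfolding app_mult[OF ph Q(1)] by (rule app_app_phi[OF A Ad]) fact
    ultimately show "app ((phi d A t * Q) * (phi d A t * Q)) v = app (phi d A t * Q) v"
      unfolding app_mult[OF P P] by (intro Q(3))
  qed
  then show ?thesis
    unfolding eigen_projector_def using Q P by blast
qed

text \<open>The adjugate is a left inverse of \<open>F\<close> up to the determinant without further
  ado. That it also reproduces eigenvectors is a dimension count: \<open>P = V * W\<close> has rank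
  exactly \<open>r\<close>, so \<open>F = V * G\<close> with \<open>G\<close> square and invertible,
  and the columns of \<open>F\<close> span the range of \<open>P\<close>.\<close>

lemma frame_inverse:
  assumes P: "eigen_projector n d A t P" and d: "d > 0" and rn: "r * d = n"
    and F: "F \<in> carrier_mat n r" and PF: "P * F = F" and W0: "W0 \<in> carrier_mat r n"
    and det: "det (W0 * F) \<noteq> 0" and v: "v \<in> cvecs n" "app A v = (\<lambda>i. t * v i)"
  shows "app F (app (adj_mat (W0 * F) * W0) v) = (\<lambda>i. det (W0 * F) * v i)"
proof -
  have Pc: "P \<in> carrier_mat n n" "P * P = P" and tr: "trace_mat P * of_nat d = of_nat n"
    and Pv: "app P v = v"
    using P v by (auto simp: eigen_projector_def)
  obtain s V W where VW: "V \<in> carrier_mat n s" "W \<in> carrier_mat s n" "P = V * W" "W * V = 1\<^sub>m s"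
    "trace_mat P = of_nat s"
    by (rule idempotent_mat_factorization[OF Pc]) (rule that)
  have "of_nat (s * d) = (of_nat (r * d) :: complex)" using tr VW(5) rn by simp
  then have "s = r" using d unfolding of_nat_eq_iff by simp
  note VW = VW[unfolded this]
  define G where "G = W * F"
  define M where "M = W0 * F"
  have G: "G \<in> carrier_mat r r" unfolding G_def using VW(2) F by simp
  have M: "M \<in> carrier_mat r r" unfolding M_def using W0 F by simp
  have W0V: "W0 * V \<in> carrier_mat r r" using W0 VW(1) by simp
  have FG: "F = V * G"
    unfolding G_def using PF assoc_mult_mat[OF VW(1,2) F] unfolding VW(3) by simp
  have "M = W0 * V * G"
    unfolding M_def by (subst FG) (rule assoc_mult_mat[OF W0 VW(1) G, symmetric])
  then have "det M = det (W0 * V) * det G" by (simp add: det_mult[OF W0V G])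
  then have dG: "det G \<noteq> 0" using det by (auto simp: M_def)
  note adjG = adj_mat[OF G] and adjM = adj_mat[OF M]
  \<comment> \<open>By Cramer's rule \<open>u\<close> satisfies \<open>F u = det G * v\<close>,
    which exhibits \<open>v\<close> in the span of the frame; \<open>det G\<close> is cancelled at
    the end.\<close>
  define u where "u = app (adj_mat G) (app W v)"
  have Wv: "app W v \<in> cvecs r" using VW(2) by (intro app_in_cvecs) auto
  have u: "u \<in> cvecs r" unfolding u_def using adjG(1) by (intro app_in_cvecs) auto
  have "app F u = app V (app G u)"
    by (subst FG) (rule app_mult[OF VW(1) G])
  also have "app G u = (\<lambda>i. det G * app W v i)"
    unfolding u_def app_mult[OF G adjG(1), symmetric] adjG(2) by (rule app_smult_one[OF Wv])
  also have "app V (\<lambda>i. det G * app W v i) = (\<lambda>i. det G * app P v i)"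
    unfolding app_cmult VW(3) app_mult[OF VW(1,2)] ..
  finally have Fu: "app F u = (\<lambda>i. det G * v i)" unfolding Pv .
  have "app F (app (adj_mat M * W0) (app F u)) = (\<lambda>i. det M * app F u i)"
  proof -
    have "app (adj_mat M * W0) (app F u) = app (adj_mat M) (app W0 (app F u))"
      by (rule app_mult[OF adjM(1) W0])
    also have "app W0 (app F u) = app M u"
      unfolding M_def by (rule app_mult[OF W0 F, symmetric])
    also have "app (adj_mat M) (app M u) = (\<lambda>i. det M * u i)"
      unfolding app_mult[OF adjM(1) M, symmetric] adjM(3) by (rule app_smult_one[OF u])
    finally show ?thesis by (simp only: app_cmult)
  qed
  then have *: "(\<lambda>i. det G * app F (app (adj_mat M * W0) v) i) = (\<lambda>i. det M * (det G * v i))"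
    unfolding Fu app_cmult .
  then have "det G * app F (app (adj_mat M * W0) v) i = det G * (det M * v i)" for i
    using fun_cong[OF *, of i] by (simp only: mult.left_commute)
  then show ?thesis
    using dG by (simp add: M_def fun_eq_iff)
qed

section \<open>Determinants and adjugates of matrices of forms\<close>

lemma wforms_det:
  assumes "\<And>x. M x \<in> carrier_mat r r" and "\<And>i j. i < r \<Longrightarrow> j < r \<Longrightarrow> (\<lambda>x. M x $$ (i, j)) \<in> wforms m w e"
  shows "(\<lambda>x. det (M x)) \<in> wforms m w (r * e)"
proof -
  have "(\<lambda>x. \<Prod>i = 0..<r. M x $$ (i, p i)) \<in> wforms m w (r * e)" if "p permutes {0..<r}" for p
  proof -
    have "(\<lambda>x. \<Prod>i = 0..<r. M x $$ (i, p i)) \<in> wforms m w (\<Sum>i = 0..<r. e)"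
      using assms(2) permutes_in_image[OF that] by (intro wforms_prod) auto
    then show ?thesis by simp
  qed
  then show ?thesis
    unfolding det_def'[OF assms(1)] by (intro wforms_sum wforms_cmult) auto
qed

lemma wforms_adj_mat:
  assumes "\<And>x. M x \<in> carrier_mat r r" and "\<And>i j. i < r \<Longrightarrow> j < r \<Longrightarrow> (\<lambda>x. M x $$ (i, j)) \<in> wforms m w e"
    and "i < r" and "j < r"
  shows "(\<lambda>x. adj_mat (M x) $$ (i, j)) \<in> wforms m w ((r - 1) * e)"
proof -
  have "(\<lambda>x. det (mat_delete (M x) j i)) \<in> wforms m w ((r - 1) * e)"
  proof (rule wforms_det)
    show "mat_delete (M x) j i \<in> carrier_mat (r - 1) (r - 1)" for x
      using assms(1) by (rule mat_delete_carrier)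
    fix i' j' assume "i' < r - 1" "j' < r - 1"
    then show "(\<lambda>x. mat_delete (M x) j i $$ (i', j')) \<in> wforms m w e"
      using assms(2) carrier_matD[OF assms(1)] by (simp add: mat_delete_def)
  qed
  then have "(\<lambda>x. (- 1) ^ (j + i) * det (mat_delete (M x) j i)) \<in> wforms m w ((r - 1) * e)"
    by (rule wforms_cmult)
  then show ?thesis
    using assms(3,4) carrier_matD[OF assms(1)] by (simp add: adj_mat_def cofactor_def)
qed

section \<open>Geometry of the cyclic covering\<close>

text \<open>Serves twice: along a line between two points it proves density statements, and in a
  coordinate direction it provides partial derivatives.\<close>

lemma wforms_on_line:
  assumes "F \<in> wforms m w e"
  shows "\<exists>p. \<forall>z. F (\<lambda>i. x i + z * v i) = poly p z"
  using assms
proof (induction rule: wforms_induct)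
  case zero
  show ?case by (intro exI[of _ 0]) simp
next
  case (monom c a)
  show ?case
    by (intro exI[of _ "Polynomial.smult c (\<Prod>i<m. [:x i, v i:] ^ a i)"]) (simp add: poly_prod mult.commute)
next
  case (add F G)
  then obtain p q where "\<forall>z. F (\<lambda>i. x i + z * v i) = poly p z" "\<forall>z. G (\<lambda>i. x i + z * v i) = poly q z"
    by blast
  then show ?case by (intro exI[of _ "p + q"]) simp
qed

lemma wforms_0:
  assumes "F \<in> wforms m (\<lambda>_. 1) e" and "e > 0"
  shows "F (\<lambda>_. 0) = 0"
  using wforms_scale[OF assms(1), of 0 "\<lambda>_. 0"] zero_power[OF assms(2), where 'a = complex] by simp

text \<open>Multiplication by a primitive root of unity \<open>q\<close> permutes the roots and
  multiplies the sum by \<open>q ^ l\<close>, which differs from 1 when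
  \<open>0 < l < d\<close>.\<close>

lemma power_sum_roots:
  fixes c :: complex
  assumes "d > 0" and "c \<noteq> 0" and "0 < l" and "l \<le> d"
  shows "(\<Sum>t\<in>{t. t ^ d = c}. t ^ l) = (if l = d then of_nat d * c else 0)"
proof (cases "l = d")
  case True
  then have "(\<Sum>t\<in>{t. t ^ d = c}. t ^ l) = (\<Sum>t\<in>{t. t ^ d = c}. c)"
    by (intro sum.cong) auto
  then show ?thesis using True card_nth_roots[OF assms(2,1)] by simp
next
  case False
  obtain q :: complex where q: "q ^ d = 1" "\<And>i. 0 < i \<Longrightarrow> i < d \<Longrightarrow> q ^ i \<noteq> 1"
    using exists_primitive_root_of_unity[OF assms(1)] by blast
  have "q \<noteq> 0" using q(1) assms(1) by (auto simp: zero_power)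
  have "(\<Sum>t\<in>{t. t ^ d = c}. t ^ l) = (\<Sum>t\<in>{t. t ^ d = c}. (q * t) ^ l)"
    using q(1) \<open>q \<noteq> 0\<close>
    by (intro sum.reindex_bij_witness[where i = "\<lambda>t. q * t" and j = "\<lambda>t. t / q"])
      (auto simp: power_mult_distrib power_divide)
  also have "\<dots> = q ^ l * (\<Sum>t\<in>{t. t ^ d = c}. t ^ l)"
    by (simp add: power_mult_distrib sum_distrib_left)
  finally have "(1 - q ^ l) * (\<Sum>t\<in>{t. t ^ d = c}. t ^ l) = 0"
    by (simp add: algebra_simps)
  then show ?thesis using q(2)[of l] False assms(3,4) by simp
qed

lemma finite_nth_roots: "d > 0 \<Longrightarrow> c \<noteq> 0 \<Longrightarrow> finite {t :: complex. t ^ d = c}"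
  using card_nth_roots[of c d] card_ge_0_finite by fastforce

text \<open>Replaces sums and products over the sheets by ones over rotations, which act on
  forms.\<close>

lemma bij_betw_roots:
  fixes c t :: complex
  assumes d: "d > 0" and c: "c \<noteq> 0" and t: "t ^ d = c" and q: "q ^ d = 1" "\<And>i. 0 < i \<Longrightarrow> i < d \<Longrightarrow> q ^ i \<noteq> 1"
  shows "bij_betw (\<lambda>j. q ^ j * t) {..<d} {s. s ^ d = c}"
proof -
  have "q \<noteq> 0" "t \<noteq> 0" using q(1) t c d by (auto simp: zero_power)
  have inj: "inj_on (\<lambda>j. q ^ j * t) {..<d}"
  proof (rule linorder_inj_onI)
    fix i j assume "i < j" "i \<in> {..<d}" "j \<in> {..<d}"
    then have "q ^ (j - i) \<noteq> 1" using q(2)[of "j - i"] by auto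
    moreover have "q ^ j = q ^ i * q ^ (j - i)" using \<open>i < j\<close> by (simp add: power_add[symmetric])
    ultimately show "q ^ i * t \<noteq> q ^ j * t" using \<open>q \<noteq> 0\<close> \<open>t \<noteq> 0\<close> by auto
  qed auto
  have "(q ^ j * t) ^ d = c" for j
    using t q(1) by (metis mult.commute mult_1 power_mult power_mult_distrib power_one)
  then have "(\<lambda>j. q ^ j * t) ` {..<d} \<subseteq> {s. s ^ d = c}" by auto
  moreover have "card ((\<lambda>j. q ^ j * t) ` {..<d}) = card {s. s ^ d = c}"
    using card_image[OF inj] card_nth_roots[OF c d] by simp
  ultimately have "(\<lambda>j. q ^ j * t) ` {..<d} = {s. s ^ d = c}"
    using finite_nth_roots[OF d c] by (intro card_subset_eq)
  with inj show ?thesis by (rule bij_betw_imageI)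
qed

text \<open>A nonzero polynomial of degree below \<open>d\<close> cannot have the \<open>d\<close>
  roots of \<open>c\<close> among its zeros. It is used to compare coefficients of powers of
  \<open>t\<close> over one point of the base.\<close>

lemma coefficients_zero_of_roots:
  fixes a :: "nat \<Rightarrow> complex"
  assumes "d > 0" and "c \<noteq> 0" and "\<And>t. t ^ d = c \<Longrightarrow> (\<Sum>i<d. t ^ i * a i) = 0" and "i < d"
  shows "a i = 0"
proof (rule ccontr)
  assume "a i \<noteq> 0"
  obtain m where m: "d = Suc m" using assms(1) by (cases d) auto
  have fin: "finite {z. (\<Sum>i\<le>m. a i * z ^ i) = 0}" "card {z. (\<Sum>i\<le>m. a i * z ^ i) = 0} \<le> m"
    using polyfun_rootbound[where c = a and n = m] \<open>a i \<noteq> 0\<close> assms(4) m by (auto simp: less_Suc_eq_le)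
  have "{t. t ^ d = c} \<subseteq> {z. (\<Sum>i\<le>m. a i * z ^ i) = 0}"
    using assms(3) by (auto simp: m lessThan_Suc_atMost mult.commute simp del: power_Suc)
  from card_mono[OF fin(1) this] show False
    using fin(2) card_nth_roots[OF assms(2,1)] m by simp
qed

text \<open>For \<open>c ^ d = 1\<close> the substitution is a deck transformation, so products of a
  form over all sheets are forms again.\<close>

lemma wforms_rotate:
  assumes "F \<in> wforms (Suc (Suc n)) w e"
  shows "(\<lambda>x. F (x(Suc n := c * x (Suc n)))) \<in> wforms (Suc (Suc n)) w e"
  using assms
proof (induction rule: wforms_induct)
  case zero
  show ?case by (rule wforms_zero)
next
  case (monom b a)
  have "(\<Prod>i<Suc (Suc n). (x(Suc n := c * x (Suc n))) i ^ a i) =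
      c ^ a (Suc n) * (\<Prod>i<Suc (Suc n). x i ^ a i)" for x :: cvec
    by (simp add: power_mult_distrib)
  then show ?case
    using wforms_monom[OF monom, of "b * c ^ a (Suc n)"] by (simp only: mult.assoc)
next
  case (add F G)
  then show ?case by (intro wforms_add)
qed

section \<open>Cones over projective space and over the covering\<close>

locale cover =
  fixes n d k :: nat and f :: "cvec \<Rightarrow> complex"
  assumes d: "d > 0" and k: "k > 0" and f: "f \<in> wforms (Suc n) (\<lambda>_. 1) (d * k)"
    and f_nonzero: "\<exists>x\<in>cvecs (Suc n). f x \<noteq> 0"
begin

abbreviation "wP \<equiv> \<lambda>_ :: nat. 1 :: nat"
abbreviation "wX \<equiv> cov_wt n k"
abbreviation "KP \<equiv> {x \<in> cvecs (Suc n). \<exists>i\<le>n. x i \<noteq> 0}"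
abbreviation "KX \<equiv> {x \<in> total_cone n. x (Suc n) ^ d = f (forget_t n x)}"
abbreviation "formsP \<equiv> wforms (Suc n) wP"
abbreviation "formsX \<equiv> wforms (Suc (Suc n)) wX"
abbreviation "openP \<equiv> wzariski_open (Suc n) wP KP"
abbreviation "openX \<equiv> wzariski_open (Suc (Suc n)) wX KX"
abbreviation "regP \<equiv> wregular (Suc n) wP KP"
abbreviation "regX \<equiv> wregular (Suc (Suc n)) wX KX"
abbreviation "ratP \<equiv> rat_on (Suc n) wP KP"
abbreviation "ratX \<equiv> rat_on (Suc (Suc n)) wX KX"
abbreviation "coneP \<equiv> cone_over wP KP"
abbreviation "X \<equiv> cyclic_cover n d k f"

text \<open>Membership is tested on the base, which suits pullbacks; \<open>cone_over_preim\<close>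
  identifies this with the cone over the preimage upstairs.\<close>

definition coneX :: "cvec set set \<Rightarrow> cvec set" where
  "coneX V = {x \<in> KX. orb wP (forget_t n x) \<in> V}"

definition preim :: "cvec set set \<Rightarrow> cvec set set" where
  "preim V = {Q \<in> pts X. cover_map n Q \<in> V}"

lemma cone_over_preim: "cone_over wX KX (preim V) = coneX V"
  by (auto simp: cone_over_def preim_def coneX_def cyclic_cover_def pts_wvariety cover_map_orb)

lemma forget_in: "x \<in> KX \<Longrightarrow> forget_t n x \<in> KP"
proof -
  assume x: "x \<in> KX"
  have "forget_t n x i = 0" if "i \<ge> Suc n" for i
    using x that by (auto simp: total_cone_def forget_t_def cvecs_def)
  moreover obtain i where "i \<le> n" "x i \<noteq> 0" using x by (auto simp: total_cone_def)
  moreover from this have "forget_t n x i \<noteq> 0" by (simp add: forget_t_def)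
  ultimately show ?thesis by (auto simp: cvecs_def)
qed

lemma lift_in:
  assumes "y \<in> KP" and "t ^ d = f y"
  shows "y(Suc n := t) \<in> KX" and "forget_t n (y(Suc n := t)) = y"
proof -
  have "y (Suc n) = 0" using assms(1) by (auto simp: cvecs_def)
  then show *: "forget_t n (y(Suc n := t)) = y" by (auto simp: forget_t_def)
  obtain i where "i \<le> n" "y i \<noteq> 0" using assms(1) by blast
  then have "\<exists>i\<le>n. (y(Suc n := t)) i \<noteq> 0" by (intro exI[of _ i]) simp
  moreover have "y(Suc n := t) \<in> cvecs (Suc (Suc n))" using assms(1) by (auto simp: cvecs_def)
  ultimately show "y(Suc n := t) \<in> KX" using * assms(2) by (simp add: total_cone_def)
qed

lemma lift_in_coneX:
  "y \<in> coneP V \<Longrightarrow> t ^ d = f y \<Longrightarrow> y(Suc n := t) \<in> coneX V"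
  using lift_in[of y t] by (simp add: coneX_def cone_over_def del: fun_upd_apply)

lemma coneX_lift:
  assumes "x \<in> coneX V"
  obtains y t where "y \<in> coneP V" "t ^ d = f y" "x = y(Suc n := t)" "forget_t n x = y" "x (Suc n) = t"
proof (rule that[of "forget_t n x" "x (Suc n)"])
  show "forget_t n x \<in> coneP V" using assms forget_in by (simp add: coneX_def cone_over_def)
qed (use assms in \<open>auto simp: coneX_def forget_t_def\<close>)

lemma rotate_in_coneX:
  assumes "x \<in> coneX V" and "c ^ d = 1"
  shows "x(Suc n := c * x (Suc n)) \<in> coneX V"
proof -
  obtain y t where y: "y \<in> coneP V" "t ^ d = f y" "x = y(Suc n := t)"
    by (rule coneX_lift[OF assms(1)]) (rule that)
  then show ?thesis
    using lift_in_coneX[OF y(1), of "c * t"] assms(2) by (simp add: power_mult_distrib)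
qed

lemma open_preim: "openP V \<Longrightarrow> openX (preim V)"
  using is_morphism_cover_map[of n d k f] openin_continuous_map_preimage[of "pts_top X" "pts_top (proj_space n)" "cover_map n" V]
  by (simp add: is_morphism_def preim_def proj_space_def cyclic_cover_def open_in_wvariety)

lemma rat_on_pullback:
  assumes V: "openP V" and g: "g \<in> regP V"
  shows "ratX (preim V) 0 (\<lambda>x. g (orb wP (forget_t n x)))"
proof -
  have "(\<lambda>P\<in>preim V. g (cover_map n P)) \<in> regX (preim V)"
    using is_morphism_cover_map[of n d k f] V g
    by (simp add: is_morphism_def preim_def proj_space_def cyclic_cover_def open_in_wvariety reg_fun_wvariety)
  then have "ratX (preim V) 0 (\<lambda>x. (\<lambda>P\<in>preim V. g (cover_map n P)) (orb wX x))"
    using wregularD[OF open_preim[OF V]] by blast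
  then show ?thesis
    by (subst rat_on_cong[of wX KX _ _ "\<lambda>x. (\<lambda>P\<in>preim V. g (cover_map n P)) (orb wX x)"])
      (auto simp: cone_over_def cover_map_orb)
qed

text \<open>Restriction to a line reduces density of \<open>f \<noteq> 0\<close> to polynomials in one variable.\<close>

lemma form_zero_of_dense:
  assumes V: "openP V" and a: "a \<in> formsP e"
    and zero: "\<And>y. y \<in> coneP V \<Longrightarrow> f y \<noteq> 0 \<Longrightarrow> a y = 0"
    and x: "x \<in> coneP V"
  shows "a x = 0"
proof -
  obtain x1 where x1: "x1 \<in> cvecs (Suc n)" "f x1 \<noteq> 0" using f_nonzero by blast
  have x': "x \<in> KP" "orb wP x \<in> V" using x by (simp_all add: cone_over_def)
  obtain F e' where F: "F \<in> formsP e'" "F x \<noteq> 0" "\<And>y. y \<in> KP \<Longrightarrow> F y \<noteq> 0 \<Longrightarrow> orb wP y \<in> V"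
    by (rule wzariski_openE[OF V x']) (rule that)
  define l where "l = (\<lambda>z i. x i + z * (x1 i - x i))"
  have l01: "l 0 = x" "l 1 = x1" by (auto simp: l_def)
  have line: "\<exists>p. \<forall>z. F (l z) = poly p z" if "F \<in> formsP e" for F e
    unfolding l_def by (rule wforms_on_line[OF that])
  from line[OF a] obtain pa where pa: "\<forall>z. a (l z) = poly pa z" by (elim exE) (rule that)
  from line[OF f] obtain pf where pf: "\<forall>z. f (l z) = poly pf z" by (elim exE) (rule that)
  from line[OF F(1)] obtain pF where pF: "\<forall>z. F (l z) = poly pF z" by (elim exE) (rule that)
  \<comment> \<open>Multiplying by \<open>pf\<close> and \<open>pF\<close> discards the points of
    the line where the hypothesis says nothing.\<close>
  have "poly (pa * pf * pF) z = 0" for z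
  proof (cases "f (l z) = 0 \<or> F (l z) = 0")
    case True
    then show ?thesis by (auto simp: pf pF)
  next
    case False
    have cv: "l z \<in> cvecs (Suc n)" using x' x1(1) by (auto simp: l_def cvecs_def)
    \<comment> \<open>The line may run through the origin, which is not in the cone; but
      \<open>f\<close> vanishes there.\<close>
    have "\<exists>i\<le>n. l z i \<noteq> 0"
    proof (rule ccontr)
      assume "\<not> (\<exists>i\<le>n. l z i \<noteq> 0)"
      then have "l z i = 0" for i using cv by (cases "i \<le> n") (auto simp: cvecs_def)
      then have "l z = (\<lambda>_. 0)" by (rule ext)
      then show False using wforms_0[OF f] d k False by simp
    qed
    then have "l z \<in> KP" using cv by simp
    then have "a (l z) = 0" using F(3) False by (intro zero) (auto simp: cone_over_def)
    then show ?thesis by (simp add: pa)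
  qed
  then have "pa * pf * pF = 0" using poly_all_0_iff_0[of "pa * pf * pF"] by simp
  moreover have "pf \<noteq> 0" using x1(2) pf[rule_format, of 1] l01 by auto
  moreover have "pF \<noteq> 0" using F(2) pF[rule_format, of 0] l01 by auto
  ultimately have "pa = 0" by simp
  then show ?thesis using pa[rule_format, of 0] l01 by simp
qed

text \<open>The equation \<open>t ^ d = f\<close> reduces exponents of \<open>t\<close> modulo
  \<open>d\<close> at the cost of powers of \<open>f\<close>. When \<open>i * k > e\<close>,
  subtraction of naturals would truncate the degree to 0, so the coefficient is required to be zero
  there.\<close>

lemma tautological_expansion:
  assumes "H \<in> formsX e"
  shows "\<exists>h. (\<forall>i. h i \<in> formsP (e - i * k) \<and> (e < i * k \<longrightarrow> h i = (\<lambda>_. 0))) \<and>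
    (\<forall>x\<in>KX. H x = (\<Sum>i<d. x (Suc n) ^ i * h i (forget_t n x)))"
  using assms
proof (induction rule: wforms_induct)
  case zero
  show ?case by (intro exI[of _ "\<lambda>i x. 0"]) (simp add: wforms_zero)
next
  case (monom c a)
  define b where "b = a (Suc n)"
  have deg: "(\<Sum>i<Suc n. a i) + k * b = e"
    using monom by (simp add: b_def cov_wt_def)
  define M where "M = (\<lambda>y. c * f y ^ (b div d) * (\<Prod>i<Suc n. y i ^ a i))"
  have "k * b = k * (d * (b div d) + b mod d)" by simp
  also have "\<dots> = (b div d) * (d * k) + (b mod d) * k" by (simp only: distrib_left mult_ac)
  finally have deg': "(b div d) * (d * k) + (\<Sum>i<Suc n. a i) + (b mod d) * k = e"
    using deg by linarith
  have "(\<lambda>y. c * (f y ^ (b div d) * (1 * (\<Prod>i<Suc n. y i ^ a i)))) \<in> formsP ((b div d) * (d * k) + (\<Sum>i<Suc n. a i))"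
    by (intro wforms_cmult wforms_mult wforms_power[OF f] wforms_monom) simp
  then have M: "M \<in> formsP (e - (b mod d) * k)"
    unfolding M_def using deg' by (simp add: mult.assoc flip: deg')
  define h where "h = (\<lambda>i. if i = b mod d then M else (\<lambda>_. 0))"
  have "h i \<in> formsP (e - i * k) \<and> (e < i * k \<longrightarrow> h i = (\<lambda>_. 0))" for i
    using M deg' by (auto simp: h_def wforms_zero)
  moreover have "c * (\<Prod>i<Suc (Suc n). x i ^ a i) = (\<Sum>i<d. x (Suc n) ^ i * h i (forget_t n x))" if "x \<in> KX" for x
  proof -
    have "(\<Sum>i<d. x (Suc n) ^ i * h i (forget_t n x)) = (\<Sum>i<d. if i = b mod d then x (Suc n) ^ i * M (forget_t n x) else 0)"
      by (intro sum.cong) (auto simp: h_def)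
    also have "\<dots> = x (Suc n) ^ (b mod d) * M (forget_t n x)" using d by simp
    also have "M (forget_t n x) = c * (x (Suc n) ^ d) ^ (b div d) * (\<Prod>i<Suc n. x i ^ a i)"
      using that by (simp add: M_def forget_t_def)
    also have "x (Suc n) ^ (b mod d) * (c * (x (Suc n) ^ d) ^ (b div d) * (\<Prod>i<Suc n. x i ^ a i)) =
        c * (\<Prod>i<Suc n. x i ^ a i) * x (Suc n) ^ (d * (b div d) + b mod d)"
      by (simp only: power_add power_mult mult_ac)
    finally show ?thesis by (simp add: b_def mult.assoc)
  qed
  ultimately show ?case by (intro exI[of _ h]) simp
next
  case (add F G)
  then obtain h1 h2 where h1: "(\<forall>i. h1 i \<in> formsP (e - i * k) \<and> (e < i * k \<longrightarrow> h1 i = (\<lambda>_. 0))) \<and>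
      (\<forall>x\<in>KX. F x = (\<Sum>i<d. x (Suc n) ^ i * h1 i (forget_t n x)))"
    and h2: "(\<forall>i. h2 i \<in> formsP (e - i * k) \<and> (e < i * k \<longrightarrow> h2 i = (\<lambda>_. 0))) \<and>
      (\<forall>x\<in>KX. G x = (\<Sum>i<d. x (Suc n) ^ i * h2 i (forget_t n x)))"
    by (elim exE) (rule that)
  show ?case
    using h1 h2
    by (intro exI[of _ "\<lambda>i x. h1 i x + h2 i x"]) (simp add: wforms_add distrib_left sum.distrib)
qed

text \<open>Over a point with \<open>f \<noteq> 0\<close> all \<open>d\<close> sheets are distinct,
  so vanishing on them kills each coefficient of the expansion; the coefficients are forms on the
  base, where density is known.\<close>

lemma formX_zero_of_dense:
  assumes V: "openP V" and D: "D \<in> formsX e"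
    and zero: "\<And>x. x \<in> coneX V \<Longrightarrow> f (forget_t n x) \<noteq> 0 \<Longrightarrow> D x = 0"
    and x: "x \<in> coneX V"
  shows "D x = 0"
proof -
  from tautological_expansion[OF D] obtain h where h: "(\<forall>i. h i \<in> formsP (e - i * k) \<and> (e < i * k \<longrightarrow> h i = (\<lambda>_. 0))) \<and>
    (\<forall>x\<in>KX. D x = (\<Sum>i<d. x (Suc n) ^ i * h i (forget_t n x)))"
    by (elim exE) (rule that)
  have "h i y = 0" if i: "i < d" and y: "y \<in> coneP V" for i y
  proof (rule form_zero_of_dense[OF V _ _ y])
    show "h i \<in> formsP (e - i * k)" using h by blast
    fix z assume z: "z \<in> coneP V" "f z \<noteq> 0"
    then have z': "z \<in> KP" by (simp add: cone_over_def)
    show "h i z = 0"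
    proof (rule coefficients_zero_of_roots[OF d z(2) _ i])
      fix t assume t: "t ^ d = f z"
      have "D (z(Suc n := t)) = 0"
        using zero[OF lift_in_coneX[OF z(1) t]] lift_in(2)[OF z' t] z(2) by simp
      then show "(\<Sum>i<d. t ^ i * h i z) = 0"
        using h lift_in[OF z' t] by simp
    qed
  qed
  moreover obtain y t where "y \<in> coneP V" "forget_t n x = y"
    by (rule coneX_lift[OF x]) (rule that)
  moreover have "x \<in> KX" using x by (simp add: coneX_def)
  ultimately show ?thesis using h by simp
qed

lemma rat_on_zero_of_dense:
  assumes V: "openP V" and h: "ratX (preim V) \<delta> h"
    and zero: "\<And>x. x \<in> coneX V \<Longrightarrow> f (forget_t n x) \<noteq> 0 \<Longrightarrow> h x = 0"
    and x: "x \<in> coneX V"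
  shows "h x = 0"
proof -
  obtain e e' a b where 1: "a \<in> formsX e" "b \<in> formsX e'"
      "int e = int e' + \<delta>" "b x \<noteq> 0" "\<And>x. x \<in> cone_over wX KX (preim V) \<Longrightarrow> b x * h x = a x"
    by (rule rat_onE[OF h, unfolded cone_over_preim, OF x]) (rule that[unfolded cone_over_preim])
  have "a x = 0"
    by (rule formX_zero_of_dense[OF V 1(1) _ x]) (use 1(5) zero in \<open>force simp: cone_over_preim\<close>)
  then show ?thesis using 1(4) 1(5)[of x] x by (simp add: cone_over_preim)
qed

end

section \<open>Direct images of sections\<close>

lemma exists_nth_root:
  assumes "d > 0"
  shows "\<exists>t :: complex. t ^ d = c"
proof (cases "c = 0")
  case True
  then show ?thesis using assms by (intro exI[of _ 0]) simp
next
  case False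
  then have "{t. t ^ d = c} \<noteq> {}" using card_nth_roots[OF False assms] assms by force
  then show ?thesis by blast
qed

context cover
begin

abbreviation "rot c x \<equiv> x(Suc n := c * x (Suc n))"

text \<open>The factor \<open>t\<close> raises the exponents \<open>d - 1 - l\<close> occurring in
  \<open>\<Phi>\<close> to \<open>d - l\<close>, and summation over the roots then leaves only the
  term \<open>l = 0\<close>, which is \<open>d * f\<close> times the identity.\<close>

definition root_sum :: "(cvec \<Rightarrow> complex) \<Rightarrow> cvec \<Rightarrow> complex" where
  "root_sum h y = (\<Sum>t\<in>{t. t ^ d = f y}. t * h (y(Suc n := t)))"

lemma d_minus_1: "(d - 1) * k + k = d * k"
  using d by (cases d) auto

lemma rat_on_coneXE:
  assumes "ratX (preim V) (int \<delta>) h" and "x0 \<in> coneX V"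
  shows "\<exists>e a b. a \<in> formsX (e + \<delta>) \<and> b \<in> formsX e \<and>
    b x0 \<noteq> 0 \<and> (\<forall>x\<in>coneX V. b x * h x = a x)"
proof -
  obtain e e' a b where 1: "a \<in> formsX e" "b \<in> formsX e'"
      "int e = int e' + int \<delta>" "b x0 \<noteq> 0" "\<And>x. x \<in> cone_over wX KX (preim V) \<Longrightarrow> b x * h x = a x"
    by (rule rat_onE[OF assms(1), unfolded cone_over_preim, OF assms(2)]) (rule that[unfolded cone_over_preim])
  moreover have "e = e' + \<delta>" using 1(3) by linarith
  ultimately show ?thesis unfolding cone_over_preim by blast
qed

text \<open>
  Away from the branch locus, numerators and denominators over all sheets are multiplied
  together; comparing coefficients of powers of \<open>t\<close> gives a quotient of forms on the base.
\<close>

lemma root_sum_rational_unramified: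
  assumes h: "ratX (preim V) (int ((d - 1) * k)) h"
    and x0: "x0 \<in> coneP V" and fx0: "f x0 \<noteq> 0"
  shows "\<exists>G H e. G \<in> formsP e \<and> H \<in> formsP e \<and> H x0 \<noteq> 0 \<and>
    (\<forall>y\<in>coneP V. f y \<noteq> 0 \<longrightarrow> H y * root_sum h y = of_nat d * f y * G y)"
proof -
  let ?F = "formsX" and ?D = "(d - 1) * k"
  obtain q :: complex where q: "q ^ d = 1" "\<And>i. 0 < i \<Longrightarrow> i < d \<Longrightarrow> q ^ i \<noteq> 1"
    using exists_primitive_root_of_unity[OF d] by blast
  have qj: "(q ^ j) ^ d = 1" for j using q(1) by (metis mult.commute power_mult power_one)
  obtain t0 where t0: "t0 ^ d = f x0" using exists_nth_root[OF d] by blast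
  have P: "x0(Suc n := q ^ j * t0) \<in> coneX V" for j
    using t0 qj[of j] by (intro lift_in_coneX[OF x0]) (simp add: power_mult_distrib)
  \<comment> \<open>One quotient is chosen for each of the points above \<open>x0\<close>, with
    denominator nonzero at that point.\<close>
  have "\<forall>j. \<exists>e a b. a \<in> ?F (e + ?D) \<and> b \<in> ?F e \<and> b (x0(Suc n := q ^ j * t0)) \<noteq> 0 \<and> (\<forall>x\<in>coneX V. b x * h x = a x)"
    using rat_on_coneXE[OF h P] by (rule allI)
  then obtain e a b where ab: "\<forall>j. a j \<in> ?F (e j + ?D) \<and> b j \<in> ?F (e j) \<and> b j (x0(Suc n := q ^ j * t0)) \<noteq> 0 \<and>
      (\<forall>x\<in>coneX V. b j x * h x = a j x)"
    unfolding choice_iff by (elim exE) (rule that)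
  define B where "B = (\<lambda>x. \<Prod>l<d. b l (rot (q ^ l) x))"
  \<comment> \<open>The numerator of the sum over the sheets after all terms are brought to the
    common denominator \<open>B\<close>.\<close>
  define A where "A = (\<lambda>x. \<Sum>j<d. q ^ j * x (Suc n) * (a j (rot (q ^ j) x) * (\<Prod>l\<in>{..<d} - {j}. b l (rot (q ^ l) x))))"
  define E where "E = (\<Sum>l<d. e l)"
  have B: "B \<in> ?F E"
    unfolding B_def E_def using ab by (intro wforms_prod wforms_rotate) blast
  have A: "A \<in> ?F (E + d * k)"
    unfolding A_def
  proof (rule wforms_sum)
    fix j assume j: "j \<in> {..<d}"
    have T: "(\<lambda>x. q ^ j * x (Suc n)) \<in> ?F k"
      using wforms_coord[of "Suc n" "Suc (Suc n)" wX] by (intro wforms_cmult) (simp add: cov_wt_def)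
    have "(\<lambda>x. q ^ j * x (Suc n) * (a j (rot (q ^ j) x) * (\<Prod>l\<in>{..<d} - {j}. b l (rot (q ^ l) x))))
        \<in> ?F (k + ((e j + ?D) + (\<Sum>l\<in>{..<d} - {j}. e l)))"
      by (rule wforms_mult[OF T], rule wforms_mult, rule wforms_rotate, use ab in blast,
          rule wforms_prod, rule wforms_rotate, use ab in blast)
    moreover have "E = e j + (\<Sum>l\<in>{..<d} - {j}. e l)"
      unfolding E_def using j by (simp add: sum.remove)
    then have "k + ((e j + ?D) + (\<Sum>l\<in>{..<d} - {j}. e l)) = E + d * k"
      using d_minus_1 by linarith
    ultimately show "(\<lambda>x. q ^ j * x (Suc n) * (a j (rot (q ^ j) x) * (\<Prod>l\<in>{..<d} - {j}. b l (rot (q ^ l) x))))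
        \<in> ?F (E + d * k)"
      by (simp only:)
  qed
  have BA: "B x * (\<Sum>j<d. q ^ j * x (Suc n) * h (rot (q ^ j) x)) = A x" if x: "x \<in> coneX V" for x
    unfolding A_def sum_distrib_left
  proof (rule sum.cong)
    fix j assume j: "j \<in> {..<d}"
    have "B x = b j (rot (q ^ j) x) * (\<Prod>l\<in>{..<d} - {j}. b l (rot (q ^ l) x))"
      unfolding B_def using j by (simp add: prod.remove)
    moreover have "b j (rot (q ^ j) x) * h (rot (q ^ j) x) = a j (rot (q ^ j) x)"
      using ab rotate_in_coneX[OF x qj[of j]] by blast
    ultimately show "B x * (q ^ j * x (Suc n) * h (rot (q ^ j) x)) =
        q ^ j * x (Suc n) * (a j (rot (q ^ j) x) * (\<Prod>l\<in>{..<d} - {j}. b l (rot (q ^ l) x)))"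
      by (simp add: mult_ac flip: mult.assoc)
  qed simp
  from tautological_expansion[OF B] obtain B' where B': "(\<forall>i. B' i \<in> formsP (E - i * k) \<and> (E < i * k \<longrightarrow> B' i = (\<lambda>_. 0))) \<and>
    (\<forall>x\<in>KX. B x = (\<Sum>i<d. x (Suc n) ^ i * B' i (forget_t n x)))"
    by (elim exE) (rule that)
  from tautological_expansion[OF A] obtain A' where A': "(\<forall>i. A' i \<in> formsP (E + d * k - i * k) \<and> (E + d * k < i * k \<longrightarrow> A' i = (\<lambda>_. 0))) \<and>
    (\<forall>x\<in>KX. A x = (\<Sum>i<d. x (Suc n) ^ i * A' i (forget_t n x)))"
    by (elim exE) (rule that)
  have coeff: "B' i y * root_sum h y = A' i y" if i: "i < d" and y: "y \<in> coneP V" "f y \<noteq> 0" for i y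
  proof -
    have "B' i y * root_sum h y - A' i y = 0"
    proof (rule coefficients_zero_of_roots[OF d y(2) _ i])
      fix t assume t: "t ^ d = f y"
      have yK: "y \<in> KP" using y by (simp add: cone_over_def)
      note l = lift_in[OF yK t]
      have "root_sum h y = (\<Sum>j<d. q ^ j * t * h (y(Suc n := q ^ j * t)))"
        unfolding root_sum_def using bij_betw_roots[OF d y(2) t q] by (rule sum.reindex_bij_betw[symmetric])
      then have "B (y(Suc n := t)) * root_sum h y = A (y(Suc n := t))"
        using BA[OF lift_in_coneX[OF y(1) t]] by simp
      moreover have "B (y(Suc n := t)) = (\<Sum>i<d. t ^ i * B' i y)" "A (y(Suc n := t)) = (\<Sum>i<d. t ^ i * A' i y)"
        using B' A' l by simp_all
      ultimately show "(\<Sum>i<d. t ^ i * (B' i y * root_sum h y - A' i y)) = 0"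
        by (simp add: right_diff_distrib sum_subtractf sum_distrib_right mult.assoc)
    qed
    then show ?thesis by simp
  qed
  have x0K: "x0 \<in> KP" using x0 by (simp add: cone_over_def)
  have "B (x0(Suc n := t0)) \<noteq> 0" using ab by (simp add: B_def)
  then have "(\<Sum>i<d. t0 ^ i * B' i x0) \<noteq> 0" using B' lift_in[OF x0K t0] by simp
  then obtain i where i: "i < d" "B' i x0 \<noteq> 0"
    by (metis (no_types, lifting) lessThan_iff mult_zero_right sum.neutral)
  \<comment> \<open>A nonzero coefficient shows that the subtraction in its degree is not truncated,
    so that numerator and denominator have equal degrees.\<close>
  then have "\<not> E < i * k" using B' by auto
  then have deg: "d * k + (E - i * k) = E + d * k - i * k" by simp
  \<comment> \<open>The factor \<open>d * f\<close>, nonzero at \<open>x0\<close>, brings the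
    relation into the shape shared with the branch points.\<close>
  have "(\<lambda>y. of_nat d * (f y * B' i y)) \<in> formsP (E + d * k - i * k)"
    using B' wforms_cmult[OF wforms_mult[OF f, of "B' i"]] unfolding deg[symmetric] by blast
  moreover have "of_nat d * (f x0 * B' i x0) \<noteq> 0" using i(2) fx0 d by simp
  moreover have "of_nat d * (f y * B' i y) * root_sum h y = of_nat d * f y * A' i y"
    if "y \<in> coneP V" "f y \<noteq> 0" for y
    using coeff[OF i(1) that] by (simp add: mult.assoc)
  ultimately show ?thesis
    using A' by blast
qed

text \<open>At a branch point there is only one point above, so the norm of one denominator suffices.\<close>

lemma root_sum_rational_ramified:
  assumes h: "ratX (preim V) (int ((d - 1) * k)) h"
    and x0: "x0 \<in> coneP V" and fx0: "f x0 = 0"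
  shows "\<exists>G H e. G \<in> formsP e \<and> H \<in> formsP e \<and> H x0 \<noteq> 0 \<and>
    (\<forall>y\<in>coneP V. f y \<noteq> 0 \<longrightarrow> H y * root_sum h y = of_nat d * f y * G y)"
proof -
  let ?F = "formsX" and ?D = "(d - 1) * k"
  obtain q :: complex where q: "q ^ d = 1" "\<And>i. 0 < i \<Longrightarrow> i < d \<Longrightarrow> q ^ i \<noteq> 1"
    using exists_primitive_root_of_unity[OF d] by blast
  have t0: "0 ^ d = f x0" using fx0 d by simp
  from rat_on_coneXE[OF h lift_in_coneX[OF x0 t0]]
  obtain e a b where ab: "a \<in> ?F (e + ?D) \<and> b \<in> ?F e \<and> b (x0(Suc n := 0)) \<noteq> 0 \<and> (\<forall>x\<in>coneX V. b x * h x = a x)"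
    by (elim exE) (rule that)
  define B where "B = (\<lambda>x. \<Prod>l<d. b (rot (q ^ l) x))"
  \<comment> \<open>The factor of \<open>B\<close> for \<open>l = 0\<close> is \<open>b\<close>
    itself; with \<open>a\<close> in its place one gets \<open>A = B * h\<close> on the
    cone.\<close>
  define A where "A = (\<lambda>x. a x * (\<Prod>l\<in>{..<d} - {0}. b (rot (q ^ l) x)))"
  have B: "B \<in> ?F (d * e)"
  proof -
    have "B \<in> ?F (\<Sum>l<d. e)"
      unfolding B_def using ab by (intro wforms_prod wforms_rotate) blast
    then show ?thesis by simp
  qed
  have A: "A \<in> ?F (d * e + ?D)"
  proof -
    have "A \<in> ?F ((e + ?D) + (\<Sum>l\<in>{..<d} - {0}. e))"
      unfolding A_def by (rule wforms_mult, use ab in blast, rule wforms_prod, rule wforms_rotate, use ab in blast)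
    moreover have "(e + ?D) + (\<Sum>l\<in>{..<d} - {0}. e) = d * e + ?D"
      using d by (cases d) auto
    ultimately show ?thesis by (simp only:)
  qed
  have BA: "B x * h x = A x" if x: "x \<in> coneX V" for x
  proof -
    have "B x = b (rot (q ^ 0) x) * (\<Prod>l\<in>{..<d} - {0}. b (rot (q ^ l) x))"
      unfolding B_def using d by (intro prod.remove) auto
    moreover have "b x * h x = a x" using ab x by blast
    ultimately show ?thesis by (simp add: A_def mult_ac flip: mult.assoc)
  qed
  from tautological_expansion[OF B] obtain B' where B': "(\<forall>i. B' i \<in> formsP (d * e - i * k) \<and> (d * e < i * k \<longrightarrow> B' i = (\<lambda>_. 0))) \<and>
    (\<forall>x\<in>KX. B x = (\<Sum>i<d. x (Suc n) ^ i * B' i (forget_t n x)))"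
    by (elim exE) (rule that)
  from tautological_expansion[OF A] obtain A' where A': "(\<forall>i. A' i \<in> formsP (d * e + ?D - i * k) \<and> (d * e + ?D < i * k \<longrightarrow> A' i = (\<lambda>_. 0))) \<and>
    (\<forall>x\<in>KX. A x = (\<Sum>i<d. x (Suc n) ^ i * A' i (forget_t n x)))"
    by (elim exE) (rule that)
  have coeff: "B' 0 y * root_sum h y = of_nat d * f y * A' (d - 1) y" if y: "y \<in> coneP V" "f y \<noteq> 0" for y
  proof -
    define N where "N = (\<Prod>s\<in>{s. s ^ d = f y}. b (y(Suc n := s)))"
    have yK: "y \<in> KP" using y by (simp add: cone_over_def)
    have BN: "B (y(Suc n := t)) = N" if t: "t ^ d = f y" for t
    proof -
      have "N = (\<Prod>j<d. b (y(Suc n := q ^ j * t)))"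
        unfolding N_def using bij_betw_roots[OF d y(2) t q] by (rule prod.reindex_bij_betw[symmetric])
      then show ?thesis by (simp add: B_def)
    qed
    have "N * root_sum h y = (\<Sum>t\<in>{t. t ^ d = f y}. t * A (y(Suc n := t)))"
      unfolding root_sum_def sum_distrib_left
    proof (rule sum.cong)
      fix t assume "t \<in> {t. t ^ d = f y}"
      then have t: "t ^ d = f y" by simp
      show "N * (t * h (y(Suc n := t))) = t * A (y(Suc n := t))"
        using BA[OF lift_in_coneX[OF y(1) t]] unfolding BN[OF t] by (simp add: mult.left_commute)
    qed simp
    also have "\<dots> = (\<Sum>t\<in>{t. t ^ d = f y}. \<Sum>i<d. t ^ Suc i * A' i y)"
    proof (rule sum.cong)
      fix t assume "t \<in> {t. t ^ d = f y}"
      then have t: "t ^ d = f y" by simp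
      have "A (y(Suc n := t)) = (\<Sum>i<d. t ^ i * A' i y)" using A' lift_in[OF yK t] by simp
      then show "t * A (y(Suc n := t)) = (\<Sum>i<d. t ^ Suc i * A' i y)"
        by (simp add: sum_distrib_left mult.assoc)
    qed simp
    also have "\<dots> = (\<Sum>i<d. (\<Sum>t\<in>{t. t ^ d = f y}. t ^ Suc i) * A' i y)"
      unfolding sum_distrib_right by (rule sum.swap)
    \<comment> \<open>Among the exponents \<open>Suc i\<close> from 1 to \<open>d\<close> only
      \<open>d\<close> has a nonzero power sum. This produces the factor \<open>f\<close> that is
      divided out later.\<close>
    also have "\<dots> = (\<Sum>i<d. if i = d - 1 then of_nat d * f y * A' i y else 0)"
    proof (rule sum.cong)
      fix i assume "i \<in> {..<d}"
      then show "(\<Sum>t\<in>{t. t ^ d = f y}. t ^ Suc i) * A' i y = (if i = d - 1 then of_nat d * f y * A' i y else 0)"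
        by (subst power_sum_roots[OF d y(2)]) auto
    qed simp
    also have "\<dots> = of_nat d * f y * A' (d - 1) y" using d by simp
    finally have NS: "N * root_sum h y = of_nat d * f y * A' (d - 1) y" .
    \<comment> \<open>\<open>B\<close> has the same value \<open>N\<close> on all sheets, so
      comparison of coefficients at the \<open>d\<close> roots replaces \<open>N\<close> by the
      constant coefficient \<open>B' 0\<close>, a form on the base.\<close>
    define c where "c = (\<lambda>i. B' i y * root_sum h y - (if i = 0 then of_nat d * f y * A' (d - 1) y else 0))"
    have "c 0 = 0"
    proof (rule coefficients_zero_of_roots[where a = c, OF d y(2) _ d])
      fix t assume t: "t ^ d = f y"
      have "N = (\<Sum>i<d. t ^ i * B' i y)"
        using B' lift_in[OF yK t] BN[OF t] by simp
      then have "(\<Sum>i<d. t ^ i * B' i y) * root_sum h y = of_nat d * f y * A' (d - 1) y"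
        using NS by simp
      moreover have "(\<Sum>i<d. t ^ i * (if i = 0 then of_nat d * f y * A' (d - 1) y else 0)) =
          (\<Sum>i<d. if i = 0 then of_nat d * f y * A' (d - 1) y else 0)"
        by (intro sum.cong) auto
      ultimately show "(\<Sum>i<d. t ^ i * c i) = 0"
        using d by (simp add: c_def right_diff_distrib sum_subtractf sum_distrib_right mult.assoc)
    qed
    then show ?thesis by (simp add: c_def)
  qed
  have x0K: "x0 \<in> KP" using x0 by (simp add: cone_over_def)
  \<comment> \<open>At \<open>t = 0\<close> the expansion of \<open>B\<close> reduces to its
    constant coefficient, which is therefore a legitimate denominator at the branch point.\<close>
  have "B (x0(Suc n := 0)) \<noteq> 0" using ab by (simp add: B_def)
  moreover have "B (x0(Suc n := 0)) = (\<Sum>i<d. 0 ^ i * B' i x0)" using B' lift_in[OF x0K t0] by simp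
  moreover have "(\<Sum>i<d. 0 ^ i * B' i x0) = (\<Sum>i<d. if i = 0 then B' i x0 else 0)"
    by (intro sum.cong) (auto simp: zero_power)
  ultimately have "B' 0 x0 \<noteq> 0" using d by simp
  moreover have "B' 0 \<in> formsP (d * e)" using B' by (metis diff_zero mult_0)
  moreover have "A' (d - 1) \<in> formsP (d * e)" using A' by (metis diff_add_inverse2)
  ultimately show ?thesis
    using coeff by blast
qed

text \<open>The quotients \<open>G / H\<close> found at different points all equal
  \<open>root_sum h / (d * f)\<close> where \<open>f \<noteq> 0\<close>. By density their cross
  products agree on the whole cone over \<open>V\<close>, so they patch to one regular function,
  also across the branch locus.\<close>

lemma root_sum_regular:
  assumes V: "openP V"
    and h: "ratX (preim V) (int ((d - 1) * k)) h"
  shows "\<exists>g\<in>regP V. \<forall>y\<in>coneP V. f y \<noteq> 0 \<longrightarrow>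
    root_sum h y = of_nat d * f y * g (orb wP y)"
proof -
  let ?C = "coneP V"
  have "\<forall>x0. \<exists>G H e. x0 \<in> ?C \<longrightarrow> G \<in> formsP e \<and> H \<in> formsP e \<and> H x0 \<noteq> 0 \<and>
      (\<forall>y\<in>?C. f y \<noteq> 0 \<longrightarrow> H y * root_sum h y = of_nat d * f y * G y)"
    using root_sum_rational_unramified[OF h] root_sum_rational_ramified[OF h] by blast
  then obtain G H e where GH: "\<forall>x0. x0 \<in> ?C \<longrightarrow> G x0 \<in> formsP (e x0) \<and>
      H x0 \<in> formsP (e x0) \<and> H x0 x0 \<noteq> 0 \<and>
      (\<forall>y\<in>?C. f y \<noteq> 0 \<longrightarrow> H x0 y * root_sum h y = of_nat d * f y * G x0 y)"
    unfolding choice_iff by (elim exE) (rule that)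
  define r where "r = (\<lambda>y. G y y / H y y)"
  have eq: "H x y * r y = G x y" if x: "x \<in> ?C" and y: "y \<in> ?C" for x y
  proof -
    have "H x y * G y y - H y y * G x y = 0"
    proof (rule form_zero_of_dense[where a = "\<lambda>z. H x z * G y z - H y z * G x z", OF V _ _ y])
      have "(\<lambda>z. H x z * G y z + - (H y z * G x z)) \<in> formsP (e x + e y)"
      proof (rule wforms_add)
        show "(\<lambda>z. H x z * G y z) \<in> formsP (e x + e y)"
          using GH x y by (intro wforms_mult) blast+
        have "(\<lambda>z. H y z * G x z) \<in> formsP (e y + e x)"
          using GH x y by (intro wforms_mult) blast+
        then show "(\<lambda>z. - (H y z * G x z)) \<in> formsP (e x + e y)"
          unfolding add.commute[of "e x"] by (rule wforms_uminus)
      qed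
      then show "(\<lambda>z. H x z * G y z - H y z * G x z) \<in> formsP (e x + e y)" by simp
      fix z assume z: "z \<in> ?C" "f z \<noteq> 0"
      have 1: "H x z * root_sum h z = of_nat d * f z * G x z" "H y z * root_sum h z = of_nat d * f z * G y z"
        using GH x y z by blast+
      have "of_nat d * f z * (H x z * G y z - H y z * G x z) =
          H x z * (of_nat d * f z * G y z) - H y z * (of_nat d * f z * G x z)"
        by (simp add: algebra_simps)
      also have "\<dots> = 0" unfolding 1[symmetric] by (simp add: mult.left_commute)
      finally show "H x z * G y z - H y z * G x z = 0" using z(2) d by simp
    qed
    moreover have "H y y \<noteq> 0" using GH y by blast
    ultimately show ?thesis by (simp add: r_def field_simps)
  qed
  have r: "ratP V 0 r"
  proof (rule rat_onI)
    fix x0 assume "x0 \<in> ?C"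
    then show "\<exists>e e' a b. a \<in> formsP e \<and> b \<in> formsP e' \<and> int e = int e' + 0 \<and>
        b x0 \<noteq> 0 \<and> (\<forall>x\<in>?C. b x * r x = a x)"
      using GH eq by (intro exI[of _ "e x0"] exI[of _ "G x0"] exI[of _ "H x0"]) simp
  qed
  obtain g where g: "g \<in> regP V" "\<And>x. x \<in> ?C \<Longrightarrow> g (orb wP x) = r x"
    using rat_on_descend[OF V r] by blast
  have "root_sum h y = of_nat d * f y * g (orb wP y)" if y: "y \<in> ?C" "f y \<noteq> 0" for y
  proof -
    have 1: "H y y * root_sum h y = of_nat d * f y * G y y" "H y y \<noteq> 0" using GH y by blast+
    have "G y y = H y y * g (orb wP y)" unfolding g(2)[OF y(1)] r_def using 1(2) by simp
    with 1(1) have "H y y * root_sum h y = H y y * (of_nat d * f y * g (orb wP y))"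
      by (simp only: mult.left_commute)
    then show ?thesis using 1(2) by simp
  qed
  then show ?thesis using g(1) by blast
qed

end

section \<open>The Ulrich bundle\<close>

lemma wforms_has_partial_derivative:
  assumes "F \<in> wforms m w e"
  shows "((\<lambda>z. F (x(i := z))) has_field_derivative deriv (\<lambda>z. F (x(i := z))) z0) (at z0)"
proof -
  have "(\<lambda>j. (x(i := 0)) j + z * (if j = i then 1 else 0)) = x(i := z)" for z :: complex
    by auto
  with wforms_on_line[OF assms, of "x(i := 0)" "\<lambda>j. if j = i then 1 else 0"]
  obtain p where "\<forall>z. F (x(i := z)) = poly p z" by auto
  then have "(\<lambda>z. F (x(i := z))) = poly p" by auto
  then show ?thesis
    using poly_DERIV[of p z0] DERIV_imp_deriv by metis
qed

lemma rat_on_app: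
  assumes "\<And>x. F x \<in> carrier_mat a b" and "\<And>i j. i < a \<Longrightarrow> j < b \<Longrightarrow> (\<lambda>x. F x $$ (i, j)) \<in> wforms m w e"
    and "\<And>j. j < b \<Longrightarrow> rat_on m w K U \<delta> (\<lambda>x. v x j)" and "int e + \<delta> = int e'"
  shows "rat_on m w K U (int e') (\<lambda>x. app (F x) (v x) i)"
proof (cases "i < a")
  case True
  have "rat_on m w K U (int e') (\<lambda>x. \<Sum>j<b. F x $$ (i, j) * v x j)"
  proof (rule rat_on_sum)
    fix j assume "j \<in> {..<b}"
    then show "rat_on m w K U (int e') (\<lambda>x. F x $$ (i, j) * v x j)"
      unfolding assms(4)[symmetric] using assms(2)[OF True] assms(3) by (intro rat_on_mult rat_on_form) auto
  qed
  then show ?thesis using True carrier_matD[OF assms(1)] by (simp add: app_def)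
next
  case False
  then show ?thesis using carrier_matD[OF assms(1)] rat_on_zero[of m w K U e'] by (simp add: app_def)
qed

text \<open>Sections of free sheaves take the value \<open>undefined\<close> beyond the rank; here they are extended by zero.\<close>

definition zvec :: "nat \<Rightarrow> (nat \<Rightarrow> 'p \<Rightarrow> complex) \<Rightarrow> 'p \<Rightarrow> cvec" where
  "zvec r u P = (\<lambda>j. if j < r then u j P else 0)"

lemma zvec_in: "zvec r u P \<in> cvecs r"
  by (simp add: zvec_def cvecs_def)

lemma zvec_add: "P \<in> U \<Longrightarrow> zvec r (\<lambda>i\<in>{..<r}. \<lambda>P\<in>U. u i P + v i P) P = (\<lambda>j. zvec r u P j + zvec r v P j)"
  by (auto simp: zvec_def)

lemma zvec_smult: "P \<in> U \<Longrightarrow> zvec r (\<lambda>i\<in>{..<r}. \<lambda>P\<in>U. g P * u i P) P = (\<lambda>j. g P * zvec r u P j)"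
  by (auto simp: zvec_def)

lemma zvec_restrict: "P \<in> V \<Longrightarrow> zvec r (\<lambda>i\<in>{..<r}. restrict (u i) V) P = zvec r u P"
  by (auto simp: zvec_def)

locale cover_root = cover +
  fixes N :: nat and A :: "cvec \<Rightarrow> complex mat" and \<gamma> :: "nat \<Rightarrow> nat"
  assumes N: "N > 0" and A_carrier: "A y \<in> carrier_mat N N" and A_pow: "A y ^\<^sub>m d = f y \<cdot>\<^sub>m 1\<^sub>m N"
    and A_graded: "graded d \<gamma> (A y)"
    and A_form: "i < N \<Longrightarrow> j < N \<Longrightarrow> (\<lambda>y. A y $$ (i, j)) \<in> wforms (Suc n) (\<lambda>_. 1) k"
    and smooth: "smooth_hypersurface n f"
begin

lemma A_pow_form:
  "i < N \<Longrightarrow> j < N \<Longrightarrow> (\<lambda>y. (A y ^\<^sub>m l) $$ (i, j)) \<in> formsP (l * k)"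
proof (induction l arbitrary: j)
  case 0
  then have "(\<lambda>y. (A y ^\<^sub>m 0) $$ (i, j)) = (\<lambda>y. if i = j then 1 else 0)"
    using carrier_matD[OF A_carrier] by auto
  then show ?case using wforms_const by simp
next
  case (Suc l)
  have "(A y ^\<^sub>m Suc l) $$ (i, j) = (\<Sum>a<N. (A y ^\<^sub>m l) $$ (i, a) * A y $$ (a, j))" for y
    unfolding pow_mat.simps by (rule index_mat_mult[OF pow_carrier_mat[OF A_carrier] A_carrier Suc.prems])
  moreover have "(\<lambda>y. \<Sum>a<N. (A y ^\<^sub>m l) $$ (i, a) * A y $$ (a, j)) \<in> formsP (l * k + k)"
    using Suc A_form by (intro wforms_sum wforms_mult) auto
  ultimately show ?case by (simp add: add.commute del: pow_mat.simps)
qed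

definition Phi :: "cvec \<Rightarrow> complex mat" where
  "Phi x = phi d (A (forget_t n x)) (x (Suc n))"

lemma Phi_carrier: "Phi x \<in> carrier_mat N N"
  unfolding Phi_def by (rule phi_carrier[OF A_carrier])

lemma Phi_form:
  assumes "i < N" and "j < N"
  shows "(\<lambda>x. Phi x $$ (i, j)) \<in> formsX ((d - 1) * k)"
proof -
  have "(\<lambda>x. \<Sum>l<d. x (Suc n) ^ (d - Suc l) * (A (forget_t n x) ^\<^sub>m l) $$ (i, j)) \<in> formsX ((d - 1) * k)"
  proof (rule wforms_sum)
    fix l assume l: "l \<in> {..<d}"
    have "(\<lambda>x. x (Suc n)) \<in> formsX k"
      using wforms_coord[of "Suc n" "Suc (Suc n)" wX] by (simp add: cov_wt_def)
    then have "(\<lambda>x. x (Suc n) ^ (d - Suc l) * (A (forget_t n x) ^\<^sub>m l) $$ (i, j))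
        \<in> formsX ((d - Suc l) * k + l * k)"
      by (intro wforms_mult wforms_power wforms_pullback[OF A_pow_form[OF assms]])
    moreover have "(d - Suc l) * k + l * k = (d - 1) * k"
      using l unfolding add_mult_distrib[symmetric] by simp
    ultimately show "(\<lambda>x. x (Suc n) ^ (d - Suc l) * (A (forget_t n x) ^\<^sub>m l) $$ (i, j))
        \<in> formsX ((d - 1) * k)"
      by (simp only:)
  qed
  then show ?thesis
    using assms carrier_matD[OF A_carrier] by (simp add: Phi_def phi_def)
qed

definition eigenspace :: "cvec \<Rightarrow> cvec set" where
  "eigenspace x = {v \<in> cvecs N. app (A (forget_t n x)) v = (\<lambda>i. x (Suc n) * v i)}"

abbreviation "sectionsE \<equiv> sections (Suc (Suc n)) wX KX ((d - 1) * k) eigenspace"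
abbreviation "\<E> \<equiv> section_sheaf (Suc (Suc n)) wX KX ((d - 1) * k) eigenspace"

lemma lin_sub_eigenspace: "lin_sub (eigenspace x)"
  unfolding lin_sub_def eigenspace_def
  by (auto simp: cvecs_def app_0 app_add app_cmult distrib_left mult.left_commute)

lemma A_forget_pow: "x \<in> KX \<Longrightarrow> A (forget_t n x) ^\<^sub>m d = x (Suc n) ^ d \<cdot>\<^sub>m 1\<^sub>m N"
  unfolding A_pow by simp

lemma app_Phi_in_eigenspace: "x \<in> KX \<Longrightarrow> v \<in> cvecs N \<Longrightarrow> app (Phi x) v \<in> eigenspace x"
  using app_app_phi[OF A_carrier A_forget_pow] app_in_cvecs[of "Phi x" N v] Phi_carrier[of x]
  by (simp add: eigenspace_def Phi_def)

text \<open>Smoothness supplies a coordinate direction in which \<open>f\<close> has nonzero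
  derivative. \<open>B\<close> is the derivative of \<open>A\<close> in this direction and
  \<open>e\<close> that of \<open>f\<close>.\<close>

lemma derivative_at_branch_point:
  assumes "x \<in> KP" and "f x = 0"
  shows "\<exists>B e. B \<in> carrier_mat N N \<and> e \<noteq> 0 \<and> pow_deriv (A x) B d = e \<cdot>\<^sub>m 1\<^sub>m N"
proof -
  obtain i where i: "i \<le> n" "partial_deriv i f x \<noteq> 0"
    using smooth assms unfolding smooth_hypersurface_def by auto
  define B where "B = mat N N (\<lambda>(a, b). deriv (\<lambda>z. A (x(i := z)) $$ (a, b)) (x i))"
  have B: "B \<in> carrier_mat N N" by (simp add: B_def)
  have "pow_deriv (A x) B d = partial_deriv i f x \<cdot>\<^sub>m 1\<^sub>m N"
  proof (rule eq_matI)
    fix a b assume "a < dim_row (partial_deriv i f x \<cdot>\<^sub>m 1\<^sub>m N)" "b < dim_col (partial_deriv i f x \<cdot>\<^sub>m 1\<^sub>m N)"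
    then have ab: "a < N" "b < N" by auto
    have "((\<lambda>z. (A (x(i := z)) ^\<^sub>m d) $$ (a, b)) has_field_derivative pow_deriv (A (x(i := x i))) B d $$ (a, b)) (at (x i))"
      using wforms_has_partial_derivative[OF A_form]
      by (intro has_field_derivative_pow_mat[OF A_carrier B _ ab]) (simp add: B_def)
    moreover have "(A (x(i := z)) ^\<^sub>m d) $$ (a, b) = f (x(i := z)) * 1\<^sub>m N $$ (a, b)" for z
      unfolding A_pow using ab by simp
    moreover have "((\<lambda>z. f (x(i := z)) * 1\<^sub>m N $$ (a, b)) has_field_derivative partial_deriv i f x * 1\<^sub>m N $$ (a, b)) (at (x i))"
      unfolding partial_deriv_def by (rule DERIV_cmult_right) (rule wforms_has_partial_derivative[OF f])
    ultimately have "pow_deriv (A x) B d $$ (a, b) = partial_deriv i f x * 1\<^sub>m N $$ (a, b)"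
      by (simp add: DERIV_unique)
    then show "pow_deriv (A x) B d $$ (a, b) = (partial_deriv i f x \<cdot>\<^sub>m 1\<^sub>m N) $$ (a, b)"
      using ab by simp
  qed (use carrier_matD[OF pow_deriv_carrier[OF A_carrier B]] in auto)
  then show ?thesis using B i(2) by blast
qed

lemma exists_Phi_projector:
  assumes "x \<in> KX"
  shows "\<exists>Q. Q \<in> carrier_mat N N \<and> eigen_projector N d (A (forget_t n x)) (x (Suc n)) (Phi x * Q)"
  unfolding Phi_def
proof (rule exists_eigen_projector[OF A_carrier A_forget_pow[OF assms] d A_graded])
  show "x (Suc n) \<noteq> 0 \<or> (\<exists>B e. B \<in> carrier_mat N N \<and> e \<noteq> 0 \<and> pow_deriv (A (forget_t n x)) B d = e \<cdot>\<^sub>m 1\<^sub>m N)"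
  proof (cases "x (Suc n) = 0")
    case True
    then have "f (forget_t n x) = 0" using assms d by (auto simp: zero_power)
    then show ?thesis using derivative_at_branch_point[OF forget_in[OF assms]] by blast
  qed simp
qed

text \<open>The columns of \<open>Phi x * C\<close> are a basis of the eigenspace at
  \<open>x\<close>, and \<open>W\<close> reads off coordinates. Both \<open>C\<close> and
  \<open>W\<close> are constant matrices: keeping them while \<open>x\<close> varies gives a frame
  on the open set where the form \<open>det (W * (Phi x * C))\<close> is nonzero.\<close>

lemma exists_rank_factorization:
  assumes "x \<in> KX"
  shows "\<exists>r C W. r * d = N \<and> C \<in> carrier_mat N r \<and> W \<in> carrier_mat r N \<and> W * (Phi x * C) = 1\<^sub>m r"
proof -
  obtain Q where Q: "Q \<in> carrier_mat N N" "eigen_projector N d (A (forget_t n x)) (x (Suc n)) (Phi x * Q)"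
    using exists_Phi_projector[OF assms] by blast
  have P: "Phi x * Q \<in> carrier_mat N N" "(Phi x * Q) * (Phi x * Q) = Phi x * Q"
    "trace_mat (Phi x * Q) * of_nat d = of_nat N"
    using Q(2) by (auto simp: eigen_projector_def)
  obtain r V W where VW: "V \<in> carrier_mat N r" "W \<in> carrier_mat r N" "Phi x * Q = V * W" "W * V = 1\<^sub>m r"
    "trace_mat (Phi x * Q) = of_nat r"
    by (rule idempotent_mat_factorization[OF P(1,2)]) (rule that)
  have "of_nat (r * d) = (of_nat N :: complex)" using P(3) VW(5) by simp
  then have rd: "r * d = N" by (simp only: of_nat_eq_iff)
  have C: "Q * V \<in> carrier_mat N r" by (rule mult_carrier_mat[OF Q(1) VW(1)])
  have "Phi x * (Q * V) = (Phi x * Q) * V"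
    by (rule assoc_mult_mat[OF Phi_carrier Q(1) VW(1), symmetric])
  also have "\<dots> = V * (W * V)"
    unfolding VW(3) by (rule assoc_mult_mat[OF VW(1,2,1)])
  also have "\<dots> = V" unfolding VW(4) by (rule right_mult_one_mat[OF VW(1)])
  finally have "W * (Phi x * (Q * V)) = 1\<^sub>m r" using VW(4) by simp
  then show ?thesis using rd C VW(2) by blast
qed

lemma sections_\<E>D:
  assumes "s \<in> sectionsE U"
  shows "s \<in> extensional (cone_over wX KX U)" and "\<And>x. x \<in> cone_over wX KX U \<Longrightarrow> s x \<in> eigenspace x"
    and "\<And>i. ratX U (int ((d - 1) * k)) (\<lambda>x. s x i)"
  using assms by (simp_all add: sections_def)

section \<open>Local frames of the eigenspace sheaf\<close>

definition frame_map :: "nat \<Rightarrow> complex mat \<Rightarrow> cvec set set \<Rightarrow> (nat \<Rightarrow> cvec set \<Rightarrow> complex) \<Rightarrow> cvec \<Rightarrow> cvec" where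
  "frame_map r C U u = (\<lambda>x\<in>cone_over wX KX U. app (Phi x * C) (zvec r u (orb wX x)))"

text \<open>Cramer's rule computes the coordinates of a section with denominator
  \<open>det (M x)\<close>. Injectivity only uses the left inverse \<open>\<Psi>\<close>;
  surjectivity is the right inverse from \<open>frame_inverse\<close>, where the rank of the
  projector enters.\<close>

lemma frame_map_bij:
  assumes rd: "r * d = N" and C: "C \<in> carrier_mat N r" and W: "W \<in> carrier_mat r N"
    and U: "openX U"
    and det: "\<And>x. x \<in> cone_over wX KX U \<Longrightarrow> det (W * (Phi x * C)) \<noteq> 0"
  shows "bij_betw (frame_map r C U) ({..<r} \<rightarrow>\<^sub>E regX U)
    (sectionsE U)"
proof -
  let ?C = "cone_over wX KX U" and ?R = "regX U" and ?D = "(d - 1) * k"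
  let ?S = "sectionsE U"
  let ?rat = "ratX U"
  define F where "F = (\<lambda>x. Phi x * C)"
  define M where "M = (\<lambda>x. W * F x)"
  define \<Psi> where "\<Psi> = (\<lambda>x. adj_mat (M x) * W)"
  have F: "F x \<in> carrier_mat N r" for x unfolding F_def by (rule mult_carrier_mat[OF Phi_carrier C])
  have M: "M x \<in> carrier_mat r r" for x unfolding M_def by (rule mult_carrier_mat[OF W F])
  note adj = adj_mat[OF M]
  have \<Psi>: "\<Psi> x \<in> carrier_mat r N" for x unfolding \<Psi>_def by (rule mult_carrier_mat[OF adj(1) W])
  have F_form: "(\<lambda>x. F x $$ (i, j)) \<in> formsX ?D" if "i < N" "j < r" for i j
  proof -
    have "(\<lambda>x. \<Sum>l<N. C $$ (l, j) * Phi x $$ (i, l)) \<in> formsX ?D"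
      using Phi_form[OF that(1)] by (intro wforms_sum wforms_cmult) auto
    then show ?thesis unfolding F_def index_mat_mult[OF Phi_carrier C that] by (simp add: mult.commute)
  qed
  have M_form: "(\<lambda>x. M x $$ (i, j)) \<in> formsX ?D" if "i < r" "j < r" for i j
    unfolding M_def index_mat_mult[OF W F that] using F_form that by (intro wforms_sum wforms_cmult) auto
  have \<Psi>_form: "(\<lambda>x. \<Psi> x $$ (i, j)) \<in> formsX ((r - 1) * ?D)" if "i < r" "j < N" for i j
  proof -
    have "(\<lambda>x. \<Sum>l<r. W $$ (l, j) * adj_mat (M x) $$ (i, l)) \<in> formsX ((r - 1) * ?D)"
      using wforms_adj_mat[OF M M_form that(1)] by (intro wforms_sum wforms_cmult) auto
    then show ?thesis unfolding \<Psi>_def index_mat_mult[OF adj(1) W that] by (simp add: mult.commute)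
  qed
  have det_form: "(\<lambda>x. det (M x)) \<in> formsX (r * ?D)"
    using M M_form by (rule wforms_det)
  have det': "det (M x) \<noteq> 0" if "x \<in> ?C" for x
    using det[OF that] by (simp add: M_def F_def)
  have CK: "x \<in> KX" "orb wX x \<in> U" if "x \<in> ?C" for x using that by (simp_all add: cone_over_def)
  have Fv: "app (F x) v \<in> eigenspace x" if "x \<in> KX" for x v
    unfolding F_def app_mult[OF Phi_carrier C]
    using that C by (intro app_Phi_in_eigenspace app_in_cvecs) auto
  have \<Psi>F: "app (\<Psi> x) (app (F x) v) = (\<lambda>i. det (M x) * v i)" if "v \<in> cvecs r" for x v
  proof -
    have "app (\<Psi> x) (app (F x) v) = app (adj_mat (M x)) (app W (app (F x) v))"
      unfolding \<Psi>_def by (rule app_mult[OF adj(1) W])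
    also have "app W (app (F x) v) = app (M x) v"
      unfolding M_def by (rule app_mult[OF W F, symmetric])
    also have "app (adj_mat (M x)) (app (M x) v) = app (adj_mat (M x) * M x) v"
      by (rule app_mult[OF adj(1) M, symmetric])
    finally show ?thesis unfolding adj(3) app_smult_one[OF that] .
  qed
  have F\<Psi>: "app (F x) (app (\<Psi> x) v) = (\<lambda>i. det (M x) * v i)" if x: "x \<in> ?C" and v: "v \<in> eigenspace x" for x v
  proof -
    obtain Q where Q: "Q \<in> carrier_mat N N" "eigen_projector N d (A (forget_t n x)) (x (Suc n)) (Phi x * Q)"
      using exists_Phi_projector[OF CK(1)[OF x]] by blast
    have P: "Phi x * Q \<in> carrier_mat N N" using Q(2) by (simp add: eigen_projector_def)
    \<comment> \<open>The columns of \<open>F x\<close> are eigenvectors, and these are fixed by the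
      projector.\<close>
    have "(Phi x * Q) * F x = F x"
    proof (rule mat_eq_app[OF mult_carrier_mat[OF P F] F])
      fix u :: cvec
      show "app ((Phi x * Q) * F x) u = app (F x) u"
        unfolding app_mult[OF P F] using Q(2) Fv[OF CK(1)[OF x], of u]
        by (simp add: eigen_projector_def eigenspace_def)
    qed
    from frame_inverse[OF Q(2) d rd F this W] show ?thesis
      using det'[OF x] v by (simp add: eigenspace_def M_def \<Psi>_def)
  qed
  have map: "frame_map r C U u \<in> ?S" if u: "u \<in> {..<r} \<rightarrow>\<^sub>E ?R" for u
  proof (rule sectionsI[where s' = "\<lambda>x. app (F x) (zvec r u (orb wX x))"])
    show "app (F x) (zvec r u (orb wX x)) \<in> eigenspace x" if "x \<in> ?C" for x
      using Fv CK(1)[OF that] by blast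
    show "?rat (int ?D) (\<lambda>x. app (F x) (zvec r u (orb wX x)) i)" for i
    proof (rule rat_on_app[OF F F_form])
      show "?rat 0 (\<lambda>x. zvec r u (orb wX x) j)" if "j < r" for j
        using wregularD[OF U, of "u j"] u that by (simp add: zvec_def PiE_iff)
    qed simp_all
  qed (auto simp: frame_map_def F_def)
  have inj: "inj_on (frame_map r C U) ({..<r} \<rightarrow>\<^sub>E ?R)"
  proof (rule inj_onI)
    fix u v assume u: "u \<in> {..<r} \<rightarrow>\<^sub>E ?R" and v: "v \<in> {..<r} \<rightarrow>\<^sub>E ?R" and eq: "frame_map r C U u = frame_map r C U v"
    have uv: "zvec r u (orb wX x) = zvec r v (orb wX x)" if x: "x \<in> ?C" for x
    proof -
      have "app (F x) (zvec r u (orb wX x)) = app (F x) (zvec r v (orb wX x))"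
        using fun_cong[OF eq, of x] x by (simp add: frame_map_def F_def)
      from arg_cong[OF this, of "app (\<Psi> x)"]
      have "(\<lambda>i. det (M x) * zvec r u (orb wX x) i) = (\<lambda>i. det (M x) * zvec r v (orb wX x) i)"
        unfolding \<Psi>F[OF zvec_in] .
      then show ?thesis using det'[OF x] by (simp add: fun_eq_iff)
    qed
    show "u = v"
    proof (rule PiE_ext[OF u v])
      fix j assume j: "j \<in> {..<r}"
      then have "u j \<in> extensional U" "v j \<in> extensional U" using u v by (auto simp: PiE_iff wregular_def)
      then show "u j = v j"
      proof (rule extensionalityI)
        fix P assume "P \<in> U"
        then obtain x where "x \<in> ?C" "P = orb wX x" using wzariski_open_subset[OF U] by (auto simp: cone_over_def)
        then show "u j P = v j P" using fun_cong[OF uv, of x j] j by (simp add: zvec_def)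
      qed
    qed
  qed
  have surj: "s \<in> frame_map r C U ` ({..<r} \<rightarrow>\<^sub>E ?R)" if s: "s \<in> ?S" for s
  proof -
    note s' = sections_\<E>D[OF s]
    have r: "r > 0" using rd N by (cases r) auto
    define h where "h = (\<lambda>j x. 1 / det (M x) * app (\<Psi> x) (s x) j)"
    have h: "?rat 0 (h j)" for j
    proof -
      \<comment> \<open>The degree of the adjugate plus that of the section is the degree of the
        determinant, so the coordinates have degree 0 and descend to regular functions.\<close>
      have "(r - 1) * z + z = r * z" for z :: nat using r by (cases r) auto
      then have "int ((r - 1) * ?D) + int ?D = int (r * ?D)" unfolding of_nat_add[symmetric] by simp
      then have "?rat (int (r * ?D)) (\<lambda>x. app (\<Psi> x) (s x) j)"
        using s'(3) by (intro rat_on_app[OF \<Psi> \<Psi>_form])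
      from rat_on_mult[OF rat_on_inverse_form[OF det_form det'] this] show ?thesis
        by (simp add: h_def)
    qed
    have "\<forall>j. \<exists>g. g \<in> ?R \<and> (\<forall>x\<in>?C. g (orb wX x) = h j x)"
      using rat_on_descend[OF U h] by blast
    then obtain g where g: "\<forall>j. g j \<in> ?R \<and> (\<forall>x\<in>?C. g j (orb wX x) = h j x)"
      unfolding choice_iff by (elim exE) (rule that)
    define u where "u = (\<lambda>j\<in>{..<r}. g j)"
    have u: "u \<in> {..<r} \<rightarrow>\<^sub>E ?R" using g by (simp add: u_def)
    have "frame_map r C U u = s"
    proof (rule extensionalityI[OF _ s'(1)])
      show "frame_map r C U u \<in> extensional ?C" by (simp add: frame_map_def)
      fix x assume x: "x \<in> ?C"
      have "app (\<Psi> x) (s x) \<in> cvecs r" using \<Psi>[of x] by (intro app_in_cvecs) auto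
      then have "zvec r u (orb wX x) = (\<lambda>j. 1 / det (M x) * app (\<Psi> x) (s x) j)"
        using g x by (auto simp: zvec_def u_def h_def cvecs_def fun_eq_iff)
      then have "app (F x) (zvec r u (orb wX x)) = (\<lambda>i. 1 / det (M x) * (det (M x) * s x i))"
        by (simp only: app_cmult F\<Psi>[OF x s'(2)[OF x]])
      then show "frame_map r C U u x = s x"
        using x det'[OF x] by (simp add: frame_map_def F_def)
    qed
    then show ?thesis using u by blast
  qed
  show ?thesis
    unfolding bij_betw_def using inj map surj by blast
qed

lemma open_in_X: "open_in X U \<longleftrightarrow> openX U"
  by (simp add: cyclic_cover_def open_in_wvariety)

lemma vector_bundle_\<E>:
  assumes rd: "r * d = N"
  shows "vector_bundle X r \<E>"
  unfolding vector_bundle_def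
proof (intro conjI ballI)
  show "mod_sheaf X \<E>"
    unfolding cyclic_cover_def by (rule mod_sheaf_section_sheaf) (rule lin_sub_eigenspace)
  fix P assume "P \<in> pts X"
  then obtain x where x: "x \<in> KX" "P = orb wX x" by (auto simp: cyclic_cover_def pts_wvariety)
  from exists_rank_factorization[OF x(1)] obtain r' C W where 1: "r' * d = N \<and> C \<in> carrier_mat N r' \<and> W \<in> carrier_mat r' N \<and>
      W * (Phi x * C) = 1\<^sub>m r'"
    by (elim exE) (rule that)
  \<comment> \<open>The equation \<open>r' * d = N\<close> does not depend on the point, hence
    neither does the rank.\<close>
  then have "r' = r" using rd d by auto
  then have C: "C \<in> carrier_mat N r" and W: "W \<in> carrier_mat r N" and one: "W * (Phi x * C) = 1\<^sub>m r" using 1 by auto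
  have F: "Phi x * C \<in> carrier_mat N r" for x by (rule mult_carrier_mat[OF Phi_carrier C])
  define \<Delta> where "\<Delta> = (\<lambda>x. det (W * (Phi x * C)))"
  have \<Delta>: "\<Delta> \<in> formsX (r * ((d - 1) * k))"
    unfolding \<Delta>_def
  proof (rule wforms_det)
    show "W * (Phi x * C) \<in> carrier_mat r r" for x by (rule mult_carrier_mat[OF W F])
    fix i j assume ij: "i < r" "j < r"
    have "(\<lambda>x. \<Sum>a<N. W $$ (i, a) * (\<Sum>l<N. C $$ (l, j) * Phi x $$ (a, l))) \<in> formsX ((d - 1) * k)"
      using Phi_form by (intro wforms_sum wforms_cmult) auto
    moreover have "(W * (Phi x * C)) $$ (i, j) = (\<Sum>a<N. W $$ (i, a) * (\<Sum>l<N. C $$ (l, j) * Phi x $$ (a, l)))" for x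
      unfolding index_mat_mult[OF W F ij]
      by (intro sum.cong refl) (simp add: index_mat_mult[OF Phi_carrier C _ ij(2)] mult.commute)
    ultimately show "(\<lambda>x. (W * (Phi x * C)) $$ (i, j)) \<in> formsX ((d - 1) * k)"
      by (simp only:)
  qed
  define B where "B = orb wX ` {x \<in> KX. \<Delta> x \<noteq> 0}"
  have B: "open_in X B"
    unfolding open_in_X B_def by (rule wzariski_open_nonzero[OF \<Delta>])
  have "P \<in> B" using x one by (auto simp: B_def \<Delta>_def)
  have det: "det (W * (Phi x * C)) \<noteq> 0" if "x \<in> cone_over wX KX U" "U \<subseteq> B" for x U
    using that orb_in_nonzero_iff[OF \<Delta>, of x KX] by (auto simp: cone_over_def B_def \<Delta>_def)
  have "sheaf_iso_map (open_subspace X B) (free_sheaf (open_subspace X B) r) \<E> (frame_map r C)"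
    unfolding sheaf_iso_map_def open_in_open_subspace[OF B]
  proof (intro allI impI conjI ballI; (elim conjE)?)
    fix U assume U: "open_in X U" "U \<subseteq> B"
    have "bij_betw (frame_map r C U) ({..<r} \<rightarrow>\<^sub>E regX U)
        (sectionsE U)"
      using U(1) det[OF _ U(2)] by (intro frame_map_bij[OF rd C W]) (auto simp: open_in_X)
    then show "bij_betw (frame_map r C U) (carrier (sect (free_sheaf (open_subspace X B) r) U)) (carrier (sect \<E> U))"
      by (simp add: free_sheaf_def section_sheaf_def reg_fun_open_subspace cyclic_cover_def reg_fun_wvariety)
    fix s
    show "frame_map r C U (s \<oplus>\<^bsub>sect (free_sheaf (open_subspace X B) r) U\<^esub> t) =
        frame_map r C U s \<oplus>\<^bsub>sect \<E> U\<^esub> frame_map r C U t" for t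
      by (auto simp: free_sheaf_def section_sheaf_def frame_map_def zvec_add app_add cone_over_def intro!: extensional_restrict_cong)
    show "frame_map r C U (g \<odot>\<^bsub>sect (free_sheaf (open_subspace X B) r) U\<^esub> s) = g \<odot>\<^bsub>sect \<E> U\<^esub> frame_map r C U s" for g
      by (auto simp: free_sheaf_def section_sheaf_def frame_map_def zvec_smult app_cmult cone_over_def intro!: extensional_restrict_cong)
    fix V assume V: "open_in X V" "V \<subseteq> U"
    then have 1: "cone_over wX KX U \<inter> cone_over wX KX V = cone_over wX KX V"
      by (auto simp: cone_over_def)
    have 2: "zvec r (\<lambda>i\<in>{..<r}. restrict (s i) V) (orb wX x) = zvec r s (orb wX x)" if "x \<in> cone_over wX KX V" for x
      by (rule zvec_restrict) (use that in \<open>simp add: cone_over_def\<close>)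
    show "frame_map r C V (rstr (free_sheaf (open_subspace X B) r) U V s) = rstr \<E> U V (frame_map r C U s)"
      by (simp add: free_sheaf_def section_sheaf_def frame_map_def 1)
        (rule extensional_restrict_cong, simp only: 2)
  qed
  then have "sheaf_iso (open_subspace X B) \<E> (free_sheaf (open_subspace X B) r)"
    by (intro sheaf_iso_freeI reg_closed_open_subspace B) (auto simp: cyclic_cover_def reg_closed_wvariety)
  then show "\<exists>W. open_in X W \<and> P \<in> W \<and> sheaf_iso (open_subspace X W) \<E> (free_sheaf (open_subspace X W) r)"
    using B \<open>P \<in> B\<close> by blast
qed

section \<open>Trivialising the direct image\<close>

lemma rat_onP_zero_of_dense:
  assumes V: "openP V" and h: "ratP V \<delta> h"
    and zero: "\<And>y. y \<in> coneP V \<Longrightarrow> f y \<noteq> 0 \<Longrightarrow> h y = 0"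
    and y: "y \<in> coneP V"
  shows "h y = 0"
proof -
  obtain e e' a b where 1: "a \<in> formsP e" "b \<in> formsP e'"
      "int e = int e' + \<delta>" "b y \<noteq> 0" "\<And>x. x \<in> coneP V \<Longrightarrow> b x * h x = a x"
    by (rule rat_onE[OF h y]) (rule that)
  have "a y = 0"
    by (rule form_zero_of_dense[OF V 1(1) _ y]) (use 1(5) zero in force)
  then show ?thesis using 1(4) 1(5)[OF y] by simp
qed

text \<open>Recovers \<open>v\<close> from the values of \<open>\<Phi> v\<close> on the sheets: the
  power sums remove all powers of \<open>A\<close> except the zeroth.\<close>

lemma sum_roots_app_phi:
  assumes "f y \<noteq> 0" and v: "v \<in> cvecs N"
  shows "(\<Sum>t\<in>{t. t ^ d = f y}. t * app (phi d (A y) t) v i) = of_nat d * f y * v i"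
proof -
  have "(\<Sum>t\<in>{t. t ^ d = f y}. t * app (phi d (A y) t) v i) =
      (\<Sum>t\<in>{t. t ^ d = f y}. \<Sum>l<d. t ^ Suc (d - Suc l) * app (A y ^\<^sub>m l) v i)"
    unfolding app_phi[OF A_carrier] by (simp add: sum_distrib_left mult.assoc)
  also have "\<dots> = (\<Sum>l<d. (\<Sum>t\<in>{t. t ^ d = f y}. t ^ Suc (d - Suc l)) * app (A y ^\<^sub>m l) v i)"
    unfolding sum_distrib_right by (rule sum.swap)
  also have "\<dots> = (\<Sum>l<d. if l = 0 then of_nat d * f y * app (A y ^\<^sub>m l) v i else 0)"
  proof (rule sum.cong)
    fix l assume l: "l \<in> {..<d}"
    then have "Suc (d - Suc l) = d \<longleftrightarrow> l = 0" by auto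
    then show "(\<Sum>t\<in>{t. t ^ d = f y}. t ^ Suc (d - Suc l)) * app (A y ^\<^sub>m l) v i =
        (if l = 0 then of_nat d * f y * app (A y ^\<^sub>m l) v i else 0)"
      using power_sum_roots[OF d assms(1), of "Suc (d - Suc l)"] l by (auto simp del: power_Suc pow_mat.simps)
  qed simp
  also have "\<dots> = of_nat d * f y * v i"
    using d app_pow_0[OF A_carrier v] by (simp del: pow_mat.simps)
  finally show ?thesis .
qed

definition pull_map :: "cvec set set \<Rightarrow> (nat \<Rightarrow> cvec set \<Rightarrow> complex) \<Rightarrow> cvec \<Rightarrow> cvec" where
  "pull_map V u = (\<lambda>x\<in>coneX V. app (Phi x) (zvec N u (orb wP (forget_t n x))))"

lemma pull_map_in:
  assumes V: "openP V" and u: "u \<in> {..<N} \<rightarrow>\<^sub>E regP V"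
  shows "pull_map V u \<in> sectionsE (preim V)"
    and "ratX (preim V) (int ((d - 1) * k)) (\<lambda>x. app (Phi x) (zvec N u (orb wP (forget_t n x))) i)"
proof -
  show *: "ratX (preim V) (int ((d - 1) * k)) (\<lambda>x. app (Phi x) (zvec N u (orb wP (forget_t n x))) i)" for i
  proof (rule rat_on_app[OF Phi_carrier Phi_form])
    show "ratX (preim V) 0 (\<lambda>x. zvec N u (orb wP (forget_t n x)) j)" if "j < N" for j
      using rat_on_pullback[OF V, of "u j"] u that by (simp add: zvec_def PiE_iff)
  qed simp_all
  show "pull_map V u \<in> sectionsE (preim V)"
  proof (rule sectionsI[where s' = "\<lambda>x. app (Phi x) (zvec N u (orb wP (forget_t n x)))"])
    show "app (Phi x) (zvec N u (orb wP (forget_t n x))) \<in> eigenspace x" if "x \<in> cone_over wX KX (preim V)" for x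
      using that by (intro app_Phi_in_eigenspace zvec_in) (simp add: cone_over_def)
    show "ratX (preim V) (int ((d - 1) * k)) (\<lambda>x. app (Phi x) (zvec N u (orb wP (forget_t n x))) i)" for i
      by (rule *)
  qed (simp_all add: pull_map_def cone_over_preim)
qed

text \<open>Summation over the sheets determines the coefficients only where
  \<open>f \<noteq> 0\<close>; density carries the equality to the branch locus.\<close>

lemma pull_map_inj:
  assumes V: "openP V"
  shows "inj_on (pull_map V) ({..<N} \<rightarrow>\<^sub>E regP V)"
proof (rule inj_onI)
  let ?R = "regP V" and ?C = "coneP V"
  fix u v assume u: "u \<in> {..<N} \<rightarrow>\<^sub>E ?R" and v: "v \<in> {..<N} \<rightarrow>\<^sub>E ?R" and eq: "pull_map V u = pull_map V v"
  have generic: "zvec N u (orb wP y) = zvec N v (orb wP y)" if y: "y \<in> ?C" "f y \<noteq> 0" for y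
  proof -
    have yK: "y \<in> KP" using y by (simp add: cone_over_def)
    have "app (phi d (A y) t) (zvec N u (orb wP y)) = app (phi d (A y) t) (zvec N v (orb wP y))" if t: "t ^ d = f y" for t
      using fun_cong[OF eq, of "y(Suc n := t)"] lift_in_coneX[OF y(1) t] lift_in(2)[OF yK t]
      by (simp add: pull_map_def Phi_def)
    then have "(\<Sum>t\<in>{t. t ^ d = f y}. t * app (phi d (A y) t) (zvec N u (orb wP y)) i) =
        (\<Sum>t\<in>{t. t ^ d = f y}. t * app (phi d (A y) t) (zvec N v (orb wP y)) i)" for i
      by (intro sum.cong) auto
    then show ?thesis
      unfolding sum_roots_app_phi[OF y(2) zvec_in] using y(2) d by auto
  qed
  show "u = v"
  proof (rule PiE_ext[OF u v])
    fix j assume j: "j \<in> {..<N}"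
    then have uv: "u j \<in> ?R" "v j \<in> ?R" using u v by (auto simp: PiE_iff)
    then have "u j \<in> extensional V" "v j \<in> extensional V" by (auto simp: wregular_def)
    then show "u j = v j"
    proof (rule extensionalityI)
      fix P assume P: "P \<in> V"
      then have "P \<in> orb wP ` KP" by (rule subsetD[OF wzariski_open_subset[OF V]])
      then obtain y where "P = orb wP y" "y \<in> KP" by (rule imageE)
      then have y: "y \<in> ?C" "P = orb wP y" using P by (simp_all add: cone_over_def)
      have "u j (orb wP y) + (- 1) * v j (orb wP y) = 0"
      proof (rule rat_onP_zero_of_dense[OF V _ _ y(1)])
        show "ratP V 0 (\<lambda>y. u j (orb wP y) + (- 1) * v j (orb wP y))"
          using uv[THEN wregularD[OF V]] by (intro rat_on_add rat_on_cmult)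
        show "u j (orb wP z) + (- 1) * v j (orb wP z) = 0" if "z \<in> ?C" "f z \<noteq> 0" for z
          using fun_cong[OF generic[OF that], of j] j by (simp add: zvec_def)
      qed
      then show "u j P = v j P" using y by simp
    qed
  qed
qed

text \<open>The candidate \<open>u\<close> is the sheet sum of \<open>t' * s\<close> divided by
  \<open>d * f\<close>. Applying \<open>\<Phi>\<close> at \<open>t\<close> annihilates the
  contributions of all sheets but one and multiplies the remaining one by
  \<open>d * t ^ d = d * f\<close>. As both sides are rational on the cone, checking this where
  \<open>f \<noteq> 0\<close> suffices.\<close>

lemma pull_map_surj:
  assumes V: "openP V"
    and s: "s \<in> sectionsE (preim V)"
  shows "s \<in> pull_map V ` ({..<N} \<rightarrow>\<^sub>E regP V)"
proof -
  let ?R = "regP V" and ?C = "coneP V"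
  note s' = sections_\<E>D[OF s, unfolded cone_over_preim]
  have "\<forall>i. \<exists>g. g \<in> ?R \<and> (\<forall>y\<in>?C. f y \<noteq> 0 \<longrightarrow> root_sum (\<lambda>x. s x i) y = of_nat d * f y * g (orb wP y))"
    using root_sum_regular[OF V s'(3)] by blast
  then obtain g where g: "\<forall>i. g i \<in> ?R \<and> (\<forall>y\<in>?C. f y \<noteq> 0 \<longrightarrow> root_sum (\<lambda>x. s x i) y = of_nat d * f y * g i (orb wP y))"
    unfolding choice_iff by (elim exE) (rule that)
  define u where "u = (\<lambda>i\<in>{..<N}. g i)"
  have u: "u \<in> {..<N} \<rightarrow>\<^sub>E ?R" using g by (simp add: u_def)
  have generic: "s x = app (Phi x) (zvec N u (orb wP (forget_t n x)))" if x: "x \<in> coneX V" and fx: "f (forget_t n x) \<noteq> 0" for x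
  proof -
    obtain y t where y: "y \<in> ?C" and t: "t ^ d = f y" and xy: "x = y(Suc n := t)" "forget_t n x = y" "x (Suc n) = t"
      by (rule coneX_lift[OF x]) (rule that)
    have fy: "f y \<noteq> 0" using fx xy by simp
    have yK: "y \<in> KP" using y by (simp add: cone_over_def)
    let ?T = "{t. t ^ d = f y}" and ?s = "\<lambda>t. s (y(Suc n := t))"
    have eig: "?s t' \<in> cvecs N" "app (A y) (?s t') = (\<lambda>i. t' * ?s t' i)" if "t' \<in> ?T" for t'
      using s'(2)[OF lift_in_coneX[OF y, of t']] lift_in(2)[OF yK, of t'] that by (auto simp: eigenspace_def)
    have sum_s: "(\<lambda>i. of_nat d * f y * zvec N u (orb wP y) i) = (\<lambda>i. \<Sum>t'\<in>?T. t' * ?s t' i)"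
    proof
      fix i
      show "of_nat d * f y * zvec N u (orb wP y) i = (\<Sum>t'\<in>?T. t' * ?s t' i)"
      proof (cases "i < N")
        case True
        then show ?thesis using g y fy by (simp add: zvec_def u_def root_sum_def)
      next
        case False
        then have "?s t' i = 0" if "t' \<in> ?T" for t' using eig(1)[OF that] by (simp add: cvecs_def)
        then show ?thesis using False by (simp add: zvec_def)
      qed
    qed
    have "of_nat d * f y * app (Phi x) (zvec N u (orb wP y)) i = of_nat d * f y * s x i" for i
    proof -
      have "of_nat d * f y * app (Phi x) (zvec N u (orb wP y)) i =
          app (Phi x) (\<lambda>i. of_nat d * f y * zvec N u (orb wP y) i) i"
        unfolding app_cmult ..
      also have "\<dots> = (\<Sum>t'\<in>?T. t' * app (Phi x) (?s t') i)"
        unfolding sum_s app_sum app_cmult ..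
      also have "\<dots> = (\<Sum>t'\<in>?T. if t' = t then t * (of_nat d * t ^ (d - 1) * ?s t i) else 0)"
      proof (rule sum.cong)
        fix t' assume t': "t' \<in> ?T"
        have "app (Phi x) (?s t') i = (if t' = t then of_nat d * t ^ (d - 1) else 0) * ?s t' i"
          unfolding Phi_def xy(2,3) app_phi_eigenvector[OF A_carrier eig[OF t']]
          using power_diff_quotient_roots[of t' d t] t t' by simp
        then show "t' * app (Phi x) (?s t') i = (if t' = t then t * (of_nat d * t ^ (d - 1) * ?s t i) else 0)"
          by simp
      qed simp
      also have "\<dots> = t * (of_nat d * t ^ (d - 1) * ?s t i)"
        using t finite_nth_roots[OF d fy] by simp
      also have "\<dots> = of_nat d * f y * s x i"
      proof -
        have "t * t ^ (d - 1) = f y" using t d by (cases d) auto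
        then show ?thesis unfolding xy(1) by (metis mult.assoc mult.left_commute)
      qed
      finally show ?thesis .
    qed
    then have "s x i = app (Phi x) (zvec N u (orb wP y)) i" for i using fy d by simp
    then show ?thesis unfolding xy(2) by (rule ext)
  qed
  have "pull_map V u = s"
  proof (rule extensionalityI[OF _ s'(1)])
    show "pull_map V u \<in> extensional (coneX V)" by (simp add: pull_map_def)
    fix x assume x: "x \<in> coneX V"
    have "s x i + (- 1) * app (Phi x) (zvec N u (orb wP (forget_t n x))) i = 0" for i
    proof (rule rat_on_zero_of_dense[OF V _ _ x])
      show "ratX (preim V) (int ((d - 1) * k))
          (\<lambda>x. s x i + (- 1) * app (Phi x) (zvec N u (orb wP (forget_t n x))) i)"
        by (intro rat_on_add rat_on_cmult s'(3) pull_map_in(2)[OF V u])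
      show "s z i + (- 1) * app (Phi z) (zvec N u (orb wP (forget_t n z))) i = 0"
        if "z \<in> coneX V" "f (forget_t n z) \<noteq> 0" for z
        using generic[OF that] by simp
    qed
    then show "pull_map V u x = s x" using x by (simp add: pull_map_def fun_eq_iff)
  qed
  then show ?thesis using u by blast
qed

lemma pushforward_\<E>: "sheaf_iso (proj_space n) (pushforward X (cover_map n) \<E>) (free_sheaf (proj_space n) N)"
proof (rule sheaf_iso_freeI)
  show "reg_closed (proj_space n)" unfolding proj_space_def by (rule reg_closed_wvariety)
  show "sheaf_iso_map (proj_space n) (free_sheaf (proj_space n) N) (pushforward X (cover_map n) \<E>) pull_map"
    unfolding sheaf_iso_map_def
  proof (intro allI impI conjI ballI)
    fix U assume "open_in (proj_space n) U"
    then have U: "openP U" by (simp add: proj_space_def open_in_wvariety)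
    have "bij_betw (pull_map U) ({..<N} \<rightarrow>\<^sub>E regP U)
        (sectionsE (preim U))"
      unfolding bij_betw_def using pull_map_inj[OF U] pull_map_in(1)[OF U] pull_map_surj[OF U] by blast
    then show "bij_betw (pull_map U) (carrier (sect (free_sheaf (proj_space n) N) U))
        (carrier (sect (pushforward X (cover_map n) \<E>) U))"
      by (simp add: free_sheaf_def section_sheaf_def pushforward_def Let_def proj_space_def reg_fun_wvariety flip: preim_def)
    have in_preim: "orb wX x \<in> preim U \<longleftrightarrow> orb wP (forget_t n x) \<in> U" if "x \<in> KX" for x
      using that by (auto simp: preim_def cyclic_cover_def pts_wvariety cover_map_orb)
    fix s
    show "pull_map U (s \<oplus>\<^bsub>sect (free_sheaf (proj_space n) N) U\<^esub> t) =
        pull_map U s \<oplus>\<^bsub>sect (pushforward X (cover_map n) \<E>) U\<^esub> pull_map U t" for t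
      by (simp add: free_sheaf_def section_sheaf_def pushforward_def Let_def pull_map_def cone_over_preim flip: preim_def)
        (rule extensional_restrict_cong, simp add: zvec_add app_add coneX_def)
    show "pull_map U (g \<odot>\<^bsub>sect (free_sheaf (proj_space n) N) U\<^esub> s) =
        g \<odot>\<^bsub>sect (pushforward X (cover_map n) \<E>) U\<^esub> pull_map U s" for g
      by (simp add: free_sheaf_def section_sheaf_def pushforward_def Let_def pull_map_def cone_over_preim flip: preim_def)
        (rule extensional_restrict_cong, simp add: zvec_smult app_cmult coneX_def in_preim cover_map_orb)
    fix V assume V: "V \<subseteq> U"
    then have 1: "coneX U \<inter> coneX V = coneX V" by (auto simp: coneX_def)
    show "pull_map V (rstr (free_sheaf (proj_space n) N) U V s) =
        rstr (pushforward X (cover_map n) \<E>) U V (pull_map U s)"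
      by (simp add: free_sheaf_def section_sheaf_def pushforward_def Let_def pull_map_def cone_over_preim 1 flip: preim_def)
        (rule extensional_restrict_cong, simp add: zvec_restrict coneX_def)
  qed
qed

lemma ulrich_bundle_\<E>: "ulrich_bundle X (proj_space n) (cover_map n) d \<E>"
proof -
  \<comment> \<open>That \<open>d\<close> divides \<open>N\<close> is read off at a single point of
    \<open>X\<close>, so a point is produced first, above some \<open>y\<close> with
    \<open>f y \<noteq> 0\<close>.\<close>
  obtain y where y: "y \<in> cvecs (Suc n)" "f y \<noteq> 0" using f_nonzero by blast
  have "y \<in> KP"
  proof (rule ccontr)
    assume "y \<notin> KP"
    then have "y i = 0" for i using y(1) by (cases "i \<le> n") (auto simp: cvecs_def)
    then have "y = (\<lambda>_. 0)" by (rule ext)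
    then show False using wforms_0[OF f] d k y(2) by simp
  qed
  moreover obtain t where "t ^ d = f y" using exists_nth_root[OF d] by blast
  ultimately obtain x where "x \<in> KX" using lift_in(1) by blast
  then obtain r where r: "r * d = N" using exists_rank_factorization by blast
  then have "r > 0" using N by (cases r) auto
  then show ?thesis
    unfolding ulrich_bundle_def using vector_bundle_\<E>[OF r] pushforward_\<E> r by blast
qed

end

text \<open>If \<open>f\<close> vanished on all these vectors, so would its partial derivatives, and
  the Jacobian criterion would fail at a coordinate point.\<close>

lemma smooth_hypersurface_nonzero:
  assumes "smooth_hypersurface n f"
  shows "\<exists>x\<in>cvecs (Suc n). f x \<noteq> 0"
proof (rule ccontr)
  assume "\<not> (\<exists>x\<in>cvecs (Suc n). f x \<noteq> 0)"
  then have zero: "f x = 0" if "x \<in> cvecs (Suc n)" for x using that by blast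
  define x :: cvec where "x = (\<lambda>i. if i = 0 then 1 else 0)"
  have x: "x \<in> cvecs (Suc n)" "x 0 \<noteq> 0" by (auto simp: x_def cvecs_def)
  have "partial_deriv i f x = 0" if "i \<le> n" for i
  proof -
    have "x(i := z) \<in> cvecs (Suc n)" for z using x that by (auto simp: cvecs_def)
    then have "(\<lambda>z. f (x(i := z))) = (\<lambda>z. 0)" using zero by simp
    then show ?thesis by (simp add: partial_deriv_def)
  qed
  then show False
    using assms x zero[OF x(1)] unfolding smooth_hypersurface_def by blast
qed

theorem theorem1p1:
  fixes n d k :: nat and f :: "cvec \<Rightarrow> complex"
  assumes "n \<ge> 1" and "d \<ge> 1" and "k \<ge> 1"
    and "f \<in> wforms (Suc n) (\<lambda>_. 1) (d * k)"
    and "smooth_hypersurface n f"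
  shows "\<exists>E :: (cvec set, cvec \<Rightarrow> cvec) mod_presheaf.
           ulrich_bundle (cyclic_cover n d k f) (proj_space n) (cover_map n) d E"
proof -
  have dk: "d > 0" "k > 0" using assms(2,3) by auto
  from exists_matrix_root[OF assms(4) dk(1)] obtain N A \<gamma>
    where A: "N > 0 \<and> (\<forall>x. A x \<in> carrier_mat N N \<and> A x ^\<^sub>m d = f x \<cdot>\<^sub>m 1\<^sub>m N \<and> graded d \<gamma> (A x)) \<and>
      (\<forall>i<N. \<forall>j<N. (\<lambda>x. A x $$ (i, j)) \<in> wforms (Suc n) (\<lambda>_. 1) k)"
    by (elim exE) (rule that)
  interpret cover_root n d k f N A \<gamma>
    by unfold_locales (use A dk assms(4,5) smooth_hypersurface_nonzero[OF assms(5)] in simp_all)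
  show ?thesis
    using ulrich_bundle_\<E> by blast
qed

end
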